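(* For $\epsilon,\delta\in\mathbb{R}_{>0}$ it is decidable whether an MLSL formula holds globally in an MLSL transition sequence with $\epsilon$-$\delta$-robustness. That is, there is an algorithm which, given a finite set of cars $\mathbb{I}$ with physical lengths, a finite set of lanes, $b_{max}$, an initial MLSL model $M$, a timed word $\rho$ satisfying the separation assumption for $\epsilon$ (see context), an MLSL formula $\phi$, and $\epsilon,\delta>0$, decides whether $\rho(M)\models^{\epsilon,\delta}_{seq}G\,\phi$.
   Context: Cars and snapshots. $\mathbb{I}$ is a finite set of cars, $\mathbb{L}=\{1,\dots,k\}$ a finite set of lanes, each car $C$ has physical length $pl(C)>0$, $b_{max}>0$ is a fixed maximal deceleration. A traffic snapshot is $TS=(pos,len,spd,acc,res,clm)$, $pos:\mathbb{I}\to\mathbb{R}$, $len:\mathbb{I}\to\mathbb{R}_{>0}$, $spd,acc:\mathbb{I}\to\mathbb{R}$, $res,clm:\mathbb{I}\to\mathcal{P}(\mathbb{L})$. Transitions ($n\in\mathbb{L}$, $a\in\mathbb{R}$, $z\ge0$): $acc(C,a)$ sets $acc(C):=a$; $c(C,n)$ requires $res(C)=\{n'\}$ with $n'\in\{n\pm1\}$ and $clm(C)=\emptyset$, and sets $clm(C):=\{n\}$; $r(C)$ sets $res(C):=res(C)\cup clm(C)$, $clm(C):=\emptyset$; $wd\,c(C)$ sets $clm(C):=\emptyset$; $wd\,r(C,n)$ requires $n\in res(C)$ and sets $res(C):=\{n\}$; a delay $z$ sets for all $C$: $pos(C):=pos(C)+spd(C)z+\frac12acc(C)z^2$, $spd(C):=spd(C)+acc(C)z$,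 $len(C):=\frac{(spd(C)+acc(C)z)^2}{b_{max}}+pl(C)$. Timed words. $\Sigma_C=\{c(C,n),r(C),wd\,c(C),wd\,r(C,n),acc(C,a)\}$, $\Sigma=\bigcup_C\Sigma_C$, $\Sigma_{acc}=\{acc(C,a)\mid C\in\mathbb{I},a\in\mathbb{R}\}$. A timed word $\rho=(\sigma,\tau)$ has $\sigma=\sigma_1\cdots\sigma_{n-1}\dagger$ (end marker $\dagger\notin\Sigma$) and weakly increasing $\tau_1\cdots\tau_n\in\mathbb{R}_{\ge0}$; $span(\rho)=[0,\tau_n]$. The projection $\rho\restriction\Sigma'$ keeps exactly the positions whose letters lie in $\Sigma'\cup\{\dagger\}$, with their time stamps. $\rho(TS_1)$ is $TS_1\xrightarrow{\tau_1}\cdot\xrightarrow{\sigma_1}\cdot\xrightarrow{\tau_2-\tau_1}\cdots\xrightarrow{\sigma_{n-1}}\cdot\xrightarrow{\tau_n-\tau_{n-1}}TS_{2n}\xrightarrow{0}TS_{2n}$; only timed words for which all transitions exist are considered, and $r(C)$, $wd\,c(C)$, $wd\,r(C,n)$ transitions must change the snapshot. For $t\in span(\rho)$, $\rho(TS)@t$ is the last snapshot of $\rho_t(TS)$, where $\rho_t=(\sigma_1,\tau_1)\cdots(\sigma_i,\tau_i)(\dagger,t)$ with $i$ maximal such that $\tau_i\le t$ (a $\dagger$ acts as no change). Views and models. A view is $V=(L,X,E)$, $L=[l,n]$ lanes (empty if $l>n$), $X=[r,t]$, owner $E$; $V^{L'}=(L',X,E)$, $V_{X'}=(L,X',E)$.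 A valuation $\nu:CVar\cup\{ego\}\to\mathbb{I}$ has $\nu(ego)=E$. A model is $M=(TS,V,\nu)$; $\rho(M)@t=(\rho(TS)@t,([l,n],[r+\Delta,t+\Delta],E),\nu)$, $\Delta$ the displacement of $pos(E)$ from time $0$ to $t$. MLSL syntax: $\phi::=\gamma=\gamma'\mid free\mid re(\gamma)\mid cl(\gamma)\mid\ell=q\mid\neg\phi\mid\phi\wedge\phi\mid\exists c.\phi\mid\phi\frown\phi\mid\begin{smallmatrix}\phi\\\phi\end{smallmatrix}$, $q\in\mathbb{Q}$. Semantics for $M=(TS,([l,n],[r,t],E),\nu)$: $\gamma=\gamma'$ iff $\nu(\gamma)=\nu(\gamma')$; $free$ iff $l=n$, $r<t$ and every car $C$ has $l\notin res(C)\cup clm(C)$ or $[pos(C),pos(C)+len(C)]\cap(r,t)=\emptyset$; $re(\gamma)$ iff $l=n$, $r<t$, $l\in res(\nu(\gamma))$, $[r,t]\subseteq[pos(\nu(\gamma)),pos(\nu(\gamma))+len(\nu(\gamma))]$; $cl(\gamma)$ likewise with $clm$; $\ell=q$ iff $t-r=q$; boolean connectives as usual; $\exists c.\phi$ iff $(TS,V,\nu[c\mapsto C])\models\phi$ for some $C$; $\phi_1\frown\phi_2$ iff for some $s\in[r,t]$, $(TS,V_{[r,s]},\nu)\models\phi_1$ and $(TS,V_{[s,t]},\nu)\models\phi_2$; $\begin{smallmatrix}\phi_2\\\phi_1\end{smallmatrix}$ iff (if $l\le n$: some $m\in[l-1,n]$ with $(TS,V^{[l,m]},\nu)\models\phi_1$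 and $(TS,V^{[m+1,n]},\nu)\models\phi_2$) and (if $l>n$: $M\models\phi_1$ and $M\models\phi_2$). Similarity. Independence relation: $I=\bigcup_{C\ne C'}\Sigma_C\times\Sigma_{C'}\cup\bigcup_C I_C$, where $I_C$ relates (in both orders) each of $c(C,n),r(C),wd\,c(C),wd\,r(C,n)$ to each $acc(C,a)$. Words $\sigma,\sigma'$ are causally equivalent if $\sigma'$ is obtained from $\sigma$ by finitely many swaps of adjacent letters $(\sigma_i,\sigma_{i+1})\in I$. Model metric: $d_{model}(M,M')=\infty$ if $res\ne res'$, $clm\ne clm'$, $L\ne L'$ or $\nu\ne\nu'$; otherwise $\max_C\{|pos(C)-pos'(C)|,|pos(C)+len(C)-pos'(C)-len'(C)|,|r-r'|,|t-t'|\}$. Timed-word metric: $d_{time}(\rho,\rho')=\infty$ if the untimed words are not causally equivalent, or $\rho\restriction\Sigma_{acc}\ne\rho'\restriction\Sigma_{acc}$, or $span(\rho)\ne span(\rho')$; otherwise $\max_C\max_i|\tau_{C,i}-\tau'_{C,i}|$, where $(\sigma_C,\tau_C)=\rho\restriction(\Sigma_C\setminus\Sigma_{acc})$ and $(\sigma_C,\tau'_C)=\rho'\restriction(\Sigma_C\setminus\Sigma_{acc})$. Robust satisfaction: $M\models^\delta\phi$ iff $M'\models\phi$ for all models $M'$ with $d_{model}(M,M')\le\delta$. $\rho(M)\models^\delta_{seq}G\phi$ iff $\rho(M)@t\models^\delta\phi$ for all $t\in span(\rho)$. $\rho(M)\models^{\epsilon,\delta}_{seq}G\phi$ iff $\rho'(M)\models^\delta_{seq}G\phi$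 for every (admissible) timed word $\rho'$ with $d_{time}(\rho,\rho')\le\epsilon$. Separation assumption for $\epsilon$: for every car $C$, writing $\rho\restriction\Sigma_C=(\sigma_C,\tau_C)$ of length $n_C$, $|\tau_{C,i}-\tau_{C,j}|>2\epsilon$ for all $i\ne j$ in $\{1,\dots,n_C\}$. *)

theory Defs
  imports Complex_Main "HOL-Library.Extended_Real" "HOL-Library.Nat_Bijection"
begin

section \<open>Traffic snapshots and their transitions\<close>

text \<open>
  Car identifiers are natural numbers, so that a finite set of cars can be part of the input of an
  algorithm. Lanes are integers, because the semantics of the vertical chop uses the bound
  \<open>l - 1\<close>. Functions on cars are total; only their values on \<open>cars T\<close> are meaningful, and
  everything below looks only at these.
\<close>

type_synonym car = nat
type_synonym lane = int

record traffic =
  cars :: "car set"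
  nlanes :: nat
  plen :: "car \<Rightarrow> real"
  bmax :: real

definition lanes :: "traffic \<Rightarrow> lane set" where
  "lanes T = {1..int (nlanes T)}"

definition wf_traffic :: "traffic \<Rightarrow> bool" where
  "wf_traffic T \<longleftrightarrow> finite (cars T) \<and> (\<forall>C\<in>cars T. 0 < plen T C) \<and> 0 < bmax T"

record snapshot =
  pos :: "car \<Rightarrow> real"
  len :: "car \<Rightarrow> real"
  spd :: "car \<Rightarrow> real"
  acc :: "car \<Rightarrow> real"
  res :: "car \<Rightarrow> lane set"
  clm :: "car \<Rightarrow> lane set"

definition wf_snapshot :: "traffic \<Rightarrow> snapshot \<Rightarrow> bool" where
  "wf_snapshot T S \<longleftrightarrow>
     (\<forall>C\<in>cars T. 0 < len S C \<and> res S C \<subseteq> lanes T \<and> clm S C \<subseteq> lanes T)"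

text \<open>The parameter \<open>'r\<close> is \<open>real\<close> for actions, and \<open>nat\<close> for actions whose accelerations are
  given by names of reals.\<close>

datatype 'r action =
    Claim car lane
  | Reserve car
  | WdClaim car
  | WdRes car lane
  | Acc car 'r

fun car_of :: "'r action \<Rightarrow> car" where
  "car_of (Claim C n) = C"
| "car_of (Reserve C) = C"
| "car_of (WdClaim C) = C"
| "car_of (WdRes C n) = C"
| "car_of (Acc C a) = C"

fun is_acc :: "'r action \<Rightarrow> bool" where
  "is_acc (Acc C a) \<longleftrightarrow> True"
| "is_acc _ \<longleftrightarrow> False"

definition alphabet :: "traffic \<Rightarrow> real action set" where
  "alphabet T = {a. car_of a \<in> cars T \<and>
     (case a of Claim C n \<Rightarrow> n \<in> lanes T | WdRes C n \<Rightarrow> n \<in> lanes T | _ \<Rightarrow> True)}"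

fun effect :: "real action \<Rightarrow> snapshot \<Rightarrow> snapshot" where
  "effect (Claim C n) S = S\<lparr>clm := (clm S)(C := {n})\<rparr>"
| "effect (Reserve C) S = S\<lparr>res := (res S)(C := res S C \<union> clm S C), clm := (clm S)(C := {})\<rparr>"
| "effect (WdClaim C) S = S\<lparr>clm := (clm S)(C := {})\<rparr>"
| "effect (WdRes C n) S = S\<lparr>res := (res S)(C := {n})\<rparr>"
| "effect (Acc C a) S = S\<lparr>acc := (acc S)(C := a)\<rparr>"

text \<open>Besides the precondition of the transition, \<open>enabled\<close> contains the requirement that
  transitions for reservations and withdrawals change the snapshot.\<close>

fun enabled :: "snapshot \<Rightarrow> real action \<Rightarrow> bool" where
  "enabled S (Claim C n) \<longleftrightarrow> (\<exists>n'\<in>{n - 1, n + 1}. res S C = {n'}) \<and> clm S C = {}"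
| "enabled S (Reserve C) \<longleftrightarrow> effect (Reserve C) S \<noteq> S"
| "enabled S (WdClaim C) \<longleftrightarrow> effect (WdClaim C) S \<noteq> S"
| "enabled S (WdRes C n) \<longleftrightarrow> n \<in> res S C \<and> effect (WdRes C n) S \<noteq> S"
| "enabled S (Acc C a) \<longleftrightarrow> True"

definition delay :: "traffic \<Rightarrow> real \<Rightarrow> snapshot \<Rightarrow> snapshot" where
  "delay T z S = S
     \<lparr>pos := (\<lambda>C. pos S C + spd S C * z + 1/2 * acc S C * z\<^sup>2),
      spd := (\<lambda>C. spd S C + acc S C * z),
      len := (\<lambda>C. (spd S C + acc S C * z)\<^sup>2 / bmax T + plen T C)\<rparr>"


section \<open>Timed words\<close>

text \<open>The second component is the time stamp of the end marker.\<close>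

type_synonym timed_word = "(real action \<times> real) list \<times> real"

definition wf_timed_word :: "traffic \<Rightarrow> timed_word \<Rightarrow> bool" where
  "wf_timed_word T \<rho> \<longleftrightarrow>
     fst ` set (fst \<rho>) \<subseteq> alphabet T \<and>
     sorted (map snd (fst \<rho>) @ [snd \<rho>]) \<and>
     (\<forall>\<tau>\<in>set (map snd (fst \<rho>) @ [snd \<rho>]). 0 \<le> \<tau>)"

definition time_span :: "timed_word \<Rightarrow> real set" where
  "time_span \<rho> = {0..snd \<rho>}"

definition untimed :: "timed_word \<Rightarrow> real action list" where
  "untimed \<rho> = map fst (fst \<rho>)"

definition project :: "timed_word \<Rightarrow> real action set \<Rightarrow> timed_word" where
  "project \<rho> A = (filter (\<lambda>(a, \<tau>). a \<in> A) (fst \<rho>), snd \<rho>)"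

definition stamps :: "timed_word \<Rightarrow> real list" where
  "stamps \<rho> = map snd (fst \<rho>) @ [snd \<rho>]"

text \<open>\<open>exec T t\<^sub>0 w t\<^sub>1 S\<close> is the last snapshot of the transition sequence that starts in \<open>S\<close>
  at time \<open>t\<^sub>0\<close>, performs the actions of \<open>w\<close> at their time stamps and ends at time \<open>t\<^sub>1\<close>;
  \<open>None\<close> if one of the transitions does not exist.\<close>

fun exec :: "traffic \<Rightarrow> real \<Rightarrow> (real action \<times> real) list \<Rightarrow> real \<Rightarrow> snapshot \<Rightarrow> snapshot option"
where
  "exec T t\<^sub>0 [] t\<^sub>1 S = Some (delay T (t\<^sub>1 - t\<^sub>0) S)"
| "exec T t\<^sub>0 ((a, \<tau>) # w) t\<^sub>1 S =
     (let S' = delay T (\<tau> - t\<^sub>0) S in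
      if enabled S' a then exec T \<tau> w t\<^sub>1 (effect a S') else None)"

definition run :: "traffic \<Rightarrow> timed_word \<Rightarrow> snapshot \<Rightarrow> snapshot option" where
  "run T \<rho> S = exec T 0 (fst \<rho>) (snd \<rho>) S"

definition admissible :: "traffic \<Rightarrow> snapshot \<Rightarrow> timed_word \<Rightarrow> bool" where
  "admissible T S \<rho> \<longleftrightarrow> wf_timed_word T \<rho> \<and> run T \<rho> S \<noteq> None"

definition cut :: "timed_word \<Rightarrow> real \<Rightarrow> timed_word" where
  "cut \<rho> t = (takeWhile (\<lambda>(a, \<tau>). \<tau> \<le> t) (fst \<rho>), t)"

definition snapshot_at :: "traffic \<Rightarrow> timed_word \<Rightarrow> snapshot \<Rightarrow> real \<Rightarrow> snapshot" where
  "snapshot_at T \<rho> S t = the (run T (cut \<rho> t) S)"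


section \<open>Views, models and MLSL\<close>

text \<open>The lanes of a view are \<open>{lo..hi}\<close>, possibly none; its extension is \<open>{left..right}\<close>,
  which has to be nonempty.\<close>

record view =
  lo :: lane
  hi :: lane
  left :: real
  right :: real
  owner :: car

datatype cvar = Ego | CVar nat

record model =
  snap :: snapshot
  view :: view
  val :: "cvar \<Rightarrow> car"

definition wf_view :: "traffic \<Rightarrow> view \<Rightarrow> bool" where
  "wf_view T V \<longleftrightarrow> {lo V..hi V} \<subseteq> lanes T \<and> left V \<le> right V \<and> owner V \<in> cars T"

definition wf_model :: "traffic \<Rightarrow> model \<Rightarrow> bool" where
  "wf_model T M \<longleftrightarrow> wf_snapshot T (snap M) \<and> wf_view T (view M) \<and>
     range (val M) \<subseteq> cars T \<and> val M Ego = owner (view M)"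

definition model_at :: "traffic \<Rightarrow> timed_word \<Rightarrow> model \<Rightarrow> real \<Rightarrow> model" where
  "model_at T \<rho> M t =
     (let S = snapshot_at T \<rho> (snap M) t;
          E = owner (view M);
          \<Delta> = pos S E - pos (snap M) E
      in M\<lparr>snap := S,
           view := (view M)\<lparr>left := left (view M) + \<Delta>, right := right (view M) + \<Delta>\<rparr>\<rparr>)"

text \<open>\<open>VChop \<phi>\<^sub>2 \<phi>\<^sub>1\<close> has \<open>\<phi>\<^sub>2\<close> on the upper lanes and \<open>\<phi>\<^sub>1\<close> on the lower lanes.\<close>

datatype mlsl =
    Same cvar cvar
  | Free
  | Re cvar
  | Cl cvar
  | Length rat
  | Neg mlsl
  | Conj mlsl mlsl
  | Ex nat mlsl
  | HChop mlsl mlsl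
  | VChop mlsl mlsl

definition extent :: "snapshot \<Rightarrow> car \<Rightarrow> real set" where
  "extent S C = {pos S C..pos S C + len S C}"

primrec holds :: "traffic \<Rightarrow> snapshot \<Rightarrow> mlsl \<Rightarrow> view \<Rightarrow> (cvar \<Rightarrow> car) \<Rightarrow> bool" where
  "holds T S (Same x y) V \<nu> \<longleftrightarrow> \<nu> x = \<nu> y"
| "holds T S Free V \<nu> \<longleftrightarrow> lo V = hi V \<and> left V < right V \<and>
     (\<forall>C\<in>cars T. lo V \<notin> res S C \<union> clm S C \<or> extent S C \<inter> {left V<..<right V} = {})"
| "holds T S (Re x) V \<nu> \<longleftrightarrow> lo V = hi V \<and> left V < right V \<and>
     lo V \<in> res S (\<nu> x) \<and> {left V..right V} \<subseteq> extent S (\<nu> x)"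
| "holds T S (Cl x) V \<nu> \<longleftrightarrow> lo V = hi V \<and> left V < right V \<and>
     lo V \<in> clm S (\<nu> x) \<and> {left V..right V} \<subseteq> extent S (\<nu> x)"
| "holds T S (Length q) V \<nu> \<longleftrightarrow> right V - left V = of_rat q"
| "holds T S (Neg \<phi>) V \<nu> \<longleftrightarrow> \<not> holds T S \<phi> V \<nu>"
| "holds T S (Conj \<phi> \<psi>) V \<nu> \<longleftrightarrow> holds T S \<phi> V \<nu> \<and> holds T S \<psi> V \<nu>"
| "holds T S (Ex c \<phi>) V \<nu> \<longleftrightarrow> (\<exists>C\<in>cars T. holds T S \<phi> V (\<nu>(CVar c := C)))"
| "holds T S (HChop \<phi> \<psi>) V \<nu> \<longleftrightarrow>
     (\<exists>s\<in>{left V..right V}. holds T S \<phi> (V\<lparr>right := s\<rparr>) \<nu> \<and> holds T S \<psi> (V\<lparr>left := s\<rparr>) \<nu>)"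
| "holds T S (VChop \<phi>\<^sub>2 \<phi>\<^sub>1) V \<nu> \<longleftrightarrow>
     (if lo V \<le> hi V
      then \<exists>m\<in>{lo V - 1..hi V}.
             holds T S \<phi>\<^sub>1 (V\<lparr>hi := m\<rparr>) \<nu> \<and> holds T S \<phi>\<^sub>2 (V\<lparr>lo := m + 1\<rparr>) \<nu>
      else holds T S \<phi>\<^sub>1 V \<nu> \<and> holds T S \<phi>\<^sub>2 V \<nu>)"

definition sat :: "traffic \<Rightarrow> model \<Rightarrow> mlsl \<Rightarrow> bool" where
  "sat T M \<phi> \<longleftrightarrow> holds T (snap M) \<phi> (view M) (val M)"


section \<open>Similarity\<close>

definition indep :: "real action \<Rightarrow> real action \<Rightarrow> bool" where
  "indep a b \<longleftrightarrow> car_of a \<noteq> car_of b \<or> (car_of a = car_of b \<and> is_acc a \<noteq> is_acc b)"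

inductive swap :: "real action list \<Rightarrow> real action list \<Rightarrow> bool" where
  "indep a b \<Longrightarrow> swap (u @ [a, b] @ v) (u @ [b, a] @ v)"

definition causally_equiv :: "real action list \<Rightarrow> real action list \<Rightarrow> bool" where
  "causally_equiv = swap\<^sup>*\<^sup>*"

definition d_model :: "traffic \<Rightarrow> model \<Rightarrow> model \<Rightarrow> ereal" where
  "d_model T M M' =
     (let S = snap M; S' = snap M'; V = view M; V' = view M' in
      if (\<exists>C\<in>cars T. res S C \<noteq> res S' C \<or> clm S C \<noteq> clm S' C) \<or>
         {lo V..hi V} \<noteq> {lo V'..hi V'} \<or> val M \<noteq> val M'
      then \<infinity>
      else ereal (MAX C\<in>cars T. Max
        {\<bar>pos S C - pos S' C\<bar>,
         \<bar>pos S C + len S C - pos S' C - len S' C\<bar>,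
         \<bar>left V - left V'\<bar>,
         \<bar>right V - right V'\<bar>}))"

definition Sigma_acc :: "real action set" where
  "Sigma_acc = {a. is_acc a}"

definition Sigma_car :: "car \<Rightarrow> real action set" where
  "Sigma_car C = {a. car_of a = C}"

definition d_time :: "traffic \<Rightarrow> timed_word \<Rightarrow> timed_word \<Rightarrow> ereal" where
  "d_time T \<rho> \<rho>' =
     (if \<not> causally_equiv (untimed \<rho>) (untimed \<rho>') \<or>
         project \<rho> Sigma_acc \<noteq> project \<rho>' Sigma_acc \<or>
         time_span \<rho> \<noteq> time_span \<rho>'
      then \<infinity>
      else ereal (MAX C\<in>cars T.
        let \<tau> = stamps (project \<rho> (Sigma_car C - Sigma_acc));
            \<tau>' = stamps (project \<rho>' (Sigma_car C - Sigma_acc))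
        in MAX i\<in>{..<length \<tau>}. \<bar>\<tau> ! i - \<tau>' ! i\<bar>))"

definition separated :: "traffic \<Rightarrow> real \<Rightarrow> timed_word \<Rightarrow> bool" where
  "separated T \<epsilon> \<rho> \<longleftrightarrow>
     (\<forall>C\<in>cars T. let \<tau> = stamps (project \<rho> (Sigma_car C)) in
        \<forall>i<length \<tau>. \<forall>j<length \<tau>. i \<noteq> j \<longrightarrow> 2 * \<epsilon> < \<bar>\<tau> ! i - \<tau> ! j\<bar>)"


section \<open>Robust satisfaction\<close>

definition robust_sat :: "traffic \<Rightarrow> real \<Rightarrow> model \<Rightarrow> mlsl \<Rightarrow> bool" where
  "robust_sat T \<delta> M \<phi> \<longleftrightarrow> (\<forall>M'. wf_model T M' \<and> d_model T M M' \<le> ereal \<delta> \<longrightarrow> sat T M' \<phi>)"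

definition robust_globally :: "traffic \<Rightarrow> real \<Rightarrow> timed_word \<Rightarrow> model \<Rightarrow> mlsl \<Rightarrow> bool" where
  "robust_globally T \<delta> \<rho> M \<phi> \<longleftrightarrow>
     (\<forall>t\<in>time_span \<rho>. robust_sat T \<delta> (model_at T \<rho> M t) \<phi>)"

definition robust_globally_seq ::
  "traffic \<Rightarrow> real \<Rightarrow> real \<Rightarrow> timed_word \<Rightarrow> model \<Rightarrow> mlsl \<Rightarrow> bool" where
  "robust_globally_seq T \<epsilon> \<delta> \<rho> M \<phi> \<longleftrightarrow>
     (\<forall>\<rho>'. admissible T (snap M) \<rho>' \<and> d_time T \<rho> \<rho>' \<le> ereal \<epsilon> \<longrightarrow>
        robust_globally T \<delta> \<rho>' M \<phi>)"


section \<open>Partial recursive functions\<close>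

datatype recf =
    Zero
  | Succ
  | Proj nat
  | Comp recf "recf list"
  | PrimRec recf recf
  | Mu recf

text \<open>\<open>computes p xs y\<close>: the program \<open>p\<close> halts on the arguments \<open>xs\<close> with the result \<open>y\<close>.\<close>

inductive computes :: "recf \<Rightarrow> nat list \<Rightarrow> nat \<Rightarrow> bool" where
  zero: "computes Zero xs 0"
| succ: "computes Succ [x] (Suc x)"
| proj: "i < length xs \<Longrightarrow> computes (Proj i) xs (xs ! i)"
| comp: "list_all2 (\<lambda>g y. computes g xs y) gs ys \<Longrightarrow> computes f ys z \<Longrightarrow>
           computes (Comp f gs) xs z"
| primrec_0: "computes f xs y \<Longrightarrow> computes (PrimRec f g) (0 # xs) y"
| primrec_Suc: "computes (PrimRec f g) (n # xs) y \<Longrightarrow> computes g (n # y # xs) z \<Longrightarrow>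
           computes (PrimRec f g) (Suc n # xs) z"
| mu: "computes f (n # xs) 0 \<Longrightarrow> (\<forall>m<n. \<exists>y. computes f (m # xs) (Suc y)) \<Longrightarrow>
           computes (Mu f) xs n"

lemma computes_deterministic:
  "computes p xs y \<Longrightarrow> computes p xs z \<Longrightarrow> y = z"
proof (induction arbitrary: z rule: computes.induct)
  case (comp xs gs ys f y)
  from comp.prems obtain zs where zs: "list_all2 (\<lambda>g y. computes g xs y) gs zs" "computes f zs z"
    by (cases rule: computes.cases) auto
  have "ys = zs"
    using comp.IH(1) zs(1) by (intro nth_equalityI) (auto simp: list_all2_conv_all_nth)
  then show ?case using comp.IH(2) zs(2) by blast
next
  case (primrec_0 f xs y g)
  from primrec_0.prems show ?case
    by (cases rule: computes.cases) (auto intro: primrec_0.IH)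
next
  case (primrec_Suc f g n xs y w)
  from primrec_Suc.prems obtain y' where "computes (PrimRec f g) (n # xs) y'"
    "computes g (n # y' # xs) z"
    by (cases rule: computes.cases) auto
  then show ?case using primrec_Suc.IH by blast
next
  case (mu f n xs)
  from mu.prems have z: "computes f (z # xs) 0" "\<forall>m<z. \<exists>y. computes f (m # xs) (Suc y)"
    by (cases rule: computes.cases; auto)+
  have "\<not> z < n" using mu.IH(2) z(1) by fastforce
  moreover have "\<not> n < z" using mu.IH(1) z(2) by fastforce
  ultimately show ?case by simp
qed (auto elim: computes.cases)

definition computable2 :: "(nat \<Rightarrow> nat \<Rightarrow> nat) \<Rightarrow> bool" where
  "computable2 f \<longleftrightarrow> (\<exists>p. \<forall>x y. computes p [x, y] (f x y))"


section \<open>Finite representation of the input\<close>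

text \<open>
  The real numbers in the input of an algorithm must be given by finite names. Any constructive
  ordered field in the sense of Mal'cev will do: \<open>R n\<close> is the real number with the name \<open>n\<close>
  (a number may have several names), the named numbers form a subfield of the reals, and on names
  the field operations are computable and the order is decidable. The rational numbers are the
  basic example (see \<open>rat_name_constructive\<close> below); the real algebraic numbers are another one.
  In HOL, \<open>x / 0 = 0\<close>.
\<close>

definition constructive_field :: "(nat \<Rightarrow> real) \<Rightarrow> bool" where
  "constructive_field R \<longleftrightarrow>
     1 \<in> range R \<and>
     (\<exists>f. computable2 f \<and> (\<forall>x y. R (f x y) = R x + R y)) \<and>
     (\<exists>f. computable2 f \<and> (\<forall>x y. R (f x y) = R x - R y)) \<and>
     (\<exists>f. computable2 f \<and> (\<forall>x y. R (f x y) = R x * R y)) \<and>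
     (\<exists>f. computable2 f \<and> (\<forall>x y. R (f x y) = R x / R y)) \<and>
     computable2 (\<lambda>x y. if R x < R y then 1 else 0)"

fun cvar_code :: "cvar \<Rightarrow> nat" where
  "cvar_code Ego = 0"
| "cvar_code (CVar c) = Suc c"

definition rat_code :: "rat \<Rightarrow> nat" where
  "rat_code q = (case quotient_of q of (a, b) \<Rightarrow> prod_encode (int_encode a, int_encode b))"

fun mlsl_code :: "mlsl \<Rightarrow> nat" where
  "mlsl_code (Same x y) = list_encode [0, cvar_code x, cvar_code y]"
| "mlsl_code Free = list_encode [1]"
| "mlsl_code (Re x) = list_encode [2, cvar_code x]"
| "mlsl_code (Cl x) = list_encode [3, cvar_code x]"
| "mlsl_code (Length q) = list_encode [4, rat_code q]"
| "mlsl_code (Neg \<phi>) = list_encode [5, mlsl_code \<phi>]"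
| "mlsl_code (Conj \<phi> \<psi>) = list_encode [6, mlsl_code \<phi>, mlsl_code \<psi>]"
| "mlsl_code (Ex c \<phi>) = list_encode [7, c, mlsl_code \<phi>]"
| "mlsl_code (HChop \<phi> \<psi>) = list_encode [8, mlsl_code \<phi>, mlsl_code \<psi>]"
| "mlsl_code (VChop \<phi> \<psi>) = list_encode [9, mlsl_code \<phi>, mlsl_code \<psi>]"

fun free_vars :: "mlsl \<Rightarrow> cvar set" where
  "free_vars (Same x y) = {x, y}"
| "free_vars Free = {}"
| "free_vars (Re x) = {x}"
| "free_vars (Cl x) = {x}"
| "free_vars (Length q) = {}"
| "free_vars (Neg \<phi>) = free_vars \<phi>"
| "free_vars (Conj \<phi> \<psi>) = free_vars \<phi> \<union> free_vars \<psi>"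
| "free_vars (Ex c \<phi>) = free_vars \<phi> - {CVar c}"
| "free_vars (HChop \<phi> \<psi>) = free_vars \<phi> \<union> free_vars \<psi>"
| "free_vars (VChop \<phi> \<psi>) = free_vars \<phi> \<union> free_vars \<psi>"

fun action_code :: "nat action \<Rightarrow> nat" where
  "action_code (Claim C n) = list_encode [0, C, int_encode n]"
| "action_code (Reserve C) = list_encode [1, C]"
| "action_code (WdClaim C) = list_encode [2, C]"
| "action_code (WdRes C n) = list_encode [3, C, int_encode n]"
| "action_code (Acc C a) = list_encode [4, C, a]"

definition lanes_code :: "lane list \<Rightarrow> nat" where
  "lanes_code ns = list_encode (map int_encode ns)"

text \<open>
  \<open>encodes R n T M \<rho> \<phi> \<epsilon> \<delta>\<close>: the number \<open>n\<close> describes the given data, reals being replaced by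
  names with respect to \<open>R\<close>. The list \<open>cs\<close> has an entry for each car (car, physical length,
  position, length, speed, acceleration, reserved lanes, claimed lanes). A valuation is an
  infinite object; \<open>vs\<close> lists its values on finitely many variables, among them those that are
  free in the formula.
\<close>

definition encodes ::
  "(nat \<Rightarrow> real) \<Rightarrow> nat \<Rightarrow> traffic \<Rightarrow> model \<Rightarrow> timed_word \<Rightarrow> mlsl \<Rightarrow> real \<Rightarrow> real \<Rightarrow> bool" where
  "encodes R n T M \<rho> \<phi> \<epsilon> \<delta> \<longleftrightarrow>
     (\<exists>(cs :: (car \<times> nat \<times> nat \<times> nat \<times> nat \<times> nat \<times> lane list \<times> lane list) list)
       (vs :: (cvar \<times> car) list) (w :: (nat action \<times> nat) list) b r t \<tau> e d.
        n = list_encode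
          [list_encode (map (\<lambda>(C, p, x, l, s, a, rs, ks).
             list_encode [C, p, x, l, s, a, lanes_code rs, lanes_code ks]) cs),
           nlanes T, b,
           int_encode (lo (view M)), int_encode (hi (view M)), r, t, owner (view M),
           list_encode (map (\<lambda>(v, C). prod_encode (cvar_code v, C)) vs),
           list_encode (map (\<lambda>(a, t). prod_encode (action_code a, t)) w), \<tau>,
           mlsl_code \<phi>, e, d] \<and>
        cars T = fst ` set cs \<and>
        (\<forall>(C, p, x, l, s, a, rs, ks)\<in>set cs.
           plen T C = R p \<and> pos (snap M) C = R x \<and> len (snap M) C = R l \<and>
           spd (snap M) C = R s \<and> acc (snap M) C = R a \<and>
           res (snap M) C = set rs \<and> clm (snap M) C = set ks) \<and>
        bmax T = R b \<and> left (view M) = R r \<and> right (view M) = R t \<and>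
        free_vars \<phi> \<subseteq> fst ` set vs \<and> (\<forall>(v, C)\<in>set vs. val M v = C) \<and>
        \<rho> = (map (\<lambda>(a, t). (map_action R a, R t)) w, R \<tau>) \<and>
        \<epsilon> = R e \<and> \<delta> = R d)"


section \<open>The rational numbers form a constructive field\<close>

definition rat_name :: "nat \<Rightarrow> real" where
  "rat_name n = (case prod_decode n of (a, m) \<Rightarrow> case prod_decode m of (b, c) \<Rightarrow>
     (real a - real b) / (real c + 1))"

lemma range_rat_name: "range rat_name = \<rat>"
proof (intro equalityI subsetI)
  fix x :: real assume "x \<in> \<rat>"
  then obtain i j :: int where ij: "0 < j" "x = of_int i / of_int j"
    by (metis Rats_cases')
  define a b c where "a = nat i" and "b = nat (- i)" and "c = nat (j - 1)"
  have "real a - real b = of_int i" "real c + 1 = of_int j"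
    using ij(1) by (auto simp: a_def b_def c_def)
  then have "x = rat_name (prod_encode (a, prod_encode (b, c)))"
    by (simp add: rat_name_def ij(2))
  then show "x \<in> range rat_name" by blast
qed (auto simp: rat_name_def split: prod.splits)

definition computable_on :: "nat \<Rightarrow> (nat list \<Rightarrow> nat) \<Rightarrow> bool" where
  "computable_on k f \<longleftrightarrow> (\<exists>p. \<forall>xs. length xs = k \<longrightarrow> computes p xs (f xs))"

named_theorems comp_intros

lemma computable_on_comp1:
  assumes "computable_on 1 (\<lambda>xs. f (xs ! 0))" "computable_on k a"
  shows "computable_on k (\<lambda>xs. f (a xs))"
proof -
  obtain p q where p: "\<And>xs. length xs = 1 \<Longrightarrow> computes p xs (f (xs ! 0))"
    and q: "\<And>xs. length xs = k \<Longrightarrow> computes q xs (a xs)"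
    using assms unfolding computable_on_def by blast
  have "computes (Comp p [q]) xs (f (a xs))" if "length xs = k" for xs
    using p[of "[a xs]"] q[OF that] by (intro computes.comp[where ys = "[a xs]"]) auto
  then show ?thesis unfolding computable_on_def by blast
qed

lemma computable_on_comp2:
  assumes "computable_on 2 (\<lambda>xs. f (xs ! 0) (xs ! 1))" "computable_on k a" "computable_on k b"
  shows "computable_on k (\<lambda>xs. f (a xs) (b xs))"
proof -
  obtain p q r where p: "\<And>xs. length xs = 2 \<Longrightarrow> computes p xs (f (xs ! 0) (xs ! 1))"
    and q: "\<And>xs. length xs = k \<Longrightarrow> computes q xs (a xs)"
    and r: "\<And>xs. length xs = k \<Longrightarrow> computes r xs (b xs)"
    using assms unfolding computable_on_def by blast
  have "computes (Comp p [q, r]) xs (f (a xs) (b xs))" if "length xs = k" for xs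
    using p[of "[a xs, b xs]"] q[OF that] r[OF that]
    by (intro computes.comp[where ys = "[a xs, b xs]"]) auto
  then show ?thesis unfolding computable_on_def by blast
qed

lemma computable_on_nth [comp_intros]: "i < k \<Longrightarrow> computable_on k (\<lambda>xs. xs ! i)"
  unfolding computable_on_def using computes.proj by metis

lemma computable_on_Suc [comp_intros]:
  assumes "computable_on k a" shows "computable_on k (\<lambda>xs. Suc (a xs))"
proof (rule computable_on_comp1[OF _ assms])
  have "computes Succ xs (Suc (xs ! 0))" if "length xs = 1" for xs
    using computes.succ that by (cases xs) auto
  then show "computable_on 1 (\<lambda>xs. Suc (xs ! 0))"
    unfolding computable_on_def by blast
qed

lemma computable_on_const [comp_intros]: "computable_on k (\<lambda>xs. c)"
proof (induction c)
  case 0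
  show ?case unfolding computable_on_def using computes.zero by blast
qed (rule computable_on_Suc)

lemma computable_on_rec1:
  assumes g: "computable_on 2 (\<lambda>xs. g (xs ! 0) (xs ! 1))"
  shows "computable_on 1 (\<lambda>xs. rec_nat c g (xs ! 0))"
proof -
  obtain p q where p: "\<And>xs. length xs = 0 \<Longrightarrow> computes p xs c"
    and q: "\<And>xs. length xs = 2 \<Longrightarrow> computes q xs (g (xs ! 0) (xs ! 1))"
    using computable_on_const[of 0 c] g unfolding computable_on_def by blast
  have *: "computes (PrimRec p q) [n] (rec_nat c g n)" for n
  proof (induction n)
    case (Suc n)
    then show ?case
      using q[of "[n, rec_nat c g n]"] by (auto intro: computes.primrec_Suc)
  qed (auto intro: computes.primrec_0 p)
  have "computes (PrimRec p q) xs (rec_nat c g (xs ! 0))" if "length xs = 1" for xs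
    using that * by (cases xs) auto
  then show ?thesis unfolding computable_on_def by blast
qed

lemma computable_on_rec2:
  assumes f: "computable_on 1 (\<lambda>xs. f (xs ! 0))"
    and g: "computable_on 3 (\<lambda>xs. g (xs ! 2) (xs ! 0) (xs ! 1))"
  shows "computable_on 2 (\<lambda>xs. rec_nat (f (xs ! 1)) (g (xs ! 1)) (xs ! 0))"
proof -
  obtain p q where p: "\<And>xs. length xs = 1 \<Longrightarrow> computes p xs (f (xs ! 0))"
    and q: "\<And>xs. length xs = 3 \<Longrightarrow> computes q xs (g (xs ! 2) (xs ! 0) (xs ! 1))"
    using f g unfolding computable_on_def by blast
  have *: "computes (PrimRec p q) [n, m] (rec_nat (f m) (g m) n)" for n m
  proof (induction n)
    case 0
    then show ?case using p[of "[m]"] by (auto intro: computes.primrec_0)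
  next
    case (Suc n)
    then show ?case
      using q[of "[n, rec_nat (f m) (g m) n, m]"] by (auto intro: computes.primrec_Suc)
  qed
  have "computes (PrimRec p q) xs (rec_nat (f (xs ! 1)) (g (xs ! 1)) (xs ! 0))"
    if xs: "length xs = 2" for xs
  proof -
    have "xs = [xs ! 0, xs ! 1]"
      using xs by (intro nth_equalityI) (auto simp: less_Suc_eq numeral_2_eq_2)
    with * show ?thesis by metis
  qed
  then show ?thesis unfolding computable_on_def by blast
qed

lemma computable_on_add [comp_intros]:
  assumes "computable_on k a" "computable_on k b"
  shows "computable_on k (\<lambda>xs. a xs + b xs)"
proof (rule computable_on_comp2[OF _ assms])
  have "rec_nat m (\<lambda>_. Suc) n = n + m" for n m :: nat by (induction n) auto
  then show "computable_on 2 (\<lambda>xs. xs ! 0 + xs ! 1)"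
    using computable_on_rec2[of "\<lambda>m. m" "\<lambda>_ _. Suc"] by (simp add: comp_intros)
qed

lemma computable_on_mult [comp_intros]:
  assumes "computable_on k a" "computable_on k b"
  shows "computable_on k (\<lambda>xs. a xs * b xs)"
proof (rule computable_on_comp2[OF _ assms])
  have "rec_nat 0 (\<lambda>_ r. r + m) n = n * m" for n m :: nat by (induction n) auto
  then show "computable_on 2 (\<lambda>xs. xs ! 0 * xs ! 1)"
    using computable_on_rec2[of "\<lambda>m. 0" "\<lambda>m _ r. r + m"] by (simp add: comp_intros)
qed

lemma computable_on_pred:
  assumes "computable_on k a"
  shows "computable_on k (\<lambda>xs. a xs - 1)"
proof (rule computable_on_comp1[OF _ assms])
  have "rec_nat 0 (\<lambda>n _. n) n = n - 1" for n :: nat by (cases n) auto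
  then show "computable_on 1 (\<lambda>xs. xs ! 0 - 1)"
    using computable_on_rec1[of "\<lambda>n _. n" 0] by (simp add: comp_intros)
qed

lemma computable_on_diff [comp_intros]:
  assumes "computable_on k a" "computable_on k b"
  shows "computable_on k (\<lambda>xs. a xs - b xs)"
proof (rule computable_on_comp2[where f = "\<lambda>n m. m - n", OF _ assms(2,1)])
  have "rec_nat m (\<lambda>_ r. r - 1) n = m - n" for n m :: nat by (induction n) auto
  then show "computable_on 2 (\<lambda>xs. xs ! 1 - xs ! 0)"
    using computable_on_rec2[of "\<lambda>m. m" "\<lambda>m _ r. r - 1"]
    by (simp add: comp_intros computable_on_pred del: One_nat_def)
qed

lemma computable_on_if [comp_intros]:
  assumes "computable_on k a" "computable_on k b" "computable_on k c" "computable_on k d"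
  shows "computable_on k (\<lambda>xs. if a xs < b xs then c xs else d xs)"
proof -
  have "computable_on k (\<lambda>xs. (1 - (1 - (b xs - a xs))) * c xs + (1 - (b xs - a xs)) * d xs)"
    by (intro comp_intros assms)
  moreover have "(1 - (1 - (b xs - a xs))) * c xs + (1 - (b xs - a xs)) * d xs =
      (if a xs < b xs then c xs else d xs)" for xs
    by auto
  ultimately show ?thesis by simp
qed

lemma computable_on_triangle [comp_intros]:
  assumes "computable_on k a"
  shows "computable_on k (\<lambda>xs. triangle (a xs))"
proof (rule computable_on_comp1[OF _ assms])
  have "rec_nat 0 (\<lambda>n r. r + Suc n) n = triangle n" for n by (induction n) auto
  then show "computable_on 1 (\<lambda>xs. triangle (xs ! 0))"
    using computable_on_rec1[of "\<lambda>n r. r + Suc n" 0]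
    by (simp add: comp_intros del: add_Suc_right)
qed

lemma computable_on_prod_encode [comp_intros]:
  assumes "computable_on k a" "computable_on k b"
  shows "computable_on k (\<lambda>xs. prod_encode (a xs, b xs))"
  unfolding prod_encode_def prod.case by (intro comp_intros assms)

definition triangle_root :: "nat \<Rightarrow> nat" where
  "triangle_root = rec_nat 0 (\<lambda>n r. if Suc n < triangle (Suc r) then r else Suc r)"

lemma triangle_root: "triangle (triangle_root n) \<le> n \<and> n < triangle (Suc (triangle_root n))"
proof (induction n)
  case (Suc n)
  then show ?case
    by (auto simp: triangle_root_def)
qed (auto simp: triangle_root_def)

lemma prod_decode_triangle_root:
  "prod_decode n = (n - triangle (triangle_root n),
     triangle_root n - (n - triangle (triangle_root n)))"
proof -
  have "n = prod_encode (n - triangle (triangle_root n),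
     triangle_root n - (n - triangle (triangle_root n)))"
    using triangle_root[of n] by (simp add: prod_encode_def)
  then show ?thesis by (metis prod_encode_inverse)
qed

lemma computable_on_triangle_root [comp_intros]:
  assumes "computable_on k a"
  shows "computable_on k (\<lambda>xs. triangle_root (a xs))"
  unfolding triangle_root_def
  by (rule computable_on_comp1[OF computable_on_rec1 assms]) (intro comp_intros; simp)

lemma computable_on_decode [comp_intros]:
  assumes "computable_on k a"
  shows "computable_on k (\<lambda>xs. fst (prod_decode (a xs)))"
    and "computable_on k (\<lambda>xs. snd (prod_decode (a xs)))"
  unfolding prod_decode_triangle_root fst_conv snd_conv by (intro comp_intros assms)+

lemma computable2I:
  assumes "computable_on 2 (\<lambda>xs. f (xs ! 0) (xs ! 1))"
  shows "computable2 f"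
proof -
  obtain p where "\<And>xs. length xs = 2 \<Longrightarrow> computes p xs (f (xs ! 0) (xs ! 1))"
    using assms unfolding computable_on_def by blast
  from this[of "[_, _]"] show ?thesis unfolding computable2_def by auto
qed

theorem rat_name_constructive: "constructive_field rat_name"
proof -
  define A where "A n = fst (prod_decode n)" for n
  define B where "B n = fst (prod_decode (snd (prod_decode n)))" for n
  define D where "D n = Suc (snd (prod_decode (snd (prod_decode n))))" for n
  define mk where "mk a b c = prod_encode (a, prod_encode (b, c - 1))" for a b c :: nat
  have R: "rat_name n = (real (A n) - real (B n)) / real (D n)" for n
    by (simp add: rat_name_def A_def B_def D_def case_prod_beta)
  have mk: "rat_name (mk a b c) = (real a - real b) / real c" if "0 < c" for a b c
    using that by (simp add: rat_name_def mk_def)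
  have D: "0 < D n" for n by (simp add: D_def)
  note [comp_intros] = computable_on_pred

  have "1 \<in> range rat_name" by (simp add: range_rat_name)
  moreover have "computable2 (\<lambda>x y. mk (A x * D y + A y * D x) (B x * D y + B y * D x) (D x * D y))"
    unfolding mk_def A_def B_def D_def by (rule computable2I) (intro comp_intros; simp)
  moreover have "rat_name (mk (A x * D y + A y * D x) (B x * D y + B y * D x) (D x * D y)) =
      rat_name x + rat_name y" for x y
    by (subst mk) (use D[of x] D[of y] in \<open>simp_all add: R field_simps\<close>)
  moreover have "computable2 (\<lambda>x y. mk (A x * D y + B y * D x) (B x * D y + A y * D x) (D x * D y))"
    unfolding mk_def A_def B_def D_def by (rule computable2I) (intro comp_intros; simp)
  moreover have "rat_name (mk (A x * D y + B y * D x) (B x * D y + A y * D x) (D x * D y)) =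
      rat_name x - rat_name y" for x y
    by (subst mk) (use D[of x] D[of y] in \<open>simp_all add: R field_simps\<close>)
  moreover have "computable2 (\<lambda>x y. mk (A x * A y + B x * B y) (A x * B y + B x * A y) (D x * D y))"
    unfolding mk_def A_def B_def D_def by (rule computable2I) (intro comp_intros; simp)
  moreover have "rat_name (mk (A x * A y + B x * B y) (A x * B y + B x * A y) (D x * D y)) =
      rat_name x * rat_name y" for x y
    by (subst mk) (use D[of x] D[of y] in \<open>simp_all add: R field_simps\<close>)
  moreover have "computable2 (\<lambda>x y.
      if B y < A y then mk (A x * D y) (B x * D y) (D x * (A y - B y))
      else if A y < B y then mk (B x * D y) (A x * D y) (D x * (B y - A y))
      else mk 0 0 1)"
    unfolding mk_def A_def B_def D_def by (rule computable2I) (intro comp_intros; simp)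
  moreover have "rat_name
      (if B y < A y then mk (A x * D y) (B x * D y) (D x * (A y - B y))
       else if A y < B y then mk (B x * D y) (A x * D y) (D x * (B y - A y))
       else mk 0 0 1) = rat_name x / rat_name y" for x y
  proof -
    consider "B y < A y" | "A y < B y" | "A y = B y" by linarith
    then show ?thesis
    proof cases
      case 1
      then have "rat_name (mk (A x * D y) (B x * D y) (D x * (A y - B y))) =
          (real (A x * D y) - real (B x * D y)) / real (D x * (A y - B y))"
        using D[of x] by (intro mk) simp
      also have "\<dots> = ((real (A x) - real (B x)) * real (D y)) /
          (real (D x) * (real (A y) - real (B y)))"
        using 1 by (simp only: of_nat_mult of_nat_diff less_imp_le left_diff_distrib)
      also have "\<dots> = rat_name x / rat_name y"
        unfolding R by simp
      finally show ?thesis using 1 by simp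
    next
      case 2
      then have "rat_name (mk (B x * D y) (A x * D y) (D x * (B y - A y))) =
          (real (B x * D y) - real (A x * D y)) / real (D x * (B y - A y))"
        using D[of x] by (intro mk) simp
      also have "\<dots> = ((real (B x) - real (A x)) * real (D y)) /
          (real (D x) * (real (B y) - real (A y)))"
        using 2 by (simp only: of_nat_mult of_nat_diff less_imp_le left_diff_distrib)
      also have "\<dots> = (- (real (A x) - real (B x)) * real (D y)) /
          (real (D x) * - (real (A y) - real (B y)))"
        by simp
      also have "\<dots> = rat_name x / rat_name y"
        unfolding R by (simp del: minus_diff_eq)
      finally show ?thesis using 2 by simp
    next
      case 3
      then show ?thesis using mk[of 1 0 0] by (simp add: R[of x] R[of y])
    qed
  qed
  moreover have "computable2 (\<lambda>x y. if rat_name x < rat_name y then 1 else 0)"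
  proof -
    have "rat_name x < rat_name y \<longleftrightarrow> A x * D y + B y * D x < A y * D x + B x * D y" for x y
    proof -
      have "rat_name x < rat_name y \<longleftrightarrow>
          (real (A x) - real (B x)) * real (D y) < (real (A y) - real (B y)) * real (D x)"
        unfolding R using D[of x] D[of y] by (simp add: pos_divide_less_eq pos_less_divide_eq)
      also have "\<dots> \<longleftrightarrow> real (A x * D y + B y * D x) < real (A y * D x + B x * D y)"
        by (simp add: left_diff_distrib) linarith
      finally show ?thesis by (simp only: of_nat_less_iff)
    qed
    moreover have "computable2 (\<lambda>x y.
        if A x * D y + B y * D x < A y * D x + B x * D y then 1 else 0)"
      unfolding A_def B_def D_def by (rule computable2I) (intro comp_intros; simp)
    ultimately show ?thesis by simp
  qed
  ultimately show ?thesis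
    unfolding constructive_field_def by (intro conjI exI allI) assumption+
qed

end

theory Submission
  imports Defs
begin

text \<open>
  The accelerations and their time stamps are the same in all similar timed words, so the position
  of a car and the end of its braking distance are fixed piecewise quadratic functions of time with
  named coefficients. Only reservations and claims are moved by the perturbation of time stamps.
  Separation makes these shifts independent of each other: at time \<open>t\<close> a car \<open>C\<close> can be in the
  state reached after a prefix of its actions if and only if \<open>t\<close> lies in a certain interval.

  For a fixed time and fixed lanes, MLSL speaks about order and differences of positions, ends and
  chop points only. Hence the violation of the formula by some perturbed model is a first-order
  statement over difference constraints, from which Fourier--Motzkin elimination removes all
  variables except the time. There remain systems of quadratic inequalities in one variable; these
  are decided by testing the roots \<open>a + b \<surd>d\<close> and the points immediately to the right of them, where
  the signs can be found by field operations and comparisons of names.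
\<close>

section \<open>Computable functions on encoded data\<close>

text \<open>\<open>computable\<close> asks for programs that halt on every number, also on numbers
  that encode no input. Recursion on formulas branches and changes lanes and valuations on the way,
  which \<open>PrimRec\<close> does not offer directly; \<open>computable_tree_rec\<close> replaces
  it by a search for certificates.

  Difference constraints are the right fragment because they are closed under all that MLSL needs:
  negation turns a strict constraint into a reversed weak one, and eliminating a chop point adds two
  constraints in which it cancels. No coefficients other than 1 and -1 arise, and the offsets stay
  in the named field. Time is substituted after the elimination only. The values substituted must
  then be single quadratic functions, so time is cut into closed pieces between consecutive stamps.

  Separation enters at the end marker: a letter delayed by \<epsilon> must not pass it. The order
  among the letters of one car survives because they are shifted by clamping their stamps, which is
  monotone.\<close>

class enc =
  fixes enc :: "'a \<Rightarrow> nat"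

instantiation nat :: enc begin
definition enc_nat :: "nat \<Rightarrow> nat" where "enc_nat n = n"
instance ..
end

instantiation bool :: enc begin
definition enc_bool :: "bool \<Rightarrow> nat" where "enc_bool b = (if b then 1 else 0)"
instance ..
end

instantiation prod :: (enc, enc) enc begin
definition enc_prod :: "'a \<times> 'b \<Rightarrow> nat" where "enc_prod p = prod_encode (enc (fst p), enc (snd p))"
instance ..
end

instantiation list :: (enc) enc begin
definition enc_list :: "'a list \<Rightarrow> nat" where "enc_list xs = list_encode (map enc xs)"
instance ..
end

lemma enc_nat_id [simp]: "enc = (id :: nat \<Rightarrow> nat)"
  by (auto simp: enc_nat_def)

text \<open>The realizer is total: on numbers that encode no element of \<open>'a\<close> it may
  take any value, but its program has to halt there as well.\<close>

definition realizes :: "(nat \<Rightarrow> nat) \<Rightarrow> ('a::enc \<Rightarrow> 'b::enc) \<Rightarrow> bool" where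
  "realizes g f \<longleftrightarrow> computable_on 1 (\<lambda>xs. g (xs ! 0)) \<and> (\<forall>x. g (enc x) = enc (f x))"

definition computable :: "('a::enc \<Rightarrow> 'b::enc) \<Rightarrow> bool" where
  "computable f \<longleftrightarrow> (\<exists>g. realizes g f)"

lemmas computableD = computable_def[THEN iffD1]

lemma computableI:
  assumes "computable_on 1 (\<lambda>xs. g (xs ! 0))" "\<And>x. g (enc x) = enc (f x)"
  shows "computable f"
  using assms unfolding computable_def realizes_def by blast

lemma realizesD:
  assumes "realizes g f"
  shows "computable_on k a \<Longrightarrow> computable_on k (\<lambda>xs. g (a xs))" "g (enc x) = enc (f x)"
  using assms computable_on_comp1[of g k a] by (auto simp: realizes_def)

named_theorems computable_intros

lemma computable_nat_iff:
  fixes f :: "nat \<Rightarrow> nat"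
  shows "computable f \<longleftrightarrow> computable_on 1 (\<lambda>xs. f (xs ! 0))"
proof
  assume "computable f"
  then obtain g where "computable_on 1 (\<lambda>xs. g (xs ! 0))" and g: "\<And>n. g n = f n"
    by (auto simp: computable_def realizes_def)
  then show "computable_on 1 (\<lambda>xs. f (xs ! 0))" by simp
qed (auto intro: computableI)

lemma computable_ident [computable_intros]: "computable (\<lambda>x. x)"
  by (rule computableI[where g = "\<lambda>n. n"]) (auto intro: comp_intros)

lemma computable_const [computable_intros]: "computable (\<lambda>x. c)"
  by (rule computableI[where g = "\<lambda>n. enc c"]) (auto intro: comp_intros)

lemma computable_compose:
  assumes "computable f" "computable g"
  shows "computable (\<lambda>x. f (g x))"
proof -
  obtain f' where "realizes f' f" using computableD[OF assms(1)] by blast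
  note f = realizesD[OF this]
  obtain g' where "realizes g' g" using computableD[OF assms(2)] by blast
  note g = realizesD[OF this]
  show ?thesis
    by (rule computableI[where g = "\<lambda>n. f' (g' n)"]) (auto intro!: f(1) g(1) comp_intros simp: f(2) g(2))
qed

lemma computable_Pair [computable_intros]:
  assumes "computable f" "computable g"
  shows "computable (\<lambda>x. (f x, g x))"
proof -
  obtain f' where "realizes f' f" using computableD[OF assms(1)] by blast
  note f = realizesD[OF this]
  obtain g' where "realizes g' g" using computableD[OF assms(2)] by blast
  note g = realizesD[OF this]
  show ?thesis
    by (rule computableI[where g = "\<lambda>n. prod_encode (f' n, g' n)"])
      (auto intro!: f(1) g(1) comp_intros simp: f(2) g(2) enc_prod_def)
qed

lemma computable_compose2:
  assumes "computable (\<lambda>p. f (fst p) (snd p))" "computable a" "computable b"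
  shows "computable (\<lambda>x. f (a x) (b x))"
  using computable_compose[OF assms(1) computable_Pair[OF assms(2,3)]] by simp

lemma computable_compose3:
  assumes "computable (\<lambda>p. f (fst p) (fst (snd p)) (snd (snd p)))"
    "computable a" "computable b" "computable c"
  shows "computable (\<lambda>x. f (a x) (b x) (c x))"
  using computable_compose[OF assms(1) computable_Pair[OF assms(2) computable_Pair[OF assms(3,4)]]]
  by simp

lemma computable_fst [computable_intros]:
  assumes "computable f" shows "computable (\<lambda>x. fst (f x))"
  by (rule computable_compose[OF _ assms],
      rule computableI[where g = "\<lambda>n. fst (prod_decode n)"])
    (auto intro: comp_intros simp: enc_prod_def)

lemma computable_snd [computable_intros]:
  assumes "computable f" shows "computable (\<lambda>x. snd (f x))"
  by (rule computable_compose[OF _ assms],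
      rule computableI[where g = "\<lambda>n. snd (prod_decode n)"])
    (auto intro: comp_intros simp: enc_prod_def)

lemma computable_nat_binop:
  fixes h :: "nat \<Rightarrow> nat \<Rightarrow> nat"
  assumes "\<And>k a b. computable_on k a \<Longrightarrow> computable_on k b \<Longrightarrow> computable_on k (\<lambda>xs. h (a xs) (b xs))"
    and "computable a" "computable b"
  shows "computable (\<lambda>x. h (a x) (b x))"
  by (rule computable_compose2[OF _ assms(2,3)],
      rule computableI[where g = "\<lambda>n. h (fst (prod_decode n)) (snd (prod_decode n))"])
    (auto intro!: comp_intros assms(1) simp: enc_prod_def)

lemma computable_add [computable_intros]:
  "computable a \<Longrightarrow> computable b \<Longrightarrow> computable (\<lambda>x. a x + b x :: nat)"
  by (rule computable_nat_binop) (auto intro: comp_intros)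

lemma computable_mult [computable_intros]:
  "computable a \<Longrightarrow> computable b \<Longrightarrow> computable (\<lambda>x. a x * b x :: nat)"
  by (rule computable_nat_binop) (auto intro: comp_intros)

lemma computable_diff [computable_intros]:
  "computable a \<Longrightarrow> computable b \<Longrightarrow> computable (\<lambda>x. a x - b x :: nat)"
  by (rule computable_nat_binop) (auto intro: comp_intros)

lemma computable_Suc [computable_intros]:
  assumes "computable a" shows "computable (\<lambda>x. Suc (a x))"
  using computable_add[OF computable_const[of 1] assms] by simp

lemma computable_if [computable_intros]:
  assumes "computable b" "computable f" "computable g"
  shows "computable (\<lambda>x. if b x then f x else g x)"
proof -
  obtain b' where "realizes b' b" using computableD[OF assms(1)] by blast
  note b = realizesD[OF this]
  obtain f' where "realizes f' f" using computableD[OF assms(2)] by blast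
  note f = realizesD[OF this]
  obtain g' where "realizes g' g" using computableD[OF assms(3)] by blast
  note g = realizesD[OF this]
  show ?thesis
    by (rule computableI[where g = "\<lambda>n. if 0 < b' n then f' n else g' n"], intro comp_intros b f g)
      (auto simp: b(2) f(2) g(2) enc_bool_def)
qed

lemma computable_not [computable_intros]:
  "computable b \<Longrightarrow> computable (\<lambda>x. \<not> b x)"
proof -
  assume "computable b"
  then have "computable (\<lambda>x. if b x then False else True)" by (intro computable_intros)
  moreover have "(\<lambda>x. if b x then False else True) = (\<lambda>x. \<not> b x)" by auto
  ultimately show ?thesis by simp
qed

lemma computable_conj [computable_intros]:
  "computable b \<Longrightarrow> computable c \<Longrightarrow> computable (\<lambda>x. b x \<and> c x)"
proof -
  assume "computable b" "computable c"
  then have "computable (\<lambda>x. if b x then c x else False)" by (intro computable_intros)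
  moreover have "(\<lambda>x. if b x then c x else False) = (\<lambda>x. b x \<and> c x)" by auto
  ultimately show ?thesis by simp
qed

lemma computable_disj [computable_intros]:
  "computable b \<Longrightarrow> computable c \<Longrightarrow> computable (\<lambda>x. b x \<or> c x)"
  using computable_not[OF computable_conj[OF computable_not computable_not], of b c] by simp

lemma computable_less [computable_intros]:
  "computable a \<Longrightarrow> computable b \<Longrightarrow> computable (\<lambda>x. (a x :: nat) < b x)"
  by (erule computable_compose2[rotated], assumption,
      rule computableI[where g = "\<lambda>n. if fst (prod_decode n) < snd (prod_decode n) then 1 else 0"],
      intro comp_intros)
    (auto simp: enc_prod_def enc_bool_def)

lemma computable_le [computable_intros]:
  "computable a \<Longrightarrow> computable b \<Longrightarrow> computable (\<lambda>x. (a x :: nat) \<le> b x)"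
  using computable_not[OF computable_less, of b a] by (simp add: not_less)

lemma computable_eq_nat [computable_intros]:
  "computable a \<Longrightarrow> computable b \<Longrightarrow> computable (\<lambda>x. (a x :: nat) = b x)"
  using computable_conj[OF computable_le computable_le, of a b b a] by (simp add: eq_iff)

lemma computable_Let [computable_intros]:
  assumes "computable a" "computable (\<lambda>p. f (fst p) (snd p))"
  shows "computable (\<lambda>x. Let (a x) (f x))"
  unfolding Let_def by (rule computable_compose2[OF assms(2) computable_ident assms(1)])

lemma computable_Cons [computable_intros]:
  assumes "computable f" "computable g"
  shows "computable (\<lambda>x. f x # g x)"
proof -
  obtain f' where "realizes f' f" using computableD[OF assms(1)] by blast
  note f = realizesD[OF this]
  obtain g' where "realizes g' g" using computableD[OF assms(2)] by blast
  note g = realizesD[OF this]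
  show ?thesis
    by (rule computableI[where g = "\<lambda>n. Suc (prod_encode (f' n, g' n))"])
      (auto intro!: f(1) g(1) comp_intros simp: f(2) g(2) enc_list_def)
qed

text \<open>The empty list has code 0, and the predecessor of any other list code is the code of the
  pair of head and tail, so one test and one subtraction decide the case.\<close>

lemma computable_case_list [computable_intros]:
  assumes "computable l" "computable n" "computable (\<lambda>p. c (fst p) (fst (snd p)) (snd (snd p)))"
  shows "computable (\<lambda>x. case l x of [] \<Rightarrow> n x | y # ys \<Rightarrow> c x y ys)"
proof -
  obtain l' where "realizes l' l" using computableD[OF assms(1)] by blast
  note l = realizesD[OF this]
  obtain n' where "realizes n' n" using computableD[OF assms(2)] by blast
  note n = realizesD[OF this]
  obtain c' where "realizes c' (\<lambda>p. c (fst p) (fst (snd p)) (snd (snd p)))" using computableD[OF assms(3)] by blast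
  note c = realizesD[OF this]
  have "(if 0 < l' (enc x) then c' (prod_encode (enc x, l' (enc x) - 1)) else n' (enc x)) =
      enc (case l x of [] \<Rightarrow> n x | y # ys \<Rightarrow> c x y ys)" for x
    using c(2)[of "(x, _, _)"] by (cases "l x") (auto simp: l(2) n(2) enc_list_def enc_prod_def)
  then show ?thesis
    by (intro computableI[where g = "\<lambda>z. if 0 < l' z then c' (prod_encode (z, l' z - 1)) else n' z"]
        comp_intros computable_on_pred l n c) simp_all
qed

lemma computable_rec_nat [computable_intros]:
  assumes "computable n" "computable a" "computable (\<lambda>p. s (fst p) (fst (snd p)) (snd (snd p)))"
  shows "computable (\<lambda>x. rec_nat (a x) (s x) (n x))"
proof -
  obtain n' where "realizes n' n" using computableD[OF assms(1)] by blast
  note n = realizesD[OF this]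
  obtain a' where "realizes a' a" using computableD[OF assms(2)] by blast
  note a = realizesD[OF this]
  obtain s' where "realizes s' (\<lambda>p. s (fst p) (fst (snd p)) (snd (snd p)))" using computableD[OF assms(3)] by blast
  note s = realizesD[OF this]
  \<comment> \<open>The code \<open>m\<close> of the whole argument is carried along unchanged, so
    that the step can use it.\<close>
  define h where "h k m = rec_nat (a' m) (\<lambda>i r. s' (prod_encode (m, prod_encode (i, r)))) k" for k m
  have "computable_on 2 (\<lambda>xs. h (xs ! 0) (xs ! 1))"
    unfolding h_def by (rule computable_on_rec2) (intro a s comp_intros; simp)+
  then have "computable_on 1 (\<lambda>xs. h (n' (xs ! 0)) (xs ! 0))"
    by (rule computable_on_comp2) (intro n comp_intros; simp)+
  moreover have "h k (enc x) = enc (rec_nat (a x) (s x) k)" for k x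
  proof (induction k)
    case (Suc k)
    then show ?case using s(2)[of "(x, k, rec_nat (a x) (s x) k)"]
      by (simp add: h_def enc_prod_def)
  qed (simp add: h_def a(2))
  ultimately show ?thesis
    by (intro computableI[where g = "\<lambda>z. h (n' z) z"]) (auto simp: n(2))
qed

lemma computable_ball_less:
  fixes P :: "'a::enc \<Rightarrow> nat \<Rightarrow> bool"
  assumes "computable n" "computable (\<lambda>p. P (fst p) (snd p))"
  shows "computable (\<lambda>x. \<forall>i<n x. P x i)"
proof -
  have "rec_nat True (\<lambda>i r. r \<and> P x i) k \<longleftrightarrow> (\<forall>i<k. P x i)" for x k
    by (induction k) (auto simp: less_Suc_eq)
  then have "(\<lambda>x. \<forall>i<n x. P x i) = (\<lambda>x. rec_nat True (\<lambda>i r. r \<and> P x i) (n x))" by auto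
  then show ?thesis
    using computable_compose2[OF assms(2) computable_fst[OF computable_ident]
        computable_fst[OF computable_snd[OF computable_ident]]]
    by (simp only:) (intro computable_intros assms)
qed

lemma computable_bex_less:
  fixes P :: "'a::enc \<Rightarrow> nat \<Rightarrow> bool"
  assumes "computable n" "computable (\<lambda>p. P (fst p) (snd p))"
  shows "computable (\<lambda>x. \<exists>i<n x. P x i)"
  using computable_not[OF computable_ball_less[OF assms(1) computable_not[OF assms(2)]]] by simp

lemma computable_drop:
  fixes l :: "'c::enc \<Rightarrow> 'a::enc list"
  assumes "computable k" "computable l"
  shows "computable (\<lambda>x. drop (k x) (l x))"
proof -
  have "rec_nat l (\<lambda>_ r. case r of [] \<Rightarrow> [] | y # ys \<Rightarrow> ys) k = drop k l" for l :: "'a list" and k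
  proof (induction k)
    case (Suc k)
    then show ?case by (cases "drop k l") (auto simp: drop_Suc tl_drop[symmetric])
  qed simp
  then show ?thesis
    using computable_rec_nat[OF assms, where s = "\<lambda>_ _ r. case r of [] \<Rightarrow> [] | y # ys \<Rightarrow> ys"]
    by (simp add: computable_intros)
qed

text \<open>\<open>xs ! i\<close> has no usable value for an index out of range.\<close>

definition nth_or :: "'a \<Rightarrow> 'a list \<Rightarrow> nat \<Rightarrow> 'a" where
  "nth_or d xs i = (case drop i xs of [] \<Rightarrow> d | y # _ \<Rightarrow> y)"

lemma nth_or_nth: "i < length xs \<Longrightarrow> nth_or d xs i = xs ! i"
  by (simp add: nth_or_def Cons_nth_drop_Suc[symmetric])

lemma nth_or_simps [simp]:
  "nth_or d [] i = d" "nth_or d (x # xs) 0 = x"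
  "nth_or d (x # xs) (Suc i) = nth_or d xs i"
  "nth_or d (x # xs) (numeral k) = nth_or d xs (pred_numeral k)"
  by (simp_all add: nth_or_def numeral_eq_Suc)

lemma computable_nth_or [computable_intros]:
  assumes "computable d" "computable l" "computable k"
  shows "computable (\<lambda>x. nth_or (d x) (l x) (k x))"
  unfolding nth_or_def by (intro computable_intros computable_drop assms)

text \<open>Lets \<open>computable_length\<close> count by primitive recursion: the code of the list
  bounds the number of steps.\<close>

lemma length_le_list_encode: "length xs \<le> list_encode xs"
proof (induction xs)
  case (Cons x xs)
  then show ?case using le_prod_encode_2[of "list_encode xs" x] by simp
qed simp

lemma computable_enc [computable_intros]:
  "computable f \<Longrightarrow> computable (\<lambda>x. enc (f x))"
  by (rule computable_compose, rule computableI[where g = "\<lambda>n. n"]) (auto intro: comp_intros)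

lemma computable_length [computable_intros]:
  fixes l :: "'c::enc \<Rightarrow> 'a::enc list"
  assumes "computable l"
  shows "computable (\<lambda>x. length (l x))"
proof -
  have *: "rec_nat 0 (\<lambda>i r. case drop i l of [] \<Rightarrow> r | y # ys \<Rightarrow> Suc r) k = min k (length l)"
    for l :: "'a list" and k
  proof (induction k)
    case (Suc k)
    show ?case
    proof (cases "k < length l")
      case True
      with Suc show ?thesis by (simp add: Cons_nth_drop_Suc[symmetric])
    qed (use Suc in auto)
  qed simp
  have "length (l x) = rec_nat 0 (\<lambda>i r. case drop i (l x) of [] \<Rightarrow> r | y # ys \<Rightarrow> Suc r) (enc (l x))" for x
    using length_le_list_encode[of "map enc (l x)"] by (simp add: * enc_list_def)
  then show ?thesis
    by (simp only:) (intro computable_intros computable_drop computable_compose[OF assms] assms)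
qed

lemma computable_list_decode [computable_intros]:
  "computable f \<Longrightarrow> computable (\<lambda>x. list_decode (f x))"
  by (rule computable_compose, rule computableI[where g = "\<lambda>n. n"])
    (auto intro: comp_intros simp: enc_list_def)

lemma computable_prod_decode [computable_intros]:
  "computable f \<Longrightarrow> computable (\<lambda>x. prod_decode (f x))"
  by (rule computable_compose, rule computableI[where g = "\<lambda>n. n"])
    (auto intro: comp_intros simp: enc_prod_def)

text \<open>This is the one use of unbounded search. Since the program must be total,
  \<open>P x\<close> has to be satisfiable for every number \<open>x\<close>.\<close>

lemma computable_Least:
  fixes P :: "nat \<Rightarrow> nat \<Rightarrow> bool"
  assumes "computable (\<lambda>p. P (fst p) (snd p))" and ex: "\<And>x. \<exists>n. P x n"
  shows "computable (\<lambda>x. LEAST n. P x n)"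
proof -
  \<comment> \<open>\<open>Mu\<close> looks for the result 0, which is the code of
    \<open>False\<close>; hence the negation is computed.\<close>
  obtain g where "realizes g (\<lambda>p. \<not> P (fst p) (snd p))" using computableD[OF computable_not[OF assms(1)]] by blast
  note g = realizesD[OF this]
  have "computable_on 2 (\<lambda>xs. g (prod_encode (xs ! 1, xs ! 0)))"
    by (intro g comp_intros) simp_all
  then obtain p where p: "\<And>xs. length xs = 2 \<Longrightarrow> computes p xs (g (prod_encode (xs ! 1, xs ! 0)))"
    unfolding computable_on_def by blast
  have p: "computes p [n, x] (if P x n then 0 else 1)" for n x
    using p[of "[n, x]"] g(2)[of "(x, n)"] by (auto simp: enc_prod_def enc_bool_def split: if_splits)
  have "computes (Mu p) [x] (LEAST n. P x n)" for x
  proof (rule computes.mu)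
    show "computes p [LEAST n. P x n, x] 0" using p[of "LEAST n. P x n" x] LeastI_ex[OF ex[of x]] by simp
    show "\<forall>m<LEAST n. P x n. \<exists>y. computes p [m, x] (Suc y)"
      using p[of _ x] by (metis One_nat_def not_less_Least)
  qed
  then have "computes (Mu p) xs (LEAST n. P (xs ! 0) n)" if "length xs = 1" for xs
    using that by (cases xs) auto
  then show ?thesis unfolding computable_nat_iff computable_on_def by blast
qed

text \<open>
  A certificate for the value at \<open>x\<close> is a finite table of pairs (argument, values at the arguments
  on which it depends). The least certificate is found by unbounded search. That search has to end
  on numbers that encode nothing, too; hence the rank \<open>r\<close> is part of the check.
\<close>

theorem computable_tree_rec:
  fixes f :: "'a::enc \<Rightarrow> 'b::enc" and r :: "'a \<Rightarrow> nat"
  assumes deps: "computable deps" and G: "computable (\<lambda>p. G (fst p) (snd p))" and r: "computable r"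
    and dec: "\<And>x y. y \<in> set (deps x) \<Longrightarrow> r y < r x"
    and rec: "\<And>x. f x = G x (map f (deps x))"
  shows "computable f"
proof -
  obtain gd0 where "realizes gd0 deps" using computableD[OF deps] by blast
  note gd0 = realizesD[OF this]
  obtain gG0 where "realizes gG0 (\<lambda>p. G (fst p) (snd p))" using computableD[OF G] by blast
  note gG0 = realizesD[OF this]
  obtain gr where "realizes gr r" using computableD[OF r] by blast
  note gr = realizesD[OF this]
  define gd where "gd z = list_decode (gd0 z)" for z
  define gG where "gG e = gG0 (enc e)" for e :: "nat \<times> nat list"
  have gd_enc: "gd (enc x) = map enc (deps x)" for x
    by (simp add: gd_def gd0(2) enc_list_def)
  have gG_enc: "gG (enc x, map enc ys) = enc (G x ys)" for x ys
    using gG0(2)[of "(x, ys)"] by (simp add: gG_def enc_prod_def enc_list_def)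
  have "computable gd0" "computable gG0" and c_gr: "computable gr"
    unfolding computable_nat_iff by (intro gd0 gG0 gr comp_intros; simp)+
  then have c_gd: "computable gd" and c_gG: "computable gG"
    unfolding gd_def gG_def
    by (auto intro: computable_list_decode computable_compose[OF _ computable_enc[OF computable_ident]])
  define d :: "nat \<times> nat list" where "d = (0, [])"
  \<comment> \<open>A dependency whose rank does not decrease, which can happen only if the argument
    is no code, must carry the default 0. This cuts off infinite descent by a check that is itself
    computable.\<close>
  define ok where "ok T e \<longleftrightarrow> length (snd e) = length (gd (fst e)) \<and>
      (\<forall>j<length (gd (fst e)).
         if gr (nth_or 0 (gd (fst e)) j) < gr (fst e)
         then \<exists>i<length T. fst (nth_or d T i) = nth_or 0 (gd (fst e)) j \<and>
                gG (nth_or d T i) = nth_or 0 (snd e) j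
         else nth_or 0 (snd e) j = 0)" for T e
  define good where "good z T \<longleftrightarrow> (\<forall>i<length T. ok T (nth_or d T i)) \<and>
      0 < length T \<and> fst (nth_or d T 0) = z" for z T
  define tab :: "nat \<Rightarrow> (nat \<times> nat list) list" where
    "tab n = map (\<lambda>e. (fst (prod_decode e), list_decode (snd (prod_decode e)))) (list_decode n)" for n
  \<comment> \<open>Every number is the code of exactly one table, so a search over numbers is a
    search over tables.\<close>
  have "enc (tab n) = n" for n
    by (simp add: tab_def enc_list_def enc_prod_def o_def)
  then have c_tab: "computable tab"
    by (intro computableI[where g = "\<lambda>n. n"] comp_intros) simp_all
  have tab_enc: "tab (enc T) = T" for T
    by (induction T) (auto simp: tab_def enc_list_def enc_prod_def o_def)
  have ok_iff: "ok T e \<longleftrightarrow> length (snd e) = length (gd (fst e)) \<and>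
      (\<forall>(y, v)\<in>set (zip (gd (fst e)) (snd e)).
         if gr y < gr (fst e) then \<exists>e'\<in>set T. fst e' = y \<and> gG e' = v else v = 0)" for T e
    unfolding ok_def by (fastforce simp: set_zip in_set_conv_nth nth_or_nth)
  have ok_mono: "ok T e \<Longrightarrow> set T \<subseteq> set T' \<Longrightarrow> ok T' e" for T T' e
    unfolding ok_iff by (fastforce split: if_splits)
  have good_iff: "good z T \<longleftrightarrow> (\<forall>e\<in>set T. ok T e) \<and> T \<noteq> [] \<and> fst (hd T) = z" for z T
  proof -
    have "(\<forall>i<length T. ok T (nth_or d T i)) \<longleftrightarrow> (\<forall>e\<in>set T. ok T e)"
      by (simp add: all_set_conv_all_nth nth_or_nth)
    then show ?thesis unfolding good_def by (cases T) auto
  qed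
  have ex: "\<exists>T. good z T" for z
  proof (induction "gr z" arbitrary: z rule: less_induct)
    case less
    then obtain W where W: "\<And>y. gr y < gr z \<Longrightarrow> good y (W y)" by metis
    define e where "e = (z, map (\<lambda>y. if gr y < gr z then gG (hd (W y)) else 0) (gd z))"
    \<comment> \<open>The certificates of the dependencies can just be concatenated because
      \<open>ok\<close> is monotone in the table; entries for the same argument need not be
      merged.\<close>
    define T where "T = e # concat (map W (filter (\<lambda>y. gr y < gr z) (gd z)))"
    have sub: "set (W y) \<subseteq> set T" if "y \<in> set (gd z)" "gr y < gr z" for y
      using that by (auto simp: T_def)
    have "ok T e" unfolding ok_iff
    proof (intro conjI ballI, goal_cases)
      case (2 p)
      then obtain y where y: "y \<in> set (gd z)" "p = (y, if gr y < gr z then gG (hd (W y)) else 0)"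
        by (auto simp: e_def zip_map2 set_zip in_set_conv_nth)
      show ?case
      proof (cases "gr y < gr z")
        case True
        with W[of y] have "hd (W y) \<in> set (W y)" "fst (hd (W y)) = y" by (auto simp: good_iff)
        with sub[OF y(1) True] True show ?thesis by (auto simp: y(2) e_def)
      qed (simp add: y(2) e_def)
    qed (simp add: e_def)
    moreover have "ok T e'" if "e' \<in> set (W y)" "y \<in> set (gd z)" "gr y < gr z" for e' y
      using W[OF that(3)] that(1) ok_mono[OF _ sub[OF that(2,3)]] unfolding good_iff by blast
    ultimately have "good z T" unfolding good_iff by (auto simp: T_def e_def)
    then show ?case by blast
  qed
  have sound: "snd e = map (\<lambda>y. enc (f y)) (deps x)"
    if "good z T" "e \<in> set T" "fst e = enc x" for z T e x
    using that(2,3)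
  proof (induction "r x" arbitrary: e x rule: less_induct)
    case less
    have ok: "ok T e" using \<open>good z T\<close> less.prems by (auto simp: good_iff)
    show ?case
    proof (rule nth_equalityI)
      show len: "length (snd e) = length (map (\<lambda>y. enc (f y)) (deps x))"
        using ok less.prems by (simp add: ok_def gd_enc)
      fix j assume j: "j < length (snd e)"
      define y where "y = deps x ! j"
      have y: "y \<in> set (deps x)" using j len by (simp add: y_def)
      have "(enc y, snd e ! j) \<in> set (zip (gd (fst e)) (snd e))"
        using j len by (auto simp: set_zip less.prems gd_enc y_def intro!: exI[of _ j])
      \<comment> \<open>On codes the rank does decrease, so the default does not apply and the table
        must contain an entry for \<open>y\<close>.\<close>
      moreover have "gr (enc y) < gr (fst e)" using dec[OF y] by (simp add: gr(2) less.prems)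
      ultimately obtain e' where e': "e' \<in> set T" "fst e' = enc y" "gG e' = snd e ! j"
        using ok unfolding ok_iff by fastforce
      have "snd e' = map enc (map f (deps y))"
        using less.hyps[OF dec[OF y] e'(1,2)] by simp
      then have "gG e' = enc (f y)"
        using gG_enc[of y "map f (deps y)"] e'(2) rec[of y] by (metis prod.collapse)
      then show "snd e ! j = map (\<lambda>y. enc (f y)) (deps x) ! j"
        using e'(3) j len by (simp add: y_def)
    qed
  qed
  define g where "g z = gG (nth_or d (tab (LEAST n. good z (tab n))) 0)" for z
  have "\<exists>n. good z (tab n)" for z using ex[of z] tab_enc by metis
  moreover have "computable (\<lambda>p. good (fst p) (tab (snd p)))"
    unfolding good_def ok_def if_bool_eq_disj
    by (intro computable_intros computable_ball_less computable_bex_less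
        computable_compose[OF c_gd] computable_compose[OF c_gG] computable_compose[OF c_gr]
        computable_compose[OF c_tab])
  ultimately have "computable (\<lambda>z. LEAST n. good z (tab n))"
    by (intro computable_Least) auto
  then have "computable g"
    unfolding g_def by (intro computable_intros computable_compose[OF c_gG] computable_compose[OF c_tab])
  moreover have "g (enc x) = enc (f x)" for x
  proof -
    define T where "T = tab (LEAST n. good (enc x) (tab n))"
    have T: "good (enc x) T" unfolding T_def
      using LeastI_ex[of "\<lambda>n. good (enc x) (tab n)"] ex[of "enc x"] tab_enc by metis
    have "snd (hd T) = map enc (map f (deps x))"
      using T sound[OF T, of "hd T" x] by (simp add: good_iff)
    then have "gG (hd T) = enc (f x)"
      using gG_enc[of x "map f (deps x)"] T rec[of x] by (metis good_iff prod.collapse)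
    moreover have "nth_or d T 0 = hd T" using T by (cases T) (auto simp: good_iff)
    ultimately show ?thesis by (simp add: g_def T_def)
  qed
  ultimately show ?thesis
    unfolding computable_nat_iff by (rule computableI)
qed

section \<open>List functions\<close>

lemma enc_Cons_less: "enc xs < enc (x # xs)"
  using le_prod_encode_2[of "enc xs" "enc x"] by (simp add: enc_list_def)

text \<open>Tails have smaller codes, so the code of the remaining list is a computable
  rank.\<close>

lemma computable_foldr [computable_intros]:
  fixes l :: "'a::enc \<Rightarrow> 'c::enc list" and n :: "'a \<Rightarrow> 'b::enc"
  assumes c: "computable (\<lambda>p. c (fst p) (fst (snd p)) (snd (snd p)))" and n: "computable n"
    and l: "computable l"
  shows "computable (\<lambda>x. foldr (c x) (l x) (n x))"
proof -
  define f where "f p = foldr (c (fst p)) (snd p) (n (fst p))" for p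
  define deps where "deps p = (case snd p of [] \<Rightarrow> [] | y # ys \<Rightarrow> [(fst p, ys)])" for p :: "'a \<times> 'c list"
  define G where "G p rs = (case snd p of [] \<Rightarrow> n (fst p)
    | y # ys \<Rightarrow> (case rs of [] \<Rightarrow> n (fst p) | r # _ \<Rightarrow> c (fst p) y r))" for p rs
  have "computable f"
  proof (rule computable_tree_rec[where deps = deps and G = G and r = "\<lambda>p. enc (snd p)"])
    show "computable deps" unfolding deps_def by (intro computable_intros)
    show "computable (\<lambda>p. G (fst p) (snd p))"
      unfolding G_def by (intro computable_intros computable_compose[OF n] computable_compose3[OF c])
    show "computable (\<lambda>p :: 'a \<times> 'c list. enc (snd p))" by (intro computable_intros)
    show "enc (snd y) < enc (snd x)" if "y \<in> set (deps x)" for x y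
      using that enc_Cons_less by (cases "snd x") (auto simp: deps_def)
    show "f x = G x (map f (deps x))" for x
      by (auto simp: f_def G_def deps_def split: list.split)
  qed
  from computable_compose[OF this computable_Pair[OF computable_ident l]] show ?thesis
    by (simp add: f_def)
qed

lemma computable_append [computable_intros]:
  assumes "computable a" "computable b" shows "computable (\<lambda>x. a x @ b x)"
proof -
  have "a x @ b x = foldr (\<lambda>y ys. y # ys) (a x) (b x)" for x by (simp add: foldr_conv_fold fold_Cons_rev)
  then show ?thesis by (simp only:) (intro computable_intros assms)
qed

lemma computable_map [computable_intros]:
  fixes l :: "'x::enc \<Rightarrow> 'a::enc list" and f :: "'x \<Rightarrow> 'a \<Rightarrow> 'b::enc"
  assumes "computable (\<lambda>p. f (fst p) (snd p))" "computable l"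
  shows "computable (\<lambda>x. map (f x) (l x))"
proof -
  have "map g xs = foldr (\<lambda>y ys. g y # ys) xs []" for g :: "'a \<Rightarrow> 'b" and xs by (induction xs) auto
  then show ?thesis
    by (simp only:) (intro computable_intros assms computable_compose2[OF assms(1)])
qed

lemma computable_filter [computable_intros]:
  fixes l :: "'x::enc \<Rightarrow> 'a::enc list"
  assumes "computable (\<lambda>p. f (fst p) (snd p))" "computable l"
  shows "computable (\<lambda>x. filter (f x) (l x))"
proof -
  have "filter g xs = foldr (\<lambda>y ys. if g y then y # ys else ys) xs []" for g :: "'a \<Rightarrow> bool" and xs
    by (induction xs) auto
  then show ?thesis
    by (simp only:) (intro computable_intros assms computable_compose2[OF assms(1)])
qed

lemma computable_concat [computable_intros]:
  fixes l :: "'x::enc \<Rightarrow> 'a::enc list list"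
  assumes "computable l" shows "computable (\<lambda>x. concat (l x))"
proof -
  have "concat xs = foldr (\<lambda>y ys. y @ ys) xs []" for xs :: "'a list list" by (induction xs) auto
  then show ?thesis by (simp only:) (intro computable_intros assms)
qed

lemma computable_list_all [computable_intros]:
  fixes l :: "'x::enc \<Rightarrow> 'a::enc list"
  assumes "computable (\<lambda>p. f (fst p) (snd p))" "computable l"
  shows "computable (\<lambda>x. list_all (f x) (l x))"
proof -
  have "list_all g xs \<longleftrightarrow> foldr (\<lambda>y r. g y \<and> r) xs True" for g :: "'a \<Rightarrow> bool" and xs
    by (induction xs) auto
  then show ?thesis
    by (simp only:) (intro computable_intros assms computable_compose2[OF assms(1)])
qed

lemma computable_list_ex [computable_intros]:
  fixes l :: "'x::enc \<Rightarrow> 'a::enc list"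
  assumes "computable (\<lambda>p. f (fst p) (snd p))" "computable l"
  shows "computable (\<lambda>x. list_ex (f x) (l x))"
proof -
  have "list_ex g xs \<longleftrightarrow> foldr (\<lambda>y r. g y \<or> r) xs False" for g :: "'a \<Rightarrow> bool" and xs
    by (induction xs) auto
  then show ?thesis
    by (simp only:) (intro computable_intros assms computable_compose2[OF assms(1)])
qed

lemma computable_take [computable_intros]:
  fixes l :: "'c::enc \<Rightarrow> 'a::enc list"
  assumes "computable k" "computable l"
  shows "computable (\<lambda>x. take (k x) (l x))"
proof -
  have "take k l = rec_nat [] (\<lambda>i r. r @ (case drop i l of [] \<Rightarrow> [] | y # ys \<Rightarrow> [y])) k" for k and l :: "'a list"
  proof (induction k)
    case (Suc k)
    then show ?case
      by (cases "k < length l") (auto simp: take_Suc_conv_app_nth Cons_nth_drop_Suc[symmetric])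
  qed simp
  then show ?thesis
    by (simp only:) (intro computable_intros computable_drop computable_compose[OF assms(2)] assms)
qed

lemma computable_upt [computable_intros]:
  assumes "computable i" "computable j"
  shows "computable (\<lambda>x. [i x..<j x])"
proof -
  have "[i..<j] = rec_nat [] (\<lambda>k r. if i \<le> k then r @ [k] else r) j" for i j by (induction j) auto
  then show ?thesis
    by (simp only:) (intro computable_intros computable_compose[OF assms(1)] assms)
qed

lemma computable_foldl [computable_intros]:
  fixes l :: "'a::enc \<Rightarrow> 'c::enc list" and n :: "'a \<Rightarrow> 'b::enc"
  assumes c: "computable (\<lambda>p. c (fst p) (fst (snd p)) (snd (snd p)))" and n: "computable n"
    and l: "computable l"
  shows "computable (\<lambda>x. foldl (c x) (n x) (l x))"
proof -
  have rev: "rev xs = foldr (\<lambda>y ys. ys @ [y]) xs []" for xs :: "'c list" by (induction xs) auto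
  have "computable (\<lambda>x. foldr (\<lambda>y r. c x r y) (rev (l x)) (n x))"
    unfolding rev by (intro computable_intros assms computable_compose3[OF c])
  then show ?thesis by (simp add: foldr_conv_foldl)
qed

lemma computable_mem_nat [computable_intros]:
  assumes "computable a" "computable l"
  shows "computable (\<lambda>x. (a x :: nat) \<in> set (l x))"
proof -
  have "a x \<in> set (l x) \<longleftrightarrow> list_ex (\<lambda>y. y = a x) (l x)" for x by (auto simp: list_ex_iff)
  then show ?thesis
    by (simp only:) (intro computable_intros assms computable_compose[OF assms(1)])
qed

section \<open>Constructive fields\<close>

text \<open>A number may have many names, so every test goes through the order of the values;
  equality is the failure of both strict comparisons.\<close>

locale named_field =
  fixes R :: "nat \<Rightarrow> real" and kadd ksub kmul kdiv :: "nat \<Rightarrow> nat \<Rightarrow> nat" and kone :: nat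
  assumes R_add [simp]: "R (kadd x y) = R x + R y"
    and R_sub [simp]: "R (ksub x y) = R x - R y"
    and R_mul [simp]: "R (kmul x y) = R x * R y"
    and R_div [simp]: "R (kdiv x y) = R x / R y"
    and R_one [simp]: "R kone = 1"
    and computable_ops: "computable (\<lambda>p. kadd (fst p) (snd p))" "computable (\<lambda>p. ksub (fst p) (snd p))"
      "computable (\<lambda>p. kmul (fst p) (snd p))" "computable (\<lambda>p. kdiv (fst p) (snd p))"
      "computable (\<lambda>p. R (fst p) < R (snd p))"

lemma named_field_of_constructive_field:
  assumes "constructive_field R"
  shows "\<exists>kadd ksub kmul kdiv kone. named_field R kadd ksub kmul kdiv kone"
proof -
  have *: "computable (\<lambda>p. f (fst p) (snd p))" if "computable2 f" for f
  proof -
    from that obtain p where p: "\<And>x y. computes p [x, y] (f x y)"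
      unfolding computable2_def by blast
    have "computes p xs (f (xs ! 0) (xs ! 1))" if "length xs = 2" for xs
      using that p by (auto simp: length_Suc_conv numeral_2_eq_2)
    then have "computable_on 2 (\<lambda>xs. f (xs ! 0) (xs ! 1))"
      unfolding computable_on_def by blast
    then have "computable_on 1 (\<lambda>xs. f (fst (prod_decode (xs ! 0))) (snd (prod_decode (xs ! 0))))"
      by (rule computable_on_comp2; intro comp_intros; simp)
    then show ?thesis
      by (rule computableI[where g = "\<lambda>n. f (fst (prod_decode n)) (snd (prod_decode n))"])
        (simp add: enc_prod_def)
  qed
  from assms obtain kadd ksub kmul kdiv where ops:
    "computable2 kadd" "\<forall>x y. R (kadd x y) = R x + R y"
    "computable2 ksub" "\<forall>x y. R (ksub x y) = R x - R y"
    "computable2 kmul" "\<forall>x y. R (kmul x y) = R x * R y"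
    "computable2 kdiv" "\<forall>x y. R (kdiv x y) = R x / R y"
    and lt: "computable2 (\<lambda>x y. if R x < R y then 1 else 0)" and one: "1 \<in> range R"
    unfolding constructive_field_def by blast
  from one obtain kone where "R kone = 1" by auto
  moreover have "computable (\<lambda>p. 0 < (if R (fst p) < R (snd p) then 1 else 0 :: nat))"
    by (intro computable_less computable_const *[OF lt])
  then have "computable (\<lambda>p. R (fst p) < R (snd p))" by (simp split: if_splits cong: if_cong)
  ultimately have "named_field R kadd ksub kmul kdiv kone"
    using ops by unfold_locales (auto intro: *)
  then show ?thesis by blast
qed

subsection \<open>Real quadratic functions\<close>

text \<open>\<open>v\<close>, \<open>w\<close>, \<open>c\<close> are the Taylor coefficients at
  \<open>r\<close>. Immediately to the right of \<open>r\<close> the first nonzero one decides the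
  sign.\<close>

lemma eventually_quadratic_neg:
  fixes v w c r :: real
  assumes "v < 0 \<or> v = 0 \<and> (w < 0 \<or> w = 0 \<and> c < 0)"
  shows "\<forall>\<^sub>F t in at_right r. v + w * (t - r) + c * (t - r)\<^sup>2 < 0"
proof -
  have right: "\<forall>\<^sub>F t in at_right r. r < t" by (simp add: eventually_at_right_less)
  consider "v < 0" | "v = 0" "w < 0" | "v = 0" "w = 0" "c < 0" using assms by auto
  then show ?thesis
  proof cases
    case 1
    have "((\<lambda>t. v + w * (t - r) + c * (t - r)\<^sup>2) \<longlongrightarrow> v + w * (r - r) + c * (r - r)\<^sup>2) (at_right r)"
      by (intro tendsto_intros)
    then show ?thesis using 1 by (intro order_tendstoD) auto
  next
    case 2
    have "((\<lambda>t. w + c * (t - r)) \<longlongrightarrow> w + c * (r - r)) (at_right r)"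
      by (intro tendsto_intros)
    then have "\<forall>\<^sub>F t in at_right r. w + c * (t - r) < 0" using 2 by (intro order_tendstoD) auto
    with right show ?thesis
    proof eventually_elim
      case (elim t)
      then have "(t - r) * (w + c * (t - r)) < 0" by (simp add: mult_less_0_iff)
      then show ?case using 2 by (simp add: algebra_simps power2_eq_square)
    qed
  next
    case 3
    from right show ?thesis by eventually_elim (use 3 in \<open>simp add: mult_less_0_iff\<close>)
  qed
qed

text \<open>To the right of \<open>r\<close> a quadratic function is eventually negative, eventually
  zero or eventually positive. Hence not being eventually positive amounts to being eventually
  nonpositive, and weak literals reduce to strict ones.\<close>

lemma eventually_quadratic_neg_iff:
  fixes v w c r :: real
  shows "(\<forall>\<^sub>F t in at_right r. v + w * (t - r) + c * (t - r)\<^sup>2 < 0) \<longleftrightarrow>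
      v < 0 \<or> v = 0 \<and> (w < 0 \<or> w = 0 \<and> c < 0)" (is "?A \<longleftrightarrow> ?B")
    and "(\<forall>\<^sub>F t in at_right r. v + w * (t - r) + c * (t - r)\<^sup>2 \<le> 0) \<longleftrightarrow>
      \<not> (\<forall>\<^sub>F t in at_right r. - v + - w * (t - r) + - c * (t - r)\<^sup>2 < 0)" (is "?C \<longleftrightarrow> \<not> ?D")
proof -
  have contr: False if "\<forall>\<^sub>F t in at_right r. f t \<le> 0" "\<forall>\<^sub>F t in at_right r. - f t < 0" for f :: "real \<Rightarrow> real"
    using eventually_conj[OF that] eventually_happens'[OF trivial_limit_at_right_real[of r]] by fastforce
  have neg: ?A if ?B using that by (rule eventually_quadratic_neg)
  have pos: ?D if "\<not> ?B" "\<not> (v = 0 \<and> w = 0 \<and> c = 0)"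
    by (rule eventually_quadratic_neg) (use that in auto)
  have zero: "\<not> ?A \<and> ?C \<and> \<not> ?D" if "v = 0 \<and> w = 0 \<and> c = 0"
    using that by (simp add: trivial_limit_at_right_real)
  have "\<not> ?D \<and> ?C" if ?A
  proof -
    have ?C using that by (rule eventually_mono) simp
    moreover have "\<not> ?D"
      using contr[OF \<open>?C\<close>] by (auto simp: algebra_simps)
    ultimately show ?thesis by blast
  qed
  moreover have "\<not> ?C \<and> \<not> ?A" if ?D
  proof -
    have nC: "\<not> ?C" using contr[of "\<lambda>t. v + w * (t - r) + c * (t - r)\<^sup>2"] that
      by (auto simp: algebra_simps)
    moreover have "?C" if ?A using that by (rule eventually_mono) simp
    ultimately show ?thesis by blast
  qed
  ultimately show "?A \<longleftrightarrow> ?B" "?C \<longleftrightarrow> \<not> ?D" using neg pos zero by blast+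
qed

text \<open>Squaring compares the absolute values of \<open>u\<close> and \<open>w * sqrt d\<close>
  without the root, and the sign of \<open>u\<close> tells which of the two has to be larger. Only
  field operations on \<open>u\<close>, \<open>w\<close>, \<open>d\<close> remain.\<close>

lemma add_mult_sqrt_neg_iff:
  fixes u w d :: real
  assumes "0 \<le> d"
  shows "u + w * sqrt d < 0 \<longleftrightarrow>
    (if u < 0 then w \<le> 0 \<or> w\<^sup>2 * d < u\<^sup>2 else w < 0 \<and> u\<^sup>2 < w\<^sup>2 * d)"
proof -
  have sq: "w\<^sup>2 * d = (\<bar>w\<bar> * sqrt d)\<^sup>2" using assms by (simp add: power_mult_distrib)
  have lt: "a\<^sup>2 < b\<^sup>2 \<longleftrightarrow> a < b" if "0 \<le> a" "0 \<le> b" for a b :: real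
    using that by (meson power2_less_imp_less power_strict_mono pos2)
  have abs_w: "\<bar>w\<bar> * sqrt d = (if 0 \<le> w then w * sqrt d else - (w * sqrt d))" by simp
  have nn: "0 \<le> w \<Longrightarrow> 0 \<le> w * sqrt d" "w \<le> 0 \<Longrightarrow> w * sqrt d \<le> 0"
    using assms by (simp_all add: mult_le_0_iff)
  show ?thesis
  proof (cases "u < 0")
    case True
    have "w\<^sup>2 * d < u\<^sup>2 \<longleftrightarrow> \<bar>w\<bar> * sqrt d < - u"
      using lt[of "\<bar>w\<bar> * sqrt d" "- u"] True assms by (simp add: sq)
    then show ?thesis using True nn unfolding abs_w by (auto split: if_splits)
  next
    case False
    have "u\<^sup>2 < w\<^sup>2 * d \<longleftrightarrow> u < \<bar>w\<bar> * sqrt d"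
      using lt[of u "\<bar>w\<bar> * sqrt d"] False assms by (simp add: sq)
    then show ?thesis using False nn unfolding abs_w by (auto split: if_splits)
  qed
qed

subsection \<open>Systems of quadratic inequalities in one variable\<close>

type_synonym qpoly = "nat \<times> nat \<times> nat"
type_synonym qpoint = "nat \<times> nat \<times> nat"

context named_field
begin

lemmas computable_field_ops [computable_intros] =
  computable_compose2[OF computable_ops(1)] computable_compose2[OF computable_ops(2)]
  computable_compose2[OF computable_ops(3)] computable_compose2[OF computable_ops(4)]
  computable_compose2[where f = "\<lambda>x y. R x < R y", OF computable_ops(5)]

definition kzero :: nat where "kzero = ksub kone kone"
definition ktwo :: nat where "ktwo = kadd kone kone"
definition kneg :: "nat \<Rightarrow> nat" where "kneg x = ksub kzero x"

lemma R_consts [simp]: "R kzero = 0" "R ktwo = 2" "R (kneg x) = - R x"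
  by (simp_all add: kzero_def ktwo_def kneg_def)

definition qval :: "qpoly \<Rightarrow> real \<Rightarrow> real" where
  "qval p t = R (fst p) + R (fst (snd p)) * t + R (snd (snd p)) * t\<^sup>2"

definition qneg :: "qpoly \<Rightarrow> qpoly" where
  "qneg p = (kneg (fst p), kneg (fst (snd p)), kneg (snd (snd p)))"

definition qderiv :: "qpoly \<Rightarrow> qpoly" where
  "qderiv p = (fst (snd p), kmul ktwo (snd (snd p)), kzero)"

definition qadd :: "qpoly \<Rightarrow> qpoly \<Rightarrow> qpoly" where
  "qadd p q = (kadd (fst p) (fst q), kadd (fst (snd p)) (fst (snd q)), kadd (snd (snd p)) (snd (snd q)))"

lemma qval_qneg [simp]: "qval (qneg p) t = - qval p t"
  by (simp add: qval_def qneg_def)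

lemma qval_qadd [simp]: "qval (qadd p q) t = qval p t + qval q t"
  by (simp add: qval_def qadd_def algebra_simps)

text \<open>The triple \<open>(a, b, d)\<close> stands for the number \<open>a + b \<surd>d\<close>.\<close>

definition point_val :: "qpoint \<Rightarrow> real" where
  "point_val e = R (fst e) + R (fst (snd e)) * sqrt (R (snd (snd e)))"

text \<open>Since the square of \<open>sqrt d\<close> is \<open>d\<close>, the value of
  \<open>p\<close> at \<open>a + b * sqrt d\<close> has the form \<open>u + w * sqrt d\<close>
  again. The last line is the sign test of \<open>add_mult_sqrt_neg_iff\<close>.\<close>

definition neg_at :: "qpoint \<Rightarrow> qpoly \<Rightarrow> bool" where
  "neg_at e p = (let a = fst e; b = fst (snd e); d = snd (snd e); p1 = fst (snd p); p2 = snd (snd p);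
       u = kadd (kadd (fst p) (kmul p1 a)) (kmul p2 (kadd (kmul a a) (kmul (kmul b b) d)));
       w = kadd (kmul p1 b) (kmul (kmul ktwo p2) (kmul a b));
       uu = kmul u u; wwd = kmul (kmul w w) d
     in if R u < R kzero then \<not> R kzero < R w \<or> R wwd < R uu else R w < R kzero \<and> R uu < R wwd)"

lemma neg_at_iff:
  assumes "0 \<le> R (snd (snd e))"
  shows "neg_at e p \<longleftrightarrow> qval p (point_val e) < 0"
proof -
  define a b d p0 p1 p2 where "a = R (fst e)" and "b = R (fst (snd e))" and "d = R (snd (snd e))"
    and "p0 = R (fst p)" and "p1 = R (fst (snd p))" and "p2 = R (snd (snd p))"
  note defs = this
  have d: "0 \<le> d" using assms by (simp add: d_def)
  define u w where "u = p0 + p1 * a + p2 * (a * a + b * b * d)" and "w = p1 * b + 2 * p2 * (a * b)"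
  have "qval p (point_val e) = p0 + p1 * (a + b * sqrt d) + p2 * (a + b * sqrt d)\<^sup>2"
    by (simp add: qval_def point_val_def defs)
  also have "(a + b * sqrt d)\<^sup>2 = a * a + b * b * d + 2 * (a * b) * sqrt d"
  proof -
    have "(a + b * sqrt d)\<^sup>2 = a * a + b * b * (sqrt d * sqrt d) + 2 * (a * b) * sqrt d"
      by (simp add: power2_eq_square algebra_simps)
    then show ?thesis using d by simp
  qed
  finally have val: "qval p (point_val e) = u + w * sqrt d" by (simp add: u_def w_def algebra_simps)
  show ?thesis
    unfolding neg_at_def Let_def val add_mult_sqrt_neg_iff[OF d, of u w]
    by (simp add: u_def w_def defs power2_eq_square not_less)
qed

definition neg_right_of :: "qpoint \<Rightarrow> qpoly \<Rightarrow> bool" where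
  "neg_right_of e p \<longleftrightarrow> neg_at e p \<or> \<not> neg_at e (qneg p) \<and>
     (neg_at e (qderiv p) \<or> \<not> neg_at e (qneg (qderiv p)) \<and> R (snd (snd p)) < R kzero)"

lemma qval_taylor:
  "qval p t = qval p r + qval (qderiv p) r * (t - r) + R (snd (snd p)) * (t - r)\<^sup>2"
  by (simp add: qval_def qderiv_def power2_eq_square algebra_simps)

lemma neg_right_of_iff:
  assumes "0 \<le> R (snd (snd e))"
  shows "neg_right_of e p \<longleftrightarrow> (\<forall>\<^sub>F t in at_right (point_val e). qval p t < 0)"
    and "\<not> neg_right_of e (qneg p) \<longleftrightarrow> (\<forall>\<^sub>F t in at_right (point_val e). qval p t \<le> 0)"
proof -
  define r where "r = point_val e"
  have taylor: "qval p r + qval (qderiv p) r * (t - r) + R (snd (snd p)) * (t - r)\<^sup>2 = qval p t" for p t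
    by (rule qval_taylor[symmetric])
  show iff: "neg_right_of e p \<longleftrightarrow> (\<forall>\<^sub>F t in at_right (point_val e). qval p t < 0)" for p
    using eventually_quadratic_neg_iff(1)[where v = "qval p r" and w = "qval (qderiv p) r" and c = "R (snd (snd p))" and r = r]
    unfolding taylor by (auto simp: neg_right_of_def neg_at_iff[OF assms] r_def)
  have ne: "- qval p r + - qval (qderiv p) r * (t - r) + - R (snd (snd p)) * (t - r)\<^sup>2 = - qval p t" for t
    using taylor[of p t] by linarith
  from eventually_quadratic_neg_iff(2)[where v = "qval p r" and w = "qval (qderiv p) r" and c = "R (snd (snd p))" and r = r]
  show "\<not> neg_right_of e (qneg p) \<longleftrightarrow> (\<forall>\<^sub>F t in at_right (point_val e). qval p t \<le> 0)"
    unfolding iff qval_qneg taylor ne by (simp add: r_def)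
qed

text \<open>A list of test points that may contain more than the roots. The third entry serves
  vanishing leading coefficients, a negative discriminant is replaced by 0 to keep the radicand
  nonnegative, and divisions by 0 merely produce additional test points.\<close>

definition qroots :: "qpoly \<Rightarrow> qpoint list" where
  "qroots q = (let c0 = fst q; c1 = fst (snd q); c2 = snd (snd q);
      d = ksub (kmul c1 c1) (kmul (kmul ktwo ktwo) (kmul c2 c0));
      d' = (if R d < R kzero then kzero else d);
      h = kdiv kone (kmul ktwo c2); m = kneg (kmul c1 h)
    in [(m, h, d'), (m, kneg h, d'), (kneg (kdiv c0 c1), kzero, kzero)])"

lemma qroots_nonneg: "e \<in> set (qroots q) \<Longrightarrow> 0 \<le> R (snd (snd e))"
  by (auto simp: qroots_def Let_def)

lemma qroots_complete:
  assumes "qval q r = 0" "\<not> (\<forall>t. qval q t = 0)"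
  shows "r \<in> point_val ` set (qroots q)"
proof -
  define c0 c1 c2 where "c0 = R (fst q)" and "c1 = R (fst (snd q))" and "c2 = R (snd (snd q))"
  note defs = this
  have root: "c0 + c1 * r + c2 * r\<^sup>2 = 0" using assms(1) by (simp add: qval_def defs)
  show ?thesis
  proof (cases "c2 = 0")
    case True
    have "c1 \<noteq> 0" using assms(2) root True by (auto simp: qval_def defs)
    then have "r = - (c0 / c1)" using root True by (simp add: field_simps eq_neg_iff_add_eq_0)
    then show ?thesis by (simp add: qroots_def Let_def point_val_def defs)
  next
    case False
    define d where "d = c1 * c1 - 4 * (c2 * c0)"
    have "(2 * c2 * r + c1)\<^sup>2 = d + 4 * c2 * (c0 + c1 * r + c2 * r\<^sup>2)"
      by (simp add: d_def power2_eq_square algebra_simps)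
    then have sq: "(2 * c2 * r + c1)\<^sup>2 = d" using root by simp
    then have d: "0 \<le> d" by (metis zero_le_power2)
    have "\<bar>2 * c2 * r + c1\<bar> = sqrt d" using sq by (metis real_sqrt_abs)
    then consider "2 * c2 * r + c1 = sqrt d" | "2 * c2 * r + c1 = - sqrt d" by linarith
    then have "r = - (c1 * (1 / (2 * c2))) + 1 / (2 * c2) * sqrt d \<or>
        r = - (c1 * (1 / (2 * c2))) + - (1 / (2 * c2)) * sqrt d"
      using False by cases (simp_all add: field_simps)
    then show ?thesis using d
      by (auto simp: qroots_def Let_def point_val_def defs d_def)
  qed
qed

definition qlit_val :: "real \<Rightarrow> bool \<times> qpoly \<Rightarrow> bool" where
  "qlit_val t l = (if fst l then qval (snd l) t < 0 else qval (snd l) t \<le> 0)"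

definition qlit_at :: "bool \<Rightarrow> qpoint \<Rightarrow> bool \<times> qpoly \<Rightarrow> bool" where
  "qlit_at rgt e l = (if rgt
     then if fst l then neg_right_of e (snd l) else \<not> neg_right_of e (qneg (snd l))
     else if fst l then neg_at e (snd l) else \<not> neg_at e (qneg (snd l)))"

lemma qlit_at_iff:
  assumes "0 \<le> R (snd (snd e))"
  shows "qlit_at True e l \<longleftrightarrow> (\<forall>\<^sub>F t in at_right (point_val e). qlit_val t l)"
    and "qlit_at False e l \<longleftrightarrow> qlit_val (point_val e) l"
proof -
  show "qlit_at True e l \<longleftrightarrow> (\<forall>\<^sub>F t in at_right (point_val e). qlit_val t l)"
    using neg_right_of_iff[OF assms, of "snd l"] by (cases "fst l") (simp_all add: qlit_at_def qlit_val_def)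
  show "qlit_at False e l \<longleftrightarrow> qlit_val (point_val e) l"
    by (auto simp: qlit_at_def qlit_val_def neg_at_iff[OF assms])
qed

definition qsat :: "(bool \<times> qpoly) list \<Rightarrow> bool" where
  "qsat cl \<longleftrightarrow> list_ex (\<lambda>q. list_ex (\<lambda>e. list_ex (\<lambda>rgt. list_all (qlit_at rgt e) cl) [False, True])
     (qroots (snd q))) cl"

text \<open>
  A solution \<open>t\<close> can be moved to the left until it reaches the largest root below it, or a point
  immediately to the right of that root.
\<close>

lemma qsat_iff:
  assumes "l\<^sub>0 \<in> set cl" "\<And>t. qval (snd l\<^sub>0) t = a - t" "\<not> fst l\<^sub>0"
  shows "qsat cl \<longleftrightarrow> (\<exists>t. \<forall>l\<in>set cl. qlit_val t l)"
proof
  assume "qsat cl"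
  then obtain q e rgt where e: "e \<in> set (qroots q)" and all: "\<forall>l\<in>set cl. qlit_at rgt e l"
    unfolding qsat_def list_ex_iff list_all_iff by blast
  note d = qroots_nonneg[OF e]
  show "\<exists>t. \<forall>l\<in>set cl. qlit_val t l"
  proof (cases rgt)
    case True
    then have "\<forall>\<^sub>F t in at_right (point_val e). qlit_val t l" if "l \<in> set cl" for l
      using all that qlit_at_iff(1)[OF d] by simp
    then have "\<forall>\<^sub>F t in at_right (point_val e). \<forall>l\<in>set cl. qlit_val t l"
      by (intro eventually_ball_finite) auto
    then show ?thesis using eventually_happens'[OF trivial_limit_at_right_real] by blast
  next
    case False
    then have "\<forall>l\<in>set cl. qlit_val (point_val e) l"
      using all qlit_at_iff(2)[OF d] by simp
    then show ?thesis by blast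
  qed
next
  assume "\<exists>t. \<forall>l\<in>set cl. qlit_val t l"
  then obtain t where t: "\<And>l. l \<in> set cl \<Longrightarrow> qlit_val t l" by blast
  \<comment> \<open>Polynomials that vanish identically are left out to keep \<open>Z\<close>
    finite; their literals hold at all times or never.\<close>
  define Z where "Z = {r. r \<le> t \<and> (\<exists>l\<in>set cl. qval (snd l) r = 0 \<and> \<not> (\<forall>t. qval (snd l) t = 0))}"
  have "Z \<subseteq> (\<Union>l\<in>set cl. point_val ` set (qroots (snd l)))"
  proof
    fix r assume "r \<in> Z"
    then obtain l where "l \<in> set cl" "qval (snd l) r = 0" "\<not> (\<forall>t. qval (snd l) t = 0)"
      unfolding Z_def by blast
    with qroots_complete[of "snd l" r] show "r \<in> (\<Union>l\<in>set cl. point_val ` set (qroots (snd l)))" by blast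
  qed
  then have fin: "finite Z" by (rule finite_subset) auto
  \<comment> \<open>The literal \<open>l\<^sub>0\<close> bounds \<open>t\<close> from below by its
    root \<open>a\<close>, so some root lies at or below \<open>t\<close>.\<close>
  have "a \<le> t" using t[OF assms(1)] assms(2,3) by (simp add: qlit_val_def)
  moreover have "qval (snd l\<^sub>0) a = 0" "qval (snd l\<^sub>0) (a + 1) \<noteq> 0" by (simp_all add: assms(2))
  ultimately have "a \<in> Z" using assms(1) unfolding Z_def by blast
  then have "Z \<noteq> {}" by blast
  define r where "r = Max Z"
  have rZ: "r \<in> Z" using fin \<open>Z \<noteq> {}\<close> by (simp add: r_def)
  then obtain l where l: "l \<in> set cl" "qval (snd l) r = 0" "\<not> (\<forall>t. qval (snd l) t = 0)"
    unfolding Z_def by blast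
  then obtain e where e: "e \<in> set (qroots (snd l))" "point_val e = r"
    using qroots_complete[of "snd l" r] by blast
  note d = qroots_nonneg[OF e(1)]
  have rt: "r \<le> t" using rZ by (simp add: Z_def)
  have "\<exists>rgt. \<forall>l\<in>set cl. qlit_at rgt e l"
  proof (cases "r = t")
    case True
    then have "\<forall>l\<in>set cl. qlit_at False e l"
      using t by (simp add: qlit_at_iff(2)[OF d] e(2))
    then show ?thesis by blast
  next
    case False
    with rt have rt: "r < t" by simp
    have "qlit_at True e l" if l: "l \<in> set cl" for l
    proof (cases "\<forall>t. qval (snd l) t = 0")
      case True
      then have "qlit_val x l" for x using t[OF l] by (simp add: qlit_val_def split: if_splits)
      then show ?thesis by (simp add: qlit_at_iff(1)[OF d])
    next
      case nz: False
      have no_root: "qval (snd l) x \<noteq> 0" if "r < x" "x \<le> t" for x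
      proof
        assume "qval (snd l) x = 0"
        then have "x \<in> Z" using that nz l by (auto simp: Z_def)
        then show False using that fin by (auto simp: r_def dest: Max_ge)
      qed
      have neg_t: "qval (snd l) t < 0"
        using t[OF l] no_root[OF rt] by (auto simp: qlit_val_def split: if_splits)
      have cont: "continuous_on A (qval (snd l))" for A
        unfolding qval_def by (intro continuous_intros)
      \<comment> \<open>After \<open>r\<close> there is no root up to \<open>t\<close>, so by the
        intermediate value theorem the sign at \<open>t\<close> persists down to
        \<open>r\<close>.\<close>
      have "qval (snd l) x < 0" if "r < x" "x < t" for x
      proof (rule ccontr)
        assume "\<not> qval (snd l) x < 0"
        then have "\<exists>y\<ge>x. y \<le> t \<and> qval (snd l) y = 0"
          using neg_t that by (intro IVT2' cont) auto
        then obtain y where "x \<le> y" "y \<le> t" "qval (snd l) y = 0" by blast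
        then show False using no_root[of y] that by auto
      qed
      then have "\<forall>\<^sub>F x in at_right r. qval (snd l) x < 0"
        using rt by (auto simp: eventually_at_right_field)
      then have "\<forall>\<^sub>F x in at_right r. qlit_val x l"
        by (rule eventually_mono) (simp add: qlit_val_def)
      then show ?thesis by (simp add: qlit_at_iff(1)[OF d] e(2))
    qed
    then show ?thesis by blast
  qed
  then obtain rgt where "\<forall>l\<in>set cl. qlit_at rgt e l" by blast
  then show "qsat cl"
    unfolding qsat_def list_ex_iff list_all_iff
    by (intro bexI[OF _ l(1)] bexI[OF _ e(1)] bexI[of _ rgt]) auto
qed

lemma computable_qneg [computable_intros]:
  assumes "computable p" shows "computable (\<lambda>x. qneg (p x))"
  by (rule computable_compose[OF _ assms]) (unfold qneg_def kneg_def, intro computable_intros)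

lemma computable_qadd [computable_intros]:
  assumes "computable p" "computable q" shows "computable (\<lambda>x. qadd (p x) (q x))"
  by (rule computable_compose2[OF _ assms]) (unfold qadd_def, intro computable_intros)

lemma computable_qsat [computable_intros]:
  assumes "computable cl"
  shows "computable (\<lambda>x. qsat (cl x))"
proof -
  have neg_at: "computable (\<lambda>x. neg_at (e x) (p x))" if "computable e" "computable p"
    for e :: "'x::enc \<Rightarrow> qpoint" and p :: "'x \<Rightarrow> qpoly"
    by (rule computable_compose2[OF _ that]) (unfold neg_at_def, intro computable_intros)
  have qderiv: "computable (\<lambda>x. qderiv (p x))" if "computable p" for p :: "'x::enc \<Rightarrow> qpoly"
    by (rule computable_compose[OF _ that]) (unfold qderiv_def, intro computable_intros)
  have neg_right_of: "computable (\<lambda>x. neg_right_of (e x) (p x))" if "computable e" "computable p"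
    for e :: "'x::enc \<Rightarrow> qpoint" and p :: "'x \<Rightarrow> qpoly"
    by (rule computable_compose2[OF _ that]) (unfold neg_right_of_def, intro computable_intros neg_at qderiv)
  have qroots: "computable (\<lambda>x. qroots (p x))" if "computable p" for p :: "'x::enc \<Rightarrow> qpoly"
    by (rule computable_compose[OF _ that]) (unfold qroots_def kneg_def, intro computable_intros)
  show ?thesis
    by (rule computable_compose[OF _ assms])
      (unfold qsat_def qlit_at_def, intro computable_intros neg_at neg_right_of qroots)
qed

end

section \<open>Difference constraints\<close>

text \<open>\<open>(s, i, c, j)\<close> stands for \<open>x\<^sub>i + c < x\<^sub>j\<close> if \<open>s\<close> holds, and for \<open>x\<^sub>i + c \<le> x\<^sub>j\<close> otherwise.\<close>

type_synonym dlit = "bool \<times> nat \<times> nat \<times> nat"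

abbreviation strict :: "dlit \<Rightarrow> bool" where "strict l \<equiv> fst l"
abbreviation src :: "dlit \<Rightarrow> nat" where "src l \<equiv> fst (snd l)"
abbreviation off :: "dlit \<Rightarrow> nat" where "off l \<equiv> fst (snd (snd l))"
abbreviation tgt :: "dlit \<Rightarrow> nat" where "tgt l \<equiv> snd (snd (snd l))"

text \<open>If the largest lower bound is less than the smallest upper bound, their midpoint is a
  solution. If the two coincide, no bound with this value can be strict, and the value itself is a
  solution.\<close>

lemma exists_between_bounds:
  fixes L U :: "(bool \<times> real) set"
  assumes fin: "finite L" "finite U"
  shows "(\<forall>(s, a)\<in>L. \<forall>(s', b)\<in>U. if s \<or> s' then a < b else a \<le> b) \<longleftrightarrow>
    (\<exists>v. (\<forall>(s, a)\<in>L. if s then a < v else a \<le> v) \<and> (\<forall>(s, b)\<in>U. if s then v < b else v \<le> b))"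
    (is "?Q \<longleftrightarrow> (\<exists>v. ?P v)")
proof
  have bounded_below: "\<exists>v. \<forall>b\<in>B. v < b" if "finite B" for B :: "real set"
    using that
  proof induction
    case (insert b B)
    then obtain v where "\<forall>b\<in>B. v < b" by blast
    then show ?case by (intro exI[of _ "min v (b - 1)"]) auto
  qed simp
  have bounded_above: "\<exists>v. \<forall>b\<in>B. b < v" if "finite B" for B :: "real set"
    using that
  proof induction
    case (insert b B)
    then obtain v where "\<forall>b\<in>B. b < v" by blast
    then show ?case by (intro exI[of _ "max v (b + 1)"]) auto
  qed simp
  assume Q: ?Q
  show "\<exists>v. ?P v"
  proof (cases "L = {}")
    case True
    obtain v where "\<forall>b\<in>snd ` U. v < b"
      using bounded_below[of "snd ` U"] fin by auto
    with True show ?thesis by (intro exI[of _ v]) (auto simp: less_imp_le)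
  next
    case L: False
    show ?thesis
    proof (cases "U = {}")
      case True
      obtain v where "\<forall>b\<in>snd ` L. b < v"
        using bounded_above[of "snd ` L"] fin by auto
      with True show ?thesis by (intro exI[of _ v]) (auto simp: less_imp_le)
    next
      case U: False
      define a b where "a = Max (snd ` L)" and "b = Min (snd ` U)"
      have a: "a \<in> snd ` L" "\<And>x. x \<in> snd ` L \<Longrightarrow> x \<le> a"
        using fin L by (auto simp: a_def intro: Max_in)
      have b: "b \<in> snd ` U" "\<And>x. x \<in> snd ` U \<Longrightarrow> b \<le> x"
        using fin U by (auto simp: b_def intro: Min_in)
      have ab: "a \<le> b" using a(1) b(1) Q by (fastforce split: if_splits)
      show ?thesis
      proof (cases "a < b")
        case True
        have "?P ((a + b) / 2)" using True a(2) b(2) by fastforce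
        then show ?thesis by blast
      next
        case False
        with ab have [simp]: "b = a" by simp
        have "if s then x < a else x \<le> a" if "(s, x) \<in> L" for s x
          using that Q b(1) a(2)[of x] by (fastforce split: if_splits)
        moreover have "if s then a < x else a \<le> x" if "(s, x) \<in> U" for s x
          using that Q a(1) b(2)[of x] by (fastforce split: if_splits)
        ultimately have "?P a" by blast
        then show ?thesis by blast
      qed
    qed
  qed
next
  assume "\<exists>v. ?P v"
  then obtain v where v: "?P v" by blast
  have "if s \<or> s' then a < b else a \<le> b" if "(s, a) \<in> L" "(s', b) \<in> U" for s a s' b
    using v that by (fastforce split: if_splits)
  then show ?Q by blast
qed

context named_field
begin

definition dlit_val :: "(nat \<Rightarrow> real) \<Rightarrow> dlit \<Rightarrow> bool" where
  "dlit_val X l = (if strict l then X (src l) + R (off l) < X (tgt l) else X (src l) + R (off l) \<le> X (tgt l))"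

definition dnf_val :: "(nat \<Rightarrow> real) \<Rightarrow> dlit list list \<Rightarrow> bool" where
  "dnf_val X D \<longleftrightarrow> (\<exists>cl\<in>set D. \<forall>l\<in>set cl. dlit_val X l)"

definition dlit_neg :: "dlit \<Rightarrow> dlit" where
  "dlit_neg l = (\<not> strict l, tgt l, kneg (off l), src l)"

definition dnf_and :: "dlit list list \<Rightarrow> dlit list list \<Rightarrow> dlit list list" where
  "dnf_and D E = concat (map (\<lambda>a. map (\<lambda>b. a @ b) E) D)"

definition dnf_neg :: "dlit list list \<Rightarrow> dlit list list" where
  "dnf_neg D = foldr (\<lambda>cl E. dnf_and (map (\<lambda>l. [dlit_neg l]) cl) E) D [[]]"

definition clause_rename :: "nat \<Rightarrow> nat \<Rightarrow> dlit list \<Rightarrow> dlit list" where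
  "clause_rename y z cl = map (\<lambda>l. (strict l, if src l = y then z else src l, off l,
     if tgt l = y then z else tgt l)) cl"

text \<open>Fourier--Motzkin elimination of the variable \<open>y\<close>. A constraint between \<open>y\<close> and itself does
  not depend on the variable, and is kept as a constraint between \<open>1\<close> and itself.\<close>

definition clause_elim :: "nat \<Rightarrow> dlit list \<Rightarrow> dlit list" where
  "clause_elim y cl =
     map (\<lambda>l. if src l = y then (strict l, 1, off l, 1) else l)
       (filter (\<lambda>l. src l = y \<and> tgt l = y \<or> src l \<noteq> y \<and> tgt l \<noteq> y) cl) @
     concat (map (\<lambda>a. map (\<lambda>b. (strict a \<or> strict b, src a, kadd (off a) (off b), tgt b))
       (filter (\<lambda>l. src l = y \<and> tgt l \<noteq> y) cl)) (filter (\<lambda>l. src l \<noteq> y \<and> tgt l = y) cl))"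

definition dnf_elim :: "nat list \<Rightarrow> dlit list list \<Rightarrow> dlit list list" where
  "dnf_elim ys D = foldr (\<lambda>y E. map (clause_elim y) E) ys D"

lemma dlit_val_neg [simp]: "dlit_val X (dlit_neg l) \<longleftrightarrow> \<not> dlit_val X l"
  by (auto simp: dlit_val_def dlit_neg_def)

lemma dnf_val_simps [simp]:
  "dnf_val X [] \<longleftrightarrow> False" "dnf_val X (cl # D) \<longleftrightarrow> (\<forall>l\<in>set cl. dlit_val X l) \<or> dnf_val X D"
  "dnf_val X (D @ E) \<longleftrightarrow> dnf_val X D \<or> dnf_val X E"
  "dnf_val X (concat Ds) \<longleftrightarrow> (\<exists>D\<in>set Ds. dnf_val X D)"
  by (auto simp: dnf_val_def)

lemma dnf_val_and [simp]: "dnf_val X (dnf_and D E) \<longleftrightarrow> dnf_val X D \<and> dnf_val X E"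
  unfolding dnf_val_def dnf_and_def by fastforce

lemma dnf_val_neg [simp]: "dnf_val X (dnf_neg D) \<longleftrightarrow> \<not> dnf_val X D"
proof (induction D)
  case (Cons cl D)
  have "dnf_val X (map (\<lambda>l. [dlit_neg l]) cl) \<longleftrightarrow> \<not> (\<forall>l\<in>set cl. dlit_val X l)"
    by (auto simp: dnf_val_def)
  with Cons show ?case by (simp add: dnf_neg_def)
qed (simp add: dnf_neg_def)

lemma dnf_val_rename [simp]:
  "dnf_val X (map (clause_rename y z) D) \<longleftrightarrow> dnf_val (X(y := X z)) D"
proof -
  have "(\<forall>l\<in>set (clause_rename y z cl). dlit_val X l) \<longleftrightarrow> (\<forall>l\<in>set cl. dlit_val (X(y := X z)) l)" for cl
    unfolding clause_rename_def set_map ball_simps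
    by (rule ball_cong) (auto simp: dlit_val_def)
  then show ?thesis by (simp add: dnf_val_def)
qed

text \<open>Constraints with target \<open>y\<close> are lower bounds for its value, those with
  source \<open>y\<close> are upper bounds. Adding one of each cancels \<open>y\<close> and leaves a
  difference constraint, strict as soon as one of the two is.\<close>

lemma clause_elim_iff:
  assumes "y \<noteq> 1"
  shows "(\<forall>l\<in>set (clause_elim y cl). dlit_val X l) \<longleftrightarrow> (\<exists>v. \<forall>l\<in>set cl. dlit_val (X(y := v)) l)"
proof -
  define K where "K = set (filter (\<lambda>l. src l = y \<and> tgt l = y \<or> src l \<noteq> y \<and> tgt l \<noteq> y) cl)"
  define A where "A = set (filter (\<lambda>l. src l \<noteq> y \<and> tgt l = y) cl)"
  define B where "B = set (filter (\<lambda>l. src l = y \<and> tgt l \<noteq> y) cl)"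
  define L where "L = (\<lambda>l. (strict l, X (src l) + R (off l))) ` A"
  define U where "U = (\<lambda>l. (strict l, X (tgt l) - R (off l))) ` B"
  have fin: "finite L" "finite U" by (simp_all add: L_def U_def A_def B_def)
  have cl: "set cl = K \<union> A \<union> B" by (auto simp: K_def A_def B_def)
  have K: "dlit_val (X(y := v)) l \<longleftrightarrow> dlit_val X (if src l = y then (strict l, 1, off l, 1) else l)"
    if "l \<in> K" for v l
    using that by (auto simp: K_def dlit_val_def)
  have "(\<forall>l\<in>set (clause_elim y cl). dlit_val X l) \<longleftrightarrow>
      (\<forall>l\<in>K. dlit_val X (if src l = y then (strict l, 1, off l, 1) else l)) \<and>
      (\<forall>a\<in>A. \<forall>b\<in>B. dlit_val X (strict a \<or> strict b, src a, kadd (off a) (off b), tgt b))"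
    by (simp add: clause_elim_def K_def A_def B_def ball_Un del: set_filter if_image_distrib)
  also have "(\<forall>a\<in>A. \<forall>b\<in>B. dlit_val X (strict a \<or> strict b, src a, kadd (off a) (off b), tgt b)) \<longleftrightarrow>
      (\<forall>(s, a)\<in>L. \<forall>(s', b)\<in>U. if s \<or> s' then a < b else a \<le> b)"
    unfolding L_def U_def by (simp add: dlit_val_def algebra_simps)
  also have "\<dots> \<longleftrightarrow> (\<exists>v. (\<forall>(s, a)\<in>L. if s then a < v else a \<le> v) \<and> (\<forall>(s, b)\<in>U. if s then v < b else v \<le> b))"
    by (rule exists_between_bounds[OF fin])
  also have "\<dots> \<longleftrightarrow> (\<exists>v. \<forall>l\<in>A \<union> B. dlit_val (X(y := v)) l)"
  proof -
    have "dlit_val (X(y := v)) l \<longleftrightarrow> (if strict l then X (src l) + R (off l) < v else X (src l) + R (off l) \<le> v)"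
      if "l \<in> A" for v l using that by (simp add: A_def dlit_val_def)
    moreover have "dlit_val (X(y := v)) l \<longleftrightarrow> (if strict l then v < X (tgt l) - R (off l) else v \<le> X (tgt l) - R (off l))"
      if "l \<in> B" for v l using that by (simp add: B_def dlit_val_def algebra_simps)
    ultimately show ?thesis by (simp add: L_def U_def ball_Un)
  qed
  finally show ?thesis unfolding cl using K by (simp add: ball_Un)
qed

lemma dnf_val_clause_elim:
  "y \<noteq> 1 \<Longrightarrow> dnf_val X (map (clause_elim y) D) \<longleftrightarrow> (\<exists>v. dnf_val (X(y := v)) D)"
  unfolding dnf_val_def using clause_elim_iff[of y _ X] by auto

lemma dnf_val_elim:
  assumes "1 \<notin> set ys"
  shows "dnf_val X (dnf_elim ys D) \<longleftrightarrow> (\<exists>Y. (\<forall>i. i \<notin> set ys \<longrightarrow> Y i = X i) \<and> dnf_val Y D)"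
  using assms
proof (induction ys arbitrary: X)
  case Nil
  have "(\<forall>i. Y i = X i) \<longleftrightarrow> Y = X" for Y by auto
  then show ?case by (simp add: dnf_elim_def)
next
  case (Cons y ys)
  have "dnf_val X (dnf_elim (y # ys) D) \<longleftrightarrow> (\<exists>v. dnf_val (X(y := v)) (dnf_elim ys D))"
    using Cons.prems by (simp add: dnf_elim_def dnf_val_clause_elim)
  also have "\<dots> \<longleftrightarrow> (\<exists>v Y. (\<forall>i. i \<notin> set ys \<longrightarrow> Y i = (X(y := v)) i) \<and> dnf_val Y D)"
    using Cons by simp
  also have "\<dots> \<longleftrightarrow> (\<exists>Y. (\<forall>i. i \<notin> set (y # ys) \<longrightarrow> Y i = X i) \<and> dnf_val Y D)"
  proof (intro iffI; elim exE conjE)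
    fix Y assume "\<forall>i. i \<notin> set (y # ys) \<longrightarrow> Y i = X i" "dnf_val Y D"
    then show "\<exists>v Y. (\<forall>i. i \<notin> set ys \<longrightarrow> Y i = (X(y := v)) i) \<and> dnf_val Y D"
      by (intro exI[of _ "Y y"] exI[of _ Y]) auto
  next
    fix v Y assume "\<forall>i. i \<notin> set ys \<longrightarrow> Y i = (X(y := v)) i" "dnf_val Y D"
    then show "\<exists>Y. (\<forall>i. i \<notin> set (y # ys) \<longrightarrow> Y i = X i) \<and> dnf_val Y D"
      by (intro exI[of _ Y]) auto
  qed
  finally show ?case .
qed

subsection \<open>From MLSL to difference constraints\<close>

definition knat :: "nat \<Rightarrow> nat" where
  "knat n = rec_nat kzero (\<lambda>_ r. kadd r kone) n"

text \<open>Undoes \<open>int_encode\<close>: an even code \<open>2 * k\<close> stands for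
  \<open>k\<close>, an odd code \<open>2 * k + 1\<close> for \<open>- (k + 1)\<close>.\<close>

definition kint :: "nat \<Rightarrow> nat" where
  "kint c = (if 2 * (c div 2) = c then knat (c div 2) else kneg (knat (Suc (c div 2))))"

definition krat :: "nat \<Rightarrow> nat" where
  "krat c = kdiv (kint (fst (prod_decode c))) (kint (snd (prod_decode c)))"

lemma R_knat [simp]: "R (knat n) = real n"
  by (induction n) (simp_all add: knat_def)

lemma R_kint [simp]: "R (kint (int_encode i)) = of_int i"
  by (auto simp: kint_def int_encode_def sum_encode_def)

lemma R_krat [simp]: "R (krat (rat_code q)) = of_rat q"
proof -
  obtain a b where ab: "quotient_of q = (a, b)" by fastforce
  then have "q = of_int a / of_int b" by (rule quotient_of_div)
  then have "(of_rat q :: real) = of_int a / of_int b" by (simp add: of_rat_divide)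
  then show ?thesis by (simp add: krat_def rat_code_def ab)
qed

text \<open>
  The variables \<open>0\<close> and \<open>2\<close> are the ends of the view, \<open>4\<close> is a chop point, and each car has a
  variable for its position and one for the end of its braking distance. The odd numbers remain
  free for the unperturbed values.
\<close>

definition pos_var :: "nat \<Rightarrow> nat" where "pos_var C = 6 + 4 * C"
definition end_var :: "nat \<Rightarrow> nat" where "end_var C = 8 + 4 * C"

definition assoc :: "(nat \<times> nat) list \<Rightarrow> nat \<Rightarrow> nat" where
  "assoc xs v = foldr (\<lambda>p r. if fst p = v then snd p else r) xs 0"

lemma assoc_simps [simp]:
  "assoc [] v = 0" "assoc (p # xs) v = (if fst p = v then snd p else assoc xs v)"
  by (simp_all add: assoc_def)

text \<open>The list \<open>cs\<close> contains the cars with the codes of their reserved and claimed lanes.\<close>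

primrec mlsl_dnf ::
  "mlsl \<Rightarrow> (nat \<times> nat list \<times> nat list) list \<Rightarrow> nat \<Rightarrow> nat \<Rightarrow> (nat \<times> nat) list \<Rightarrow> dlit list list" where
  "mlsl_dnf (Same x y) cs l h \<nu> = (if assoc \<nu> (cvar_code x) = assoc \<nu> (cvar_code y) then [[]] else [])"
| "mlsl_dnf Free cs l h \<nu> = (if l = h
     then foldr (\<lambda>e D. if 2 * l \<in> set (fst (snd e)) \<or> 2 * l \<in> set (snd (snd e))
         then dnf_and [[(False, end_var (fst e), kzero, 0)], [(False, 2, kzero, pos_var (fst e))]] D else D)
       cs [[(True, 0, kzero, 2)]]
     else [])"
| "mlsl_dnf (Re x) cs l h \<nu> =
     (if l = h \<and> list_ex (\<lambda>e. fst e = assoc \<nu> (cvar_code x) \<and> 2 * l \<in> set (fst (snd e))) cs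
      then [[(True, 0, kzero, 2), (False, pos_var (assoc \<nu> (cvar_code x)), kzero, 0),
        (False, 2, kzero, end_var (assoc \<nu> (cvar_code x)))]]
      else [])"
| "mlsl_dnf (Cl x) cs l h \<nu> =
     (if l = h \<and> list_ex (\<lambda>e. fst e = assoc \<nu> (cvar_code x) \<and> 2 * l \<in> set (snd (snd e))) cs
      then [[(True, 0, kzero, 2), (False, pos_var (assoc \<nu> (cvar_code x)), kzero, 0),
        (False, 2, kzero, end_var (assoc \<nu> (cvar_code x)))]]
      else [])"
| "mlsl_dnf (Length q) cs l h \<nu> =
     [[(False, 0, krat (rat_code q), 2), (False, 2, kneg (krat (rat_code q)), 0)]]"
| "mlsl_dnf (Neg \<phi>) cs l h \<nu> = dnf_neg (mlsl_dnf \<phi> cs l h \<nu>)"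
| "mlsl_dnf (Conj \<phi> \<psi>) cs l h \<nu> = dnf_and (mlsl_dnf \<phi> cs l h \<nu>) (mlsl_dnf \<psi> cs l h \<nu>)"
| "mlsl_dnf (Ex c \<phi>) cs l h \<nu> = concat (map (\<lambda>e. mlsl_dnf \<phi> cs l h ((Suc c, fst e) # \<nu>)) cs)"
| "mlsl_dnf (HChop \<phi> \<psi>) cs l h \<nu> = map (clause_elim 4)
     (dnf_and [[(False, 0, kzero, 4), (False, 4, kzero, 2)]]
       (dnf_and (map (clause_rename 2 4) (mlsl_dnf \<phi> cs l h \<nu>))
         (map (clause_rename 0 4) (mlsl_dnf \<psi> cs l h \<nu>))))"
| "mlsl_dnf (VChop \<phi>\<^sub>2 \<phi>\<^sub>1) cs l h \<nu> =
     (if l \<le> h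
      then concat (map (\<lambda>m. dnf_and (mlsl_dnf \<phi>\<^sub>1 cs l m \<nu>) (mlsl_dnf \<phi>\<^sub>2 cs (Suc m) h \<nu>)) [l - 1..<Suc h])
      else dnf_and (mlsl_dnf \<phi>\<^sub>1 cs l h \<nu>) (mlsl_dnf \<phi>\<^sub>2 cs l h \<nu>))"

lemma cvar_code_eq_iff [simp]: "cvar_code x = cvar_code y \<longleftrightarrow> x = y"
  by (cases x; cases y) auto

text \<open>The procedure computes with lanes as natural numbers, while lane lists are stored by
  \<open>int_encode\<close>; hence \<open>mlsl_dnf\<close> looks up \<open>2 * l\<close>.\<close>

lemma int_encode_of_nat [simp]: "int_encode (int n) = 2 * n"
  by (simp add: int_encode_def sum_encode_def)

lemma interval_avoids_open_iff:
  fixes p e a b :: real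
  assumes "p < e" "a < b"
  shows "{p..e} \<inter> {a<..<b} = {} \<longleftrightarrow> e \<le> a \<or> b \<le> p"
proof
  assume empty: "{p..e} \<inter> {a<..<b} = {}"
  show "e \<le> a \<or> b \<le> p"
  proof (rule ccontr)
    assume "\<not> ?thesis"
    then have "max p a < min e b" using assms by auto
    then obtain x where "max p a < x" "x < min e b" using dense by blast
    then have "x \<in> {p..e} \<inter> {a<..<b}" by auto
    with empty show False by blast
  qed
qed auto

text \<open>The hypotheses on \<open>X\<close> fix only the ends of the view and the variables of
  the cars. Variable 4 stays unconstrained, so all chops, nested ones included, can share
  it.\<close>

lemma dnf_val_mlsl_dnf:
  assumes cs: "cars T = fst ` set cs"
    and res: "\<And>C rs ks l. (C, rs, ks) \<in> set cs \<Longrightarrow> l \<in> res S C \<longleftrightarrow> int_encode l \<in> set rs"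
    and clm: "\<And>C rs ks l. (C, rs, ks) \<in> set cs \<Longrightarrow> l \<in> clm S C \<longleftrightarrow> int_encode l \<in> set ks"
    and len: "\<And>C. C \<in> cars T \<Longrightarrow> 0 < len S C"
    and X: "\<And>C. C \<in> cars T \<Longrightarrow> X (pos_var C) = pos S C"
      "\<And>C. C \<in> cars T \<Longrightarrow> X (end_var C) = pos S C + len S C"
      "X 0 = left V" "X 2 = right V"
    and V: "lo V = int l" "hi V = int h" "0 < l"
    and \<nu>: "\<And>v. v \<in> free_vars \<phi> \<Longrightarrow> assoc \<nu>s (cvar_code v) = \<nu> v" "range \<nu> \<subseteq> cars T"
  shows "dnf_val X (mlsl_dnf \<phi> cs l h \<nu>s) \<longleftrightarrow> holds T S \<phi> V \<nu>"
  using X V \<nu>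
proof (induction \<phi> arbitrary: X V l h \<nu>s \<nu>)
  case Free
  define occ where "occ e \<longleftrightarrow> 2 * l \<in> set (fst (snd e)) \<or> 2 * l \<in> set (snd (snd e))"
    for e :: "nat \<times> nat list \<times> nat list"
  have *: "dnf_val X (foldr (\<lambda>e D. if occ e
         then dnf_and [[(False, end_var (fst e), kzero, 0)], [(False, 2, kzero, pos_var (fst e))]] D else D)
       es [[(True, 0, kzero, 2)]]) \<longleftrightarrow>
     X 0 < X 2 \<and> (\<forall>e\<in>set es. \<not> occ e \<or> X (end_var (fst e)) \<le> X 0 \<or> X 2 \<le> X (pos_var (fst e)))" for es
    by (induction es) (auto simp: dlit_val_def)
  have occ_iff: "\<not> occ e \<or> X (end_var (fst e)) \<le> X 0 \<or> X 2 \<le> X (pos_var (fst e)) \<longleftrightarrow>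
      lo V \<notin> res S (fst e) \<union> clm S (fst e) \<or> extent S (fst e) \<inter> {left V<..<right V} = {}"
    if "e \<in> set cs" "left V < right V" for e
  proof -
    obtain C rs ks where e: "e = (C, rs, ks)" by (cases e) auto
    have C: "C \<in> cars T" using that(1) e cs by force
    then show ?thesis
      using res[of C rs ks "int l"] clm[of C rs ks "int l"] that e len[OF C] Free.prems
      by (simp add: occ_def extent_def interval_avoids_open_iff)
  qed
  have "(\<forall>e\<in>set cs. \<not> occ e \<or> X (end_var (fst e)) \<le> X 0 \<or> X 2 \<le> X (pos_var (fst e))) \<longleftrightarrow>
      (\<forall>C\<in>cars T. lo V \<notin> res S C \<union> clm S C \<or> extent S C \<inter> {left V<..<right V} = {})"
    if "left V < right V"
    unfolding cs ball_simps by (rule ball_cong[OF refl]) (rule occ_iff[OF _ that])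
  with *[of cs] show ?case unfolding mlsl_dnf.simps holds.simps occ_def
    by (cases "l = h \<and> left V < right V") (auto simp: Free.prems)
next
  case (Re x)
  have x: "\<nu> x \<in> cars T" "assoc \<nu>s (cvar_code x) = \<nu> x" using Re.prems by auto
  have "list_ex (\<lambda>e. fst e = \<nu> x \<and> 2 * l \<in> set (fst (snd e))) cs \<longleftrightarrow> int l \<in> res S (\<nu> x)"
  proof
    assume "list_ex (\<lambda>e. fst e = \<nu> x \<and> 2 * l \<in> set (fst (snd e))) cs"
    then obtain a b where "(\<nu> x, a, b) \<in> set cs" "2 * l \<in> set a" by (auto simp: list_ex_iff)
    then show "int l \<in> res S (\<nu> x)" using res[of "\<nu> x" a b "int l"] by simp
  next
    assume l: "int l \<in> res S (\<nu> x)"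
    from x(1) obtain a b where ab: "(\<nu> x, a, b) \<in> set cs" unfolding cs by force
    with l show "list_ex (\<lambda>e. fst e = \<nu> x \<and> 2 * l \<in> set (fst (snd e))) cs"
      using res[OF ab, of "int l"] by (auto simp: list_ex_iff intro!: bexI[OF _ ab])
  qed
  then show ?case using x Re.prems by (auto simp: dlit_val_def extent_def)
next
  case (Cl x)
  have x: "\<nu> x \<in> cars T" "assoc \<nu>s (cvar_code x) = \<nu> x" using Cl.prems by auto
  have "list_ex (\<lambda>e. fst e = \<nu> x \<and> 2 * l \<in> set (snd (snd e))) cs \<longleftrightarrow> int l \<in> clm S (\<nu> x)"
  proof
    assume "list_ex (\<lambda>e. fst e = \<nu> x \<and> 2 * l \<in> set (snd (snd e))) cs"
    then obtain a b where "(\<nu> x, a, b) \<in> set cs" "2 * l \<in> set b" by (auto simp: list_ex_iff)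
    then show "int l \<in> clm S (\<nu> x)" using clm[of "\<nu> x" a b "int l"] by simp
  next
    assume l: "int l \<in> clm S (\<nu> x)"
    from x(1) obtain a b where ab: "(\<nu> x, a, b) \<in> set cs" unfolding cs by force
    with l show "list_ex (\<lambda>e. fst e = \<nu> x \<and> 2 * l \<in> set (snd (snd e))) cs"
      using clm[OF ab, of "int l"] by (auto simp: list_ex_iff intro!: bexI[OF _ ab])
  qed
  then show ?case using x Cl.prems by (auto simp: dlit_val_def extent_def)
next
  case (Ex c \<phi>)
  have "dnf_val X (mlsl_dnf \<phi> cs l h ((Suc c, C) # \<nu>s)) \<longleftrightarrow> holds T S \<phi> V (\<nu>(CVar c := C))"
    if "C \<in> cars T" for C
  proof (rule Ex.IH)
    show "assoc ((Suc c, C) # \<nu>s) (cvar_code v) = (\<nu>(CVar c := C)) v" if "v \<in> free_vars \<phi>" for v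
      using that Ex.prems(8)[of v] cvar_code_eq_iff[of "CVar c" v] by auto
  qed (use that Ex.prems in auto)
  then show ?case by (auto simp: cs)
next
  case (HChop \<phi> \<psi>)
  \<comment> \<open>Renaming 2 to 4 evaluates the left part in an environment whose right end is the
    chop point; for the right part, 0 is renamed instead.\<close>
  have 1: "dnf_val (X(4 := s, 2 := s)) (mlsl_dnf \<phi> cs l h \<nu>s) \<longleftrightarrow> holds T S \<phi> (V\<lparr>right := s\<rparr>) \<nu>" for s
    by (rule HChop.IH(1)) (use HChop.prems in \<open>auto simp: pos_var_def end_var_def\<close>)
  have 2: "dnf_val (X(4 := s, 0 := s)) (mlsl_dnf \<psi> cs l h \<nu>s) \<longleftrightarrow> holds T S \<psi> (V\<lparr>left := s\<rparr>) \<nu>" for s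
    by (rule HChop.IH(2)) (use HChop.prems in \<open>auto simp: pos_var_def end_var_def\<close>)
  show ?case using HChop.prems
    by (auto simp: dnf_val_clause_elim 1 2 dlit_val_def)
next
  case (VChop \<phi>\<^sub>2 \<phi>\<^sub>1)
  show ?case
  proof (cases "l \<le> h")
    case True
    have 1: "dnf_val X (mlsl_dnf \<phi>\<^sub>1 cs l m \<nu>s) \<longleftrightarrow> holds T S \<phi>\<^sub>1 (V\<lparr>hi := int m\<rparr>) \<nu>" for m
      by (rule VChop.IH(2)) (use VChop.prems in auto)
    have 2: "dnf_val X (mlsl_dnf \<phi>\<^sub>2 cs (Suc m) h \<nu>s) \<longleftrightarrow> holds T S \<phi>\<^sub>2 (V\<lparr>lo := int m + 1\<rparr>) \<nu>" for m
      by (rule VChop.IH(1)) (use VChop.prems in auto)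
    \<comment> \<open>\<open>0 < l\<close> makes the truncated difference \<open>l - 1\<close> agree
      with the integer one. This smallest \<open>m\<close> gives the lower part no lanes.\<close>
    have "{int l - 1..int h} = int ` set [l - 1..<Suc h]"
      unfolding set_upt image_int_atLeastLessThan using VChop.prems(7) by (auto simp: of_nat_diff)
    then have "holds T S (VChop \<phi>\<^sub>2 \<phi>\<^sub>1) V \<nu> \<longleftrightarrow>
        (\<exists>m\<in>set [l - 1..<Suc h]. holds T S \<phi>\<^sub>1 (V\<lparr>hi := int m\<rparr>) \<nu> \<and> holds T S \<phi>\<^sub>2 (V\<lparr>lo := int m + 1\<rparr>) \<nu>)"
      using True VChop.prems(5,6) by (simp del: set_upt)
    then show ?thesis using True by (simp del: set_upt upt_Suc holds.simps add: 1 2)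
  next
    case False
    then show ?thesis using VChop.IH[of X V l h \<nu>s \<nu>] VChop.prems by simp
  qed
next
  case (Length q)
  then show ?case by (auto simp: dlit_val_def)
qed (auto simp: dlit_val_def)

end

subsection \<open>Computability\<close>

lemma computable_half [computable_intros]:
  assumes "computable f" shows "computable (\<lambda>x. f x div (2 :: nat))"
proof -
  have *: "rec_nat 0 (\<lambda>i r. if 2 * Suc i \<le> c then Suc i else r) n = min n (c div 2)" for c n :: nat
    by (induction n) (auto simp: min_def)
  then have "c div 2 = rec_nat 0 (\<lambda>i r. if 2 * Suc i \<le> c then Suc i else r) c" for c :: nat
    by (simp only: * min_absorb2 div_le_dividend)
  then show ?thesis
    by (simp only:) (intro computable_intros computable_compose[OF assms] assms)
qed

instantiation mlsl :: enc begin
definition enc_mlsl :: "mlsl \<Rightarrow> nat" where "enc_mlsl = mlsl_code"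
instance ..
end

definition mlsl_arg :: "nat \<Rightarrow> mlsl \<Rightarrow> nat" where
  "mlsl_arg k \<phi> = nth_or 0 (list_decode (mlsl_code \<phi>)) k"

text \<open>Subformulas are selected by their position in \<open>mlsl_code\<close>. There the bound
  variable of \<open>Ex\<close> occupies position 1, so the body of \<open>Ex\<close> falls to
  \<open>mlsl_sub2\<close>.\<close>

fun mlsl_sub1 :: "mlsl \<Rightarrow> mlsl" where
  "mlsl_sub1 (Neg \<phi>) = \<phi>"
| "mlsl_sub1 (Conj \<phi> \<psi>) = \<phi>"
| "mlsl_sub1 (HChop \<phi> \<psi>) = \<phi>"
| "mlsl_sub1 (VChop \<phi> \<psi>) = \<phi>"
| "mlsl_sub1 _ = Free"

fun mlsl_sub2 :: "mlsl \<Rightarrow> mlsl" where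
  "mlsl_sub2 (Conj \<phi> \<psi>) = \<psi>"
| "mlsl_sub2 (Ex c \<phi>) = \<phi>"
| "mlsl_sub2 (HChop \<phi> \<psi>) = \<psi>"
| "mlsl_sub2 (VChop \<phi> \<psi>) = \<psi>"
| "mlsl_sub2 _ = Free"

lemma computable_via_nat:
  fixes g :: "nat \<Rightarrow> nat"
  assumes "computable g" "\<And>x. g (enc x) = enc (f x)"
  shows "computable f"
  using assms unfolding computable_nat_iff by (rule computableI)

lemma computable_mlsl_arg [computable_intros]:
  assumes "computable f" shows "computable (\<lambda>x. mlsl_arg k (f x))"
proof (rule computable_compose[OF _ assms], rule computable_via_nat)
  show "computable (\<lambda>n. nth_or 0 (list_decode n) k)" by (intro computable_intros)
qed (simp add: mlsl_arg_def enc_mlsl_def)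

lemma computable_mlsl_sub [computable_intros]:
  assumes "computable f"
  shows "computable (\<lambda>x. mlsl_sub1 (f x))" "computable (\<lambda>x. mlsl_sub2 (f x))"
proof -
  define tag where "tag n = nth_or 0 (list_decode n) 0" for n
  have tag: "computable tag" unfolding tag_def by (intro computable_intros)
  show "computable (\<lambda>x. mlsl_sub1 (f x))"
  proof (rule computable_compose[OF _ assms], rule computable_via_nat)
    show "computable (\<lambda>n. if tag n = 5 \<or> tag n = 6 \<or> tag n = 8 \<or> tag n = 9
        then nth_or 0 (list_decode n) 1 else mlsl_code Free)"
      by (intro computable_intros computable_compose[OF tag])
    show "(if tag (enc \<phi>) = 5 \<or> tag (enc \<phi>) = 6 \<or> tag (enc \<phi>) = 8 \<or> tag (enc \<phi>) = 9
        then nth_or 0 (list_decode (enc \<phi>)) 1 else mlsl_code Free) = enc (mlsl_sub1 \<phi>)" for \<phi>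
      unfolding enc_mlsl_def tag_def by (cases \<phi>) simp_all
  qed
  show "computable (\<lambda>x. mlsl_sub2 (f x))"
  proof (rule computable_compose[OF _ assms], rule computable_via_nat)
    show "computable (\<lambda>n. if tag n = 6 \<or> tag n = 7 \<or> tag n = 8 \<or> tag n = 9
        then nth_or 0 (list_decode n) 2 else mlsl_code Free)"
      by (intro computable_intros computable_compose[OF tag])
    show "(if tag (enc \<phi>) = 6 \<or> tag (enc \<phi>) = 7 \<or> tag (enc \<phi>) = 8 \<or> tag (enc \<phi>) = 9
        then nth_or 0 (list_decode (enc \<phi>)) 2 else mlsl_code Free) = enc (mlsl_sub2 \<phi>)" for \<phi>
      unfolding enc_mlsl_def tag_def by (cases \<phi>) simp_all
  qed
qed

text \<open>Makes the code of a formula a rank for the recursion on subformulas.\<close>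

lemma less_list_encode: "x \<in> set xs \<Longrightarrow> x < list_encode xs"
proof (induction xs)
  case (Cons y ys)
  have "y \<le> prod_encode (y, list_encode ys)" "list_encode ys \<le> prod_encode (y, list_encode ys)"
    by (rule le_prod_encode_1, rule le_prod_encode_2)
  with Cons show ?case by auto
qed simp

context named_field
begin

lemma computable_kneg [computable_intros]:
  "computable f \<Longrightarrow> computable (\<lambda>x. kneg (f x))"
  unfolding kneg_def by (intro computable_intros)

lemma computable_knat [computable_intros]:
  "computable f \<Longrightarrow> computable (\<lambda>x. knat (f x))"
  unfolding knat_def by (intro computable_intros)

lemma computable_krat [computable_intros]:
  assumes "computable f" shows "computable (\<lambda>x. krat (f x))"
  by (rule computable_compose[OF _ assms], unfold krat_def kint_def) (intro computable_intros)

lemma computable_dnf_and [computable_intros]: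
  assumes "computable f" "computable g" shows "computable (\<lambda>x. dnf_and (f x) (g x))"
  by (rule computable_compose2[OF _ assms], unfold dnf_and_def) (intro computable_intros)

lemma computable_dnf_neg [computable_intros]:
  assumes "computable f" shows "computable (\<lambda>x. dnf_neg (f x))"
  by (rule computable_compose[OF _ assms], unfold dnf_neg_def dlit_neg_def) (intro computable_intros)

lemma computable_clause_rename [computable_intros]:
  assumes "computable f" shows "computable (\<lambda>x. clause_rename y z (f x))"
  by (rule computable_compose[OF _ assms], unfold clause_rename_def) (intro computable_intros)

lemma computable_clause_elim [computable_intros]:
  assumes "computable y" "computable f" shows "computable (\<lambda>x. clause_elim (y x) (f x))"
  by (rule computable_compose2[OF _ assms], unfold clause_elim_def) (intro computable_intros)

lemma computable_dnf_elim [computable_intros]: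
  assumes "computable ys" "computable f" shows "computable (\<lambda>x. dnf_elim (ys x) (f x))"
  by (rule computable_compose2[OF _ assms], unfold dnf_elim_def) (intro computable_intros)

lemma computable_assoc [computable_intros]:
  assumes "computable xs" "computable v" shows "computable (\<lambda>x. assoc (xs x) (v x))"
  by (rule computable_compose2[OF _ assms], unfold assoc_def) (intro computable_intros)

lemma computable_vars [computable_intros]:
  assumes "computable C"
  shows "computable (\<lambda>x. pos_var (C x))" "computable (\<lambda>x. end_var (C x))"
  unfolding pos_var_def end_var_def by (intro computable_intros assms)+

text \<open>An argument consists of a formula, the list of cars, the lanes of the view and a valuation.\<close>

type_synonym mlsl_job =
  "mlsl \<times> (nat \<times> nat list \<times> nat list) list \<times> nat \<times> nat \<times> (nat \<times> nat) list"

definition mlsl_deps :: "mlsl_job \<Rightarrow> mlsl_job list" where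
  "mlsl_deps x =
    (let \<phi> = fst x; cs = fst (snd x); l = fst (snd (snd x)); h = fst (snd (snd (snd x)));
       \<nu> = snd (snd (snd (snd x))); tag = mlsl_arg 0 \<phi>; ms = [l - 1..<Suc h]
     in if tag = 5 then [(mlsl_sub1 \<phi>, cs, l, h, \<nu>)]
        else if tag = 6 \<or> tag = 8 then [(mlsl_sub1 \<phi>, cs, l, h, \<nu>), (mlsl_sub2 \<phi>, cs, l, h, \<nu>)]
        else if tag = 7 then map (\<lambda>e. (mlsl_sub2 \<phi>, cs, l, h, (Suc (mlsl_arg 1 \<phi>), fst e) # \<nu>)) cs
        else if tag = 9
        then if l \<le> h then map (\<lambda>m. (mlsl_sub2 \<phi>, cs, l, m, \<nu>)) ms @ map (\<lambda>m. (mlsl_sub1 \<phi>, cs, Suc m, h, \<nu>)) ms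
          else [(mlsl_sub2 \<phi>, cs, l, h, \<nu>), (mlsl_sub1 \<phi>, cs, l, h, \<nu>)]
        else [])"

text \<open>The recursion equation of \<open>mlsl_dnf\<close>, with the results of the recursive
  calls in \<open>Ds\<close>. For a vertical chop of a nonempty view these are \<open>n\<close>
  results for the lower part followed by \<open>n\<close> for the upper part.\<close>

definition mlsl_step :: "mlsl_job \<Rightarrow> dlit list list list \<Rightarrow> dlit list list" where
  "mlsl_step x Ds =
    (let \<phi> = fst x; cs = fst (snd x); l = fst (snd (snd x)); h = fst (snd (snd (snd x)));
       \<nu> = snd (snd (snd (snd x))); tag = mlsl_arg 0 \<phi>; C = assoc \<nu> (mlsl_arg 1 \<phi>);
       D = nth_or [] Ds 0; E = nth_or [] Ds 1; n = Suc h - (l - 1);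
       covers = [[(True, 0, kzero, 2), (False, pos_var C, kzero, 0), (False, 2, kzero, end_var C)]]
     in if tag = 0 then if C = assoc \<nu> (mlsl_arg 2 \<phi>) then [[]] else []
        else if tag = 1 then if l = h
          then foldr (\<lambda>e D. if 2 * l \<in> set (fst (snd e)) \<or> 2 * l \<in> set (snd (snd e))
              then dnf_and [[(False, end_var (fst e), kzero, 0)], [(False, 2, kzero, pos_var (fst e))]] D else D)
            cs [[(True, 0, kzero, 2)]]
          else []
        else if tag = 2 then if l = h \<and> list_ex (\<lambda>e. fst e = C \<and> 2 * l \<in> set (fst (snd e))) cs then covers else []
        else if tag = 3 then if l = h \<and> list_ex (\<lambda>e. fst e = C \<and> 2 * l \<in> set (snd (snd e))) cs then covers else []
        else if tag = 4 then [[(False, 0, krat (mlsl_arg 1 \<phi>), 2), (False, 2, kneg (krat (mlsl_arg 1 \<phi>)), 0)]]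
        else if tag = 5 then dnf_neg D
        else if tag = 6 then dnf_and D E
        else if tag = 7 then concat Ds
        else if tag = 8 then map (clause_elim 4)
          (dnf_and [[(False, 0, kzero, 4), (False, 4, kzero, 2)]]
            (dnf_and (map (clause_rename 2 4) D) (map (clause_rename 0 4) E)))
        else if l \<le> h then concat (map (\<lambda>i. dnf_and (nth_or [] Ds i) (nth_or [] Ds (n + i))) [0..<n])
        else dnf_and D E)"

lemma computable_mlsl_step: "computable (\<lambda>p. mlsl_step (fst p) (snd p))"
  unfolding mlsl_step_def by (intro computable_intros)

lemma computable_mlsl_deps: "computable mlsl_deps"
  unfolding mlsl_deps_def by (intro computable_intros)

lemma nth_or_map: "i < length xs \<Longrightarrow> nth_or d (map f xs) i = f (xs ! i)"
  by (simp add: nth_or_nth)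

lemma nth_or_append:
  "i < length xs \<Longrightarrow> nth_or d (xs @ ys) i = nth_or d xs i" "nth_or d (xs @ ys) (length xs + i) = nth_or d ys i"
  by (simp_all add: nth_or_def split: list.split)

lemma concat_map_nth_or_append:
  "concat (map (\<lambda>i. g (nth_or d (map f ms @ map f' ms) i) (nth_or d (map f ms @ map f' ms) (length ms + i)))
     [0..<length ms]) = concat (map (\<lambda>m. g (f m) (f' m)) ms)"
proof -
  have "map (\<lambda>i. g (nth_or d (map f ms @ map f' ms) i) (nth_or d (map f ms @ map f' ms) (length ms + i))) [0..<length ms]
      = map (\<lambda>i. g (f (ms ! i)) (f' (ms ! i))) [0..<length ms]"
    using nth_or_append[where xs = "map f ms" and ys = "map f' ms" and d = d] by (auto simp: nth_or_map)
  also have "\<dots> = map (\<lambda>m. g (f m) (f' m)) ms" by (rule nth_equalityI) auto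
  finally show ?thesis by simp
qed

lemma computable_mlsl_dnf [computable_intros]:
  assumes "computable \<phi>" "computable cs" "computable l" "computable h" "computable \<nu>"
  shows "computable (\<lambda>x. mlsl_dnf (\<phi> x) (cs x) (l x) (h x) (\<nu> x))"
proof -
  define f where "f x = mlsl_dnf (fst x) (fst (snd x)) (fst (snd (snd x)))
    (fst (snd (snd (snd x)))) (snd (snd (snd (snd x))))" for x :: mlsl_job
  have "computable f"
  proof (rule computable_tree_rec[OF computable_mlsl_deps computable_mlsl_step])
    show "computable (\<lambda>x :: mlsl_job. enc (fst x))" by (intro computable_intros)
    show "enc (fst y) < enc (fst x)" if "y \<in> set (mlsl_deps x)" for x y
    proof -
      have "enc (mlsl_sub1 \<phi>) < enc \<phi>" if "mlsl_arg 0 \<phi> \<in> {5, 6, 8, 9}" for \<phi>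
        using that by (cases \<phi>) (auto simp: mlsl_arg_def enc_mlsl_def simp del: list_encode.simps intro!: less_list_encode)
      moreover have "enc (mlsl_sub2 \<phi>) < enc \<phi>" if "mlsl_arg 0 \<phi> \<in> {6, 7, 8, 9}" for \<phi>
        using that by (cases \<phi>) (auto simp: mlsl_arg_def enc_mlsl_def simp del: list_encode.simps intro!: less_list_encode)
      ultimately show ?thesis
        using that by (auto simp: mlsl_deps_def Let_def simp del: upt_Suc split: if_splits)
    qed
    show "f x = mlsl_step x (map f (mlsl_deps x))" for x
    proof -
      obtain \<phi> cs l h \<nu> where x: "x = (\<phi>, cs, l, h, \<nu>)" by (cases x) auto
      show ?thesis
      proof (cases \<phi>)
        case (VChop \<phi>\<^sub>2 \<phi>\<^sub>1)
        have "f x = mlsl_step x (map f (mlsl_deps x))" if "l \<le> h"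
        proof -
          define ms where "ms = [l - 1..<Suc h]"
          have n: "Suc h - (l - 1) = length ms" by (simp only: ms_def length_upt)
          have "mlsl_deps x = map (\<lambda>m. (\<phi>\<^sub>1, cs, l, m, \<nu>)) ms @ map (\<lambda>m. (\<phi>\<^sub>2, cs, Suc m, h, \<nu>)) ms"
            using that by (simp add: mlsl_deps_def x VChop mlsl_arg_def ms_def Let_def del: upt_Suc)
          then have "map f (mlsl_deps x) = map (\<lambda>m. mlsl_dnf \<phi>\<^sub>1 cs l m \<nu>) ms @
              map (\<lambda>m. mlsl_dnf \<phi>\<^sub>2 cs (Suc m) h \<nu>) ms"
            by (simp add: f_def o_def)
          moreover have "mlsl_step x Ds =
              concat (map (\<lambda>i. dnf_and (nth_or [] Ds i) (nth_or [] Ds (length ms + i))) [0..<length ms])" for Ds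
            using that unfolding n[symmetric] by (simp add: mlsl_step_def x VChop mlsl_arg_def)
          ultimately have "mlsl_step x (map f (mlsl_deps x)) =
              concat (map (\<lambda>m. dnf_and (mlsl_dnf \<phi>\<^sub>1 cs l m \<nu>) (mlsl_dnf \<phi>\<^sub>2 cs (Suc m) h \<nu>)) ms)"
            by (simp only: concat_map_nth_or_append)
          then show ?thesis
            using that by (simp add: f_def x VChop ms_def del: upt_Suc)
        qed
        moreover have "f x = mlsl_step x (map f (mlsl_deps x))" if "\<not> l \<le> h"
          using that by (simp add: mlsl_deps_def mlsl_step_def x VChop mlsl_arg_def f_def)
        ultimately show ?thesis by blast
      qed (auto simp: mlsl_deps_def mlsl_step_def x mlsl_arg_def f_def o_def Let_def)
    qed
  qed
  from computable_compose[OF this computable_Pair[OF assms(1) computable_Pair[OF assms(2)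
      computable_Pair[OF assms(3) computable_Pair[OF assms(4,5)]]]]]
  show ?thesis by (simp add: f_def)
qed

end

section \<open>Transition sequences\<close>

subsection \<open>Reservations and claims\<close>

definition disc :: "car \<Rightarrow> real action \<Rightarrow> bool" where
  "disc C a \<longleftrightarrow> car_of a = C \<and> \<not> is_acc a"

text \<open>A transition system for the lanes of one car, without time. The car in the letter is
  ignored because words are filtered by \<open>disc C\<close> first.\<close>

fun lane_step :: "real action \<Rightarrow> lane set \<times> lane set \<Rightarrow> lane set \<times> lane set" where
  "lane_step (Claim C n) s = (fst s, {n})"
| "lane_step (Reserve C) s = (fst s \<union> snd s, {})"
| "lane_step (WdClaim C) s = (fst s, {})"
| "lane_step (WdRes C n) s = ({n}, snd s)"
| "lane_step (Acc C a) s = s"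

fun lane_enabled :: "real action \<Rightarrow> lane set \<times> lane set \<Rightarrow> bool" where
  "lane_enabled (Claim C n) s \<longleftrightarrow> (\<exists>n'\<in>{n - 1, n + 1}. fst s = {n'}) \<and> snd s = {}"
| "lane_enabled (WdRes C n) s \<longleftrightarrow> n \<in> fst s \<and> fst s \<noteq> {n}"
| "lane_enabled (Acc C a) s \<longleftrightarrow> True"
| "lane_enabled a s \<longleftrightarrow> lane_step a s \<noteq> s"

fun lane_path :: "real action list \<Rightarrow> lane set \<times> lane set \<Rightarrow> bool" where
  "lane_path [] s \<longleftrightarrow> True"
| "lane_path (a # as) s \<longleftrightarrow> lane_enabled a s \<and> lane_path as (lane_step a s)"

definition lane_state :: "snapshot \<Rightarrow> car \<Rightarrow> lane set \<times> lane set" where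
  "lane_state S C = (res S C, clm S C)"

lemma lane_path_append: "lane_path (u @ v) s \<Longrightarrow> lane_path u s"
  by (induction u arbitrary: s) auto

lemma lane_state_delay [simp]: "lane_state (delay T z S) C = lane_state S C"
  by (simp add: lane_state_def delay_def)

lemma lane_state_effect:
  "lane_state (effect a S) C = (if disc C a then lane_step a (lane_state S C) else lane_state S C)"
  by (cases a) (auto simp: lane_state_def disc_def)

lemma enabled_iff: "enabled S a \<longleftrightarrow> lane_enabled a (lane_state S (car_of a))"
proof (cases a)
  case (Reserve C)
  have "effect a S = S \<longleftrightarrow> lane_step a (lane_state S C) = lane_state S C"
    by (cases S) (auto simp: Reserve lane_state_def fun_eq_iff)
  then show ?thesis by (simp add: Reserve)
next
  case (WdClaim C)
  have "effect a S = S \<longleftrightarrow> lane_step a (lane_state S C) = lane_state S C"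
    by (cases S) (auto simp: WdClaim lane_state_def fun_eq_iff)
  then show ?thesis by (simp add: WdClaim)
next
  case (WdRes C n)
  have "effect a S = S \<longleftrightarrow> res S C = {n}"
    by (cases S) (auto simp: WdRes fun_eq_iff)
  then show ?thesis by (simp add: WdRes lane_state_def)
qed (auto simp: lane_state_def)

lemma exec_lane_state:
  "exec T t\<^sub>0 w t\<^sub>1 S = Some S' \<Longrightarrow>
    lane_state S' C = fold lane_step (filter (disc C) (map fst w)) (lane_state S C)"
proof (induction T t\<^sub>0 w t\<^sub>1 S rule: exec.induct)
  case (2 T t\<^sub>0 a \<tau> w t\<^sub>1 S)
  then show ?case by (auto simp: Let_def lane_state_effect split: if_splits)
qed auto

text \<open>Enabledness depends only on the lanes of the letter's own car, and neither delays nor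
  accelerations change lanes. So the existence of a run is independent of the stamps and of the
  interleaving, and shifted words inherit admissibility.\<close>

lemma exec_defined_iff:
  "exec T t\<^sub>0 w t\<^sub>1 S \<noteq> None \<longleftrightarrow> (\<forall>C. lane_path (filter (disc C) (map fst w)) (lane_state S C))"
proof (induction T t\<^sub>0 w t\<^sub>1 S rule: exec.induct)
  case (2 T t\<^sub>0 a \<tau> w t\<^sub>1 S)
  define S' where "S' = delay T (\<tau> - t\<^sub>0) S"
  have IH: "exec T \<tau> w t\<^sub>1 (effect a S') \<noteq> None \<longleftrightarrow>
      (\<forall>C. lane_path (filter (disc C) (map fst w)) (lane_state (effect a S') C))" if "enabled S' a"
    using 2 that by (simp add: S'_def)
  have en: "enabled S' a \<longleftrightarrow> lane_enabled a (lane_state S (car_of a))"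
    by (simp add: enabled_iff S'_def)
  have "exec T t\<^sub>0 ((a, \<tau>) # w) t\<^sub>1 S \<noteq> None \<longleftrightarrow> enabled S' a \<and>
      (\<forall>C. lane_path (filter (disc C) (map fst w)) (lane_state (effect a S') C))"
    using IH by (simp add: Let_def S'_def)
  also have "\<dots> \<longleftrightarrow> (\<forall>C. lane_path (filter (disc C) (map fst ((a, \<tau>) # w))) (lane_state S C))"
  proof (cases "is_acc a")
    case True
    then have "lane_enabled a s" "\<not> disc C a" for s C by (cases a; simp add: disc_def)+
    then show ?thesis by (simp add: en lane_state_effect) (simp add: S'_def)
  next
    case False
    then have "disc C a \<longleftrightarrow> C = car_of a" for C by (auto simp: disc_def)
    then have "lane_path (filter (disc C) (map fst ((a, \<tau>) # w))) (lane_state S C) \<longleftrightarrow>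
        (C = car_of a \<longrightarrow> lane_enabled a (lane_state S C)) \<and>
        lane_path (filter (disc C) (map fst w)) (lane_state (effect a S') C)" for C
      by (simp add: lane_state_effect S'_def)
    then show ?thesis unfolding en by blast
  qed
  finally show ?case .
qed simp

lemma lane_paths_of_prefix:
  assumes "\<forall>C. lane_path (filter (disc C) (map fst (u @ v))) (s C)"
  shows "\<forall>C. lane_path (filter (disc C) (map fst u)) (s C)"
  using assms lane_path_append by (metis filter_append map_append)

subsection \<open>Trajectories\<close>

type_synonym quad = "real \<times> real \<times> real"

definition quad_val :: "quad \<Rightarrow> real \<Rightarrow> real" where
  "quad_val q t = fst q + fst (snd q) * t + snd (snd q) * t\<^sup>2"

definition quad_deriv :: "quad \<Rightarrow> real \<Rightarrow> real" where
  "quad_deriv q t = fst (snd q) + 2 * snd (snd q) * t"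

text \<open>The trajectory that continues \<open>q\<close> from time \<open>\<tau>\<close> on with the acceleration \<open>a\<close>.\<close>

definition quad_accelerate :: "real \<Rightarrow> real \<Rightarrow> quad \<Rightarrow> quad" where
  "quad_accelerate a \<tau> q = (let b = fst (snd q) + 2 * snd (snd q) * \<tau> - a * \<tau> in
     (fst q + fst (snd q) * \<tau> + snd (snd q) * (\<tau> * \<tau>) - b * \<tau> - a / 2 * (\<tau> * \<tau>), b, a / 2))"

lemma quad_accelerate_at [simp]:
  "quad_val (quad_accelerate a \<tau> q) \<tau> = quad_val q \<tau>"
  "quad_deriv (quad_accelerate a \<tau> q) \<tau> = quad_deriv q \<tau>"
  "snd (snd (quad_accelerate a \<tau> q)) = a / 2"
  by (simp_all add: quad_val_def quad_deriv_def quad_accelerate_def Let_def power2_eq_square algebra_simps)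

fun traj_step :: "car \<Rightarrow> real action \<times> real \<Rightarrow> quad \<Rightarrow> quad" where
  "traj_step C (Acc D a, \<tau>) q = (if D = C then quad_accelerate a \<tau> q else q)"
| "traj_step C _ q = q"

definition traj :: "car \<Rightarrow> (real action \<times> real) list \<Rightarrow> quad \<Rightarrow> quad" where
  "traj C w q = fold (traj_step C) w q"

lemma traj_step_not_acc: "\<not> is_acc (fst x) \<Longrightarrow> traj_step C x q = q"
  by (cases "(C, x, q)" rule: traj_step.cases) auto

text \<open>Similar words share their acceleration letters together with the stamps, so this yields
  the invariance of trajectories under perturbation.\<close>

lemma traj_filter_acc: "traj C (filter (\<lambda>x. is_acc (fst x)) w) q = traj C w q"
  by (induction w arbitrary: q) (auto simp: traj_def traj_step_not_acc)

lemma traj_at_stamp: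
  assumes "\<forall>x\<in>set w. snd x = t"
  shows "quad_val (traj C w q) t = quad_val q t \<and> quad_deriv (traj C w q) t = quad_deriv q t"
  using assms
proof (induction w arbitrary: q)
  case (Cons x w)
  have "quad_val (traj_step C x q) t = quad_val q t \<and> quad_deriv (traj_step C x q) t = quad_deriv q t"
    using Cons.prems by (cases "(C, x, q)" rule: traj_step.cases) auto
  with Cons show ?case by (simp add: traj_def)
qed (simp add: traj_def)

definition init_quad :: "snapshot \<Rightarrow> car \<Rightarrow> quad" where
  "init_quad S C = (pos S C, spd S C, acc S C / 2)"

text \<open>\<open>q\<close> is a function of absolute time, so delays leave it unchanged, and an
  acceleration replaces it by a quadratic with the same value and derivative. Every run ends with a
  delay, which computes the length from the speed reached.\<close>

lemma exec_pos_len: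
  assumes "exec T t\<^sub>0 w t\<^sub>1 S = Some S'"
    and "pos S C = quad_val q t\<^sub>0" "spd S C = quad_deriv q t\<^sub>0" "acc S C = 2 * snd (snd q)"
  shows "pos S' C = quad_val (traj C w q) t\<^sub>1"
    and "len S' C = (quad_deriv (traj C w q) t\<^sub>1)\<^sup>2 / bmax T + plen T C"
proof -
  have "pos S' C = quad_val (traj C w q) t\<^sub>1 \<and>
      len S' C = (quad_deriv (traj C w q) t\<^sub>1)\<^sup>2 / bmax T + plen T C"
    using assms
  proof (induction T t\<^sub>0 w t\<^sub>1 S arbitrary: q rule: exec.induct)
    case (1 T t\<^sub>0 t\<^sub>1 S)
    then show ?case
      by (auto simp: delay_def traj_def quad_val_def quad_deriv_def power2_eq_square field_simps)
  next
    case (2 T t\<^sub>0 a \<tau> w t\<^sub>1 S)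
    define S' where "S' = delay T (\<tau> - t\<^sub>0) S"
    have S': "pos S' C = quad_val q \<tau>" "spd S' C = quad_deriv q \<tau>" "acc S' C = 2 * snd (snd q)"
      using 2(3-5) by (auto simp: S'_def delay_def quad_val_def quad_deriv_def power2_eq_square field_simps)
    have "pos (effect a S') C = quad_val (traj_step C (a, \<tau>) q) \<tau>"
      "spd (effect a S') C = quad_deriv (traj_step C (a, \<tau>) q) \<tau>"
      "acc (effect a S') C = 2 * snd (snd (traj_step C (a, \<tau>) q))"
      using S' by (cases a; auto)+
    with 2(1)[of S' "traj_step C (a, \<tau>) q"] 2(2) show ?case
      by (auto simp: Let_def S'_def traj_def split: if_splits)
  qed
  then show "pos S' C = quad_val (traj C w q) t\<^sub>1"
    "len S' C = (quad_deriv (traj C w q) t\<^sub>1)\<^sup>2 / bmax T + plen T C" by auto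
qed

abbreviation until :: "real \<Rightarrow> (real action \<times> real) list \<Rightarrow> (real action \<times> real) list" where
  "until t w \<equiv> takeWhile (\<lambda>(a, \<tau>). \<tau> \<le> t) w"

lemma snapshot_at_eqs:
  assumes "admissible T S \<rho>"
  shows "pos (snapshot_at T \<rho> S t) C = quad_val (traj C (until t (fst \<rho>)) (init_quad S C)) t"
    and "len (snapshot_at T \<rho> S t) C =
      (quad_deriv (traj C (until t (fst \<rho>)) (init_quad S C)) t)\<^sup>2 / bmax T + plen T C"
    and "lane_state (snapshot_at T \<rho> S t) C =
      fold lane_step (filter (disc C) (map fst (until t (fst \<rho>)))) (lane_state S C)"
proof -
  \<comment> \<open>A prefix of an executable word is executable, so \<open>the\<close> in
    \<open>snapshot_at\<close> meets an existing snapshot.\<close>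
  have "\<forall>C. lane_path (filter (disc C) (map fst (until t (fst \<rho>) @ dropWhile (\<lambda>(a, \<tau>). \<tau> \<le> t) (fst \<rho>)))) (lane_state S C)"
    using assms exec_defined_iff[of T 0 "fst \<rho>" "snd \<rho>" S]
    by (simp add: admissible_def run_def del: map_append filter_append)
  from lane_paths_of_prefix[OF this] obtain S' where
    S': "exec T 0 (until t (fst \<rho>)) t S = Some S'"
    using exec_defined_iff[of T 0 "until t (fst \<rho>)" t S] by blast
  then have at: "snapshot_at T \<rho> S t = S'" by (simp add: snapshot_at_def run_def cut_def)
  have init: "pos S C = quad_val (init_quad S C) 0" "spd S C = quad_deriv (init_quad S C) 0"
    "acc S C = 2 * snd (snd (init_quad S C))"
    by (simp_all add: init_quad_def quad_val_def quad_deriv_def)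
  show "pos (snapshot_at T \<rho> S t) C = quad_val (traj C (until t (fst \<rho>)) (init_quad S C)) t"
    "len (snapshot_at T \<rho> S t) C =
      (quad_deriv (traj C (until t (fst \<rho>)) (init_quad S C)) t)\<^sup>2 / bmax T + plen T C"
    unfolding at by (rule exec_pos_len[OF S' init])+
  show "lane_state (snapshot_at T \<rho> S t) C =
      fold lane_step (filter (disc C) (map fst (until t (fst \<rho>)))) (lane_state S C)"
    unfolding at by (rule exec_lane_state[OF S'])
qed

subsection \<open>Similar timed words\<close>

text \<open>In the form of a filter, cutting at time \<open>t\<close> commutes with the
  projections.\<close>

lemma until_eq_filter:
  "sorted (map snd w) \<Longrightarrow> until t w = filter (\<lambda>x. snd x \<le> t) w"
proof (induction w)
  case (Cons x w)
  show ?case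
  proof (cases "snd x \<le> t")
    case False
    with Cons.prems have "\<forall>y\<in>set w. \<not> snd y \<le> t" by auto
    with False show ?thesis by (auto simp: case_prod_beta filter_empty_conv)
  qed (use Cons in \<open>auto simp: case_prod_beta\<close>)
qed simp

lemma filter_disc_swap: "swap u v \<Longrightarrow> filter (disc C) u = filter (disc C) v"
  by (induction rule: swap.induct) (auto simp: indep_def disc_def)

lemma filter_disc_causally_equiv:
  assumes "causally_equiv u v" shows "filter (disc C) u = filter (disc C) v"
  using assms unfolding causally_equiv_def
  by (induction rule: rtranclp_induct) (auto simp: filter_disc_swap)

lemma causally_equiv_Cons:
  assumes "causally_equiv u v" shows "causally_equiv (a # u) (a # v)"
proof -
  have "swap (a # x) (a # y)" if "swap x y" for x y
    using that
  proof cases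
    case (1 b c p q)
    then show ?thesis using swap.intros[of b c "a # p" q] by simp
  qed
  note step = this
  from assms show ?thesis
    unfolding causally_equiv_def by (induction rule: rtranclp_induct) (auto intro: rtranclp.intros step)
qed

lemma causally_equiv_trans:
  "causally_equiv u v \<Longrightarrow> causally_equiv v w \<Longrightarrow> causally_equiv u w"
  unfolding causally_equiv_def by (rule rtranclp_trans)

lemma causally_equiv_insort:
  assumes "\<forall>y\<in>set ys. snd y < snd x \<longrightarrow> indep (fst x) (fst y)"
  shows "causally_equiv (map fst (x # ys)) (map fst (insort_key snd x ys))"
  using assms
proof (induction ys)
  case (Cons y ys)
  show ?case
  proof (cases "snd x \<le> snd y")
    case False
    then have "swap (map fst (x # y # ys)) (map fst (y # x # ys))"
      using Cons.prems swap.intros[of "fst x" "fst y" "[]" "map fst ys"] by simp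
    then have "causally_equiv (map fst (x # y # ys)) (map fst (y # x # ys))"
      by (simp add: causally_equiv_def)
    moreover have "causally_equiv (map fst (y # x # ys)) (map fst (y # insort_key snd x ys))"
      using Cons causally_equiv_Cons by simp
    ultimately show ?thesis using False causally_equiv_trans by simp
  qed (simp add: causally_equiv_def)
qed (simp add: causally_equiv_def)

text \<open>Insertion moves a letter past letters with smaller stamps only, one adjacent swap at a
  time, and the hypothesis makes each such inverted pair independent.\<close>

lemma causally_equiv_sort:
  assumes "sorted_wrt (\<lambda>x y. snd y < snd x \<longrightarrow> indep (fst x) (fst y)) l"
  shows "causally_equiv (map fst l) (map fst (sort_key snd l))"
  using assms
proof (induction l)
  case (Cons x l)
  then have "causally_equiv (map fst (x # l)) (map fst (x # sort_key snd l))"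
    using causally_equiv_Cons by simp
  moreover have "causally_equiv (map fst (x # sort_key snd l)) (map fst (sort_key snd (x # l)))"
    using Cons.prems causally_equiv_insort[of "sort_key snd l" x] by simp
  ultimately show ?case by (rule causally_equiv_trans)
qed (simp add: causally_equiv_def)

text \<open>Insertion into a sorted list commutes with filtering, so the filtered list alone has to
  be in order already. Applied to accelerations and to the other letters of each car, whose
  subsequences must survive the sorting.\<close>

lemma filter_sort_key:
  assumes "sorted (map f (filter P l))"
  shows "filter P (sort_key f l) = filter P l"
proof -
  have *: "filter P (insort_key f x xs) = (if P x then insort_key f x (filter P xs) else filter P xs)"
    if "sorted (map f xs)" for x xs
    using that
  proof (induction xs)
    case (Cons y ys)
    then have "P x \<Longrightarrow> f x \<le> f y \<Longrightarrow> insort_key f x (filter P ys) = x # filter P ys"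
      by (intro insort_is_Cons) auto
    with Cons show ?case by auto
  qed simp
  have "filter P (sort_key f l) = sort_key f (filter P l)"
    by (induction l) (auto simp: *)
  then show ?thesis using assms by (simp add: sort_key_id_if_sorted)
qed

text \<open>Describes a cut through the letters of one car by a prefix length of the whole word, so
  that all cars share the range \<open>0..length w\<close>.\<close>

lemma exists_take_filter:
  "k \<le> length (filter P w) \<Longrightarrow>
    \<exists>m\<le>length w. filter P (take m w) = take k (filter P w) \<and> filter P (drop m w) = drop k (filter P w)"
proof (induction w arbitrary: k)
  case (Cons x w)
  show ?case
  proof (cases "k = 0")
    case False
    define k' where "k' = (if P x then k - 1 else k)"
    have "k' \<le> length (filter P w)" using Cons.prems by (auto simp: k'_def split: if_splits)
    from Cons.IH[OF this] obtain m where "m \<le> length w"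
      "filter P (take m w) = take k' (filter P w)" "filter P (drop m w) = drop k' (filter P w)" by blast
    with False show ?thesis by (intro exI[of _ "Suc m"]) (cases k; auto simp: k'_def)
  qed (auto intro: exI[of _ 0])
qed simp

lemma project_disc:
  "project \<rho> (Sigma_car C - Sigma_acc) = (filter (\<lambda>x. disc C (fst x)) (fst \<rho>), snd \<rho>)"
  by (simp add: project_def Sigma_car_def Sigma_acc_def disc_def case_prod_beta')

lemma project_acc: "project \<rho> Sigma_acc = (filter (\<lambda>x. is_acc (fst x)) (fst \<rho>), snd \<rho>)"
  by (simp add: project_def Sigma_acc_def case_prod_beta')

text \<open>The two end markers agree and contribute the difference 0 to each maximum, whence
  \<open>0 \<le> \<epsilon>\<close>. Nonnegative ends are determined by the spans.\<close>

lemma d_time_le_iff: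
  assumes "finite (cars T)" "cars T \<noteq> {}" "0 \<le> snd \<rho>" "0 \<le> snd \<rho>'"
  shows "d_time T \<rho> \<rho>' \<le> ereal \<epsilon> \<longleftrightarrow>
    causally_equiv (untimed \<rho>) (untimed \<rho>') \<and> snd \<rho> = snd \<rho>' \<and>
    filter (\<lambda>x. is_acc (fst x)) (fst \<rho>) = filter (\<lambda>x. is_acc (fst x)) (fst \<rho>') \<and>
    0 \<le> \<epsilon> \<and>
    (\<forall>C\<in>cars T. \<forall>i<length (filter (\<lambda>x. disc C (fst x)) (fst \<rho>)).
       \<bar>snd (filter (\<lambda>x. disc C (fst x)) (fst \<rho>) ! i) - snd (filter (\<lambda>x. disc C (fst x)) (fst \<rho>') ! i)\<bar> \<le> \<epsilon>)"
proof (cases "causally_equiv (untimed \<rho>) (untimed \<rho>') \<and> snd \<rho> = snd \<rho>' \<and>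
    filter (\<lambda>x. is_acc (fst x)) (fst \<rho>) = filter (\<lambda>x. is_acc (fst x)) (fst \<rho>')")
  case True
  define xs where "xs C = filter (\<lambda>x. disc C (fst x)) (fst \<rho>)" for C
  define ys where "ys C = filter (\<lambda>x. disc C (fst x)) (fst \<rho>')" for C
  have "map fst (xs C) = map fst (ys C)" for C
    using filter_disc_causally_equiv[of "untimed \<rho>" "untimed \<rho>'" C] True
    by (simp add: xs_def ys_def untimed_def filter_map o_def)
  then have [simp]: "length (xs C) = length (ys C)" for C by (metis length_map)
  have "d_time T \<rho> \<rho>' = ereal (MAX C\<in>cars T. MAX i\<in>{..<Suc (length (ys C))}.
      \<bar>(map snd (xs C) @ [snd \<rho>]) ! i - (map snd (ys C) @ [snd \<rho>]) ! i\<bar>)"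
    using True by (simp add: d_time_def project_acc project_disc time_span_def stamps_def xs_def[symmetric] ys_def[symmetric] Let_def)
  then have "d_time T \<rho> \<rho>' \<le> ereal \<epsilon> \<longleftrightarrow> (\<forall>C\<in>cars T. \<forall>i<Suc (length (ys C)).
      \<bar>(map snd (xs C) @ [snd \<rho>]) ! i - (map snd (ys C) @ [snd \<rho>]) ! i\<bar> \<le> \<epsilon>)"
  proof -
    have Max_Suc: "(MAX i\<in>{..<Suc n}. f i) \<le> \<epsilon> \<longleftrightarrow> (\<forall>i<Suc n. f i \<le> \<epsilon>)" for f :: "nat \<Rightarrow> real" and n
      by (subst Max_le_iff) (auto simp: lessThan_empty_iff)
    assume "d_time T \<rho> \<rho>' = ereal (MAX C\<in>cars T. MAX i\<in>{..<Suc (length (ys C))}.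
      \<bar>(map snd (xs C) @ [snd \<rho>]) ! i - (map snd (ys C) @ [snd \<rho>]) ! i\<bar>)"
    then show ?thesis
      using assms by (simp only: ereal_less_eq, subst Max_le_iff) (auto simp only: Max_Suc finite_imageI image_is_empty ball_simps)
  qed
  also have "\<dots> \<longleftrightarrow> (\<forall>C\<in>cars T. 0 \<le> \<epsilon> \<and> (\<forall>i<length (ys C). \<bar>snd (xs C ! i) - snd (ys C ! i)\<bar> \<le> \<epsilon>))"
    by (intro ball_cong refl) (auto simp: less_Suc_eq nth_append)
  finally show ?thesis using True assms(2) by (auto simp: xs_def[symmetric] ys_def[symmetric])
next
  case False
  then have "d_time T \<rho> \<rho>' = \<infinity>"
    using assms by (auto simp: d_time_def project_acc time_span_def Icc_eq_Icc)
  with False show ?thesis by auto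
qed

text \<open>
  \<open>window \<epsilon> w C m t\<close>: in some word at distance at most \<open>\<epsilon>\<close> from \<open>w\<close>, the letters of \<open>C\<close> that have
  been performed up to time \<open>t\<close> are those among the first \<open>m\<close> letters of \<open>w\<close>.
\<close>

definition window :: "real \<Rightarrow> (real action \<times> real) list \<Rightarrow> car \<Rightarrow> nat \<Rightarrow> real \<Rightarrow> bool" where
  "window \<epsilon> w C m t \<longleftrightarrow>
     (\<forall>x\<in>set (take m w). disc C (fst x) \<longrightarrow> snd x - \<epsilon> \<le> t) \<and>
     (\<forall>x\<in>set (drop m w). disc C (fst x) \<longrightarrow> t < snd x + \<epsilon>)"

text \<open>Both words list the letters of \<open>C\<close> in the same order, so those performed up
  to \<open>t\<close> are its first \<open>k\<close> letters. Their original stamps are at most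
  \<open>t + \<epsilon>\<close>, the later ones exceed \<open>t - \<epsilon>\<close>; a letter
  stamped exactly \<open>t\<close> counts as performed, which decides between weak and
  strict.\<close>

lemma window_of_similar:
  assumes "sorted (map snd w')" and "map fst xs = map fst ys"
    and xs: "xs = filter (\<lambda>x. disc C (fst x)) w" and ys: "ys = filter (\<lambda>x. disc C (fst x)) w'"
    and dist: "\<And>i. i < length xs \<Longrightarrow> \<bar>snd (xs ! i) - snd (ys ! i)\<bar> \<le> \<epsilon>"
  shows "\<exists>m\<le>length w. window \<epsilon> w C m t \<and>
    filter (disc C) (map fst (until t w')) = filter (disc C) (map fst (take m w))"
proof -
  have len: "length xs = length ys" using assms(2) by (metis length_map)
  have srt: "sorted (map snd ys)" unfolding ys using assms(1) by (rule sorted_filter)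
  define k where "k = length (until t ys)"
  have take_k: "until t ys = take k ys" unfolding k_def by (rule takeWhile_eq_take)
  have k_le: "k \<le> length ys" by (simp add: k_def length_takeWhile_le)
  have early: "snd (ys ! i) \<le> t" if "i < k" for i
  proof -
    have "ys ! i = until t ys ! i" using that unfolding k_def by (rule takeWhile_nth[symmetric])
    then have "ys ! i \<in> set (until t ys)" using that unfolding k_def by simp
    then show ?thesis by (auto dest!: set_takeWhileD)
  qed
  have late: "t < snd (ys ! i)" if "k \<le> i" "i < length ys" for i
  proof -
    have "\<not> snd (ys ! k) \<le> t"
      using that nth_length_takeWhile[of "\<lambda>(a, \<tau>). \<tau> \<le> t" ys] by (simp add: k_def case_prod_beta)
    moreover have "snd (ys ! k) \<le> snd (ys ! i)"
      using srt that by (auto dest: sorted_nth_mono[of "map snd ys" k i])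
    ultimately show ?thesis by simp
  qed
  obtain m where m: "m \<le> length w" "filter (\<lambda>x. disc C (fst x)) (take m w) = take k xs"
    "filter (\<lambda>x. disc C (fst x)) (drop m w) = drop k xs"
    using exists_take_filter[of k "\<lambda>x. disc C (fst x)" w] k_le len xs by auto
  have "window \<epsilon> w C m t" unfolding window_def
  proof (intro conjI ballI impI)
    fix x assume "x \<in> set (take m w)" "disc C (fst x)"
    then have "x \<in> set (take k xs)" unfolding m(2)[symmetric] by simp
    then obtain i where "i < k" "i < length xs" "x = xs ! i" by (auto simp: in_set_conv_nth)
    then show "snd x - \<epsilon> \<le> t" using early[of i] dist[of i] by simp
  next
    fix x assume "x \<in> set (drop m w)" "disc C (fst x)"
    then have "x \<in> set (drop k xs)" unfolding m(3)[symmetric] by simp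
    then obtain j where "j < length xs - k" "x = xs ! (k + j)"
      by (auto simp: in_set_conv_nth)
    moreover from this have "k + j < length xs" by simp
    ultimately show "t < snd x + \<epsilon>" using late[of "k + j"] dist[of "k + j"] len by simp
  qed
  moreover have "filter (disc C) (map fst (until t w')) = filter (disc C) (map fst (take m w))"
  proof -
    have "filter (disc C) (map fst (until t w')) = map fst (filter (\<lambda>x. snd x \<le> t) ys)"
      by (simp add: until_eq_filter[OF assms(1)] filter_map o_def ys conj_commute)
    also have "\<dots> = map fst (take k ys)" using until_eq_filter[OF srt] take_k by simp
    also have "\<dots> = map fst (take k xs)" using assms(2) by (simp add: take_map[symmetric])
    also have "\<dots> = filter (disc C) (map fst (take m w))" by (simp add: m(2)[symmetric] filter_map o_def)
    finally show ?thesis .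
  qed
  ultimately show ?thesis using m(1) by blast
qed

text \<open>The end marker belongs to every projection, so separation also applies to the pair of a
  letter and the end.\<close>

lemma separated_end:
  assumes "wf_timed_word T \<rho>" "separated T \<epsilon> \<rho>" "x \<in> set (fst \<rho>)" "car_of (fst x) \<in> cars T"
  shows "snd x + 2 * \<epsilon> < snd \<rho>"
proof -
  define ys where "ys = filter (\<lambda>(a, \<tau>). a \<in> Sigma_car (car_of (fst x))) (fst \<rho>)"
  have st: "stamps (project \<rho> (Sigma_car (car_of (fst x)))) = map snd ys @ [snd \<rho>]"
    by (simp add: stamps_def project_def ys_def)
  have "x \<in> set ys" using assms(3) by (auto simp: ys_def Sigma_car_def)
  then obtain i where i: "i < length ys" "ys ! i = x" by (auto simp: in_set_conv_nth)
  have "\<forall>i<Suc (length ys). \<forall>j<Suc (length ys). i \<noteq> j \<longrightarrow>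
      2 * \<epsilon> < \<bar>(map snd ys @ [snd \<rho>]) ! i - (map snd ys @ [snd \<rho>]) ! j\<bar>"
    using bspec[OF assms(2)[unfolded separated_def] assms(4)] by (simp add: Let_def st)
  then have "2 * \<epsilon> < \<bar>(map snd ys @ [snd \<rho>]) ! i - (map snd ys @ [snd \<rho>]) ! length ys\<bar>"
    using i by (metis less_SucI lessI nat_neq_iff)
  moreover have "snd x \<le> snd \<rho>"
    using assms(1,3) by (auto simp: wf_timed_word_def sorted_append)
  ultimately show ?thesis using i by (simp add: nth_append)
qed

lemma filter_less_upt: "filter (\<lambda>i. i < m) [0..<n] = [0..<min m n]"
  by (induction n) (auto simp: min_def le_Suc_eq)

text \<open>Converse of \<open>window_of_similar\<close>, with one word for all cars at once: the
  clamped stamps are monotone along the letters of each car and unchanged for accelerations, so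
  every pair that sorting inverts is independent.\<close>

lemma similar_of_window:
  assumes fin: "finite (cars T)" "cars T \<noteq> {}" and \<epsilon>: "0 < \<epsilon>"
    and adm: "admissible T S \<rho>" and sep: "separated T \<epsilon> \<rho>" and t: "0 \<le> t"
    and win: "\<And>C. C \<in> cars T \<Longrightarrow> m C \<le> length (fst \<rho>) \<and> window \<epsilon> (fst \<rho>) C (m C) t"
  shows "\<exists>\<rho>'. admissible T S \<rho>' \<and> d_time T \<rho> \<rho>' \<le> ereal \<epsilon> \<and>
    (\<forall>C\<in>cars T. filter (disc C) (map fst (until t (fst \<rho>'))) = filter (disc C) (map fst (take (m C) (fst \<rho>))))"
proof -
  obtain w \<tau>e where \<rho>: "\<rho> = (w, \<tau>e)" by (cases \<rho>) auto
  have wf: "wf_timed_word T \<rho>" using adm by (simp add: admissible_def)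
  have srt: "sorted (map snd w)" and le_end: "\<And>x. x \<in> set w \<Longrightarrow> snd x \<le> \<tau>e"
    and nonneg: "\<And>x. x \<in> set w \<Longrightarrow> 0 \<le> snd x" and alph: "fst ` set w \<subseteq> alphabet T" and "0 \<le> \<tau>e"
    using wf by (auto simp: wf_timed_word_def \<rho> sorted_append)
  have car: "car_of (fst x) \<in> cars T" if "x \<in> set w" for x
    using alph that by (auto simp: alphabet_def)
  \<comment> \<open>The witness is \<epsilon> plus the stamp of the earliest letter of
    \<open>C\<close> that is still to come. The window puts it after \<open>t\<close>, separation
    puts it before the end.\<close>
  have "\<exists>\<sigma>. \<forall>x\<in>set (drop (m C) w). disc C (fst x) \<longrightarrow> t < \<sigma> \<and> \<sigma> \<le> snd x + \<epsilon> \<and> \<sigma> \<le> \<tau>e" if C: "C \<in> cars T" for C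
  proof (cases "\<exists>x\<in>set (drop (m C) w). disc C (fst x)")
    case True
    define L where "L = {x \<in> set (drop (m C) w). disc C (fst x)}"
    have L: "finite L" "L \<noteq> {}" using True by (auto simp: L_def)
    have "Min ((\<lambda>x. snd x + \<epsilon>) ` L) \<in> (\<lambda>x. snd x + \<epsilon>) ` L" using L by (intro Min_in) auto
    then obtain x where x: "x \<in> L" "Min ((\<lambda>x. snd x + \<epsilon>) ` L) = snd x + \<epsilon>" by auto
    have min: "snd x + \<epsilon> \<le> snd y + \<epsilon>" if "y \<in> L" for y
      using L that unfolding x(2)[symmetric] by (intro Min_le) auto
    have "x \<in> set w" using x(1) by (auto simp: L_def dest: in_set_dropD)
    then have "snd x + 2 * \<epsilon> < \<tau>e" using separated_end[OF wf sep] car by (simp add: \<rho>)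
    moreover have "t < snd x + \<epsilon>" using win[OF C] x(1) by (simp add: window_def L_def \<rho>)
    ultimately show ?thesis using min \<epsilon> by (intro exI[of _ "snd x + \<epsilon>"]) (auto simp: L_def)
  qed auto
  then obtain \<sigma> where \<sigma>: "\<And>C x. C \<in> cars T \<Longrightarrow> x \<in> set (drop (m C) w) \<Longrightarrow> disc C (fst x) \<Longrightarrow>
      t < \<sigma> C \<and> \<sigma> C \<le> snd x + \<epsilon> \<and> \<sigma> C \<le> \<tau>e" by metis
  define n where "n = length w"
  \<comment> \<open>The first \<open>m C\<close> letters are moved back to time \<open>t\<close>, the others behind it. Stable sorting by the
    new time stamps swaps independent letters only.\<close>
  define st where "st i = (if is_acc (fst (w ! i)) then snd (w ! i)
      else if i < m (car_of (fst (w ! i))) then min (snd (w ! i)) t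
      else max (snd (w ! i)) (\<sigma> (car_of (fst (w ! i)))))" for i
  define L where "L = map (\<lambda>i. (fst (w ! i), st i)) [0..<n]"
  define w' where "w' = sort_key snd L"
  have w_map: "w = map ((!) w) [0..<n]" by (simp add: n_def map_nth)
  have fst_L: "map fst L = map fst w" by (subst w_map) (simp add: L_def)
  have late: "t < \<sigma> C \<and> \<sigma> C \<le> snd (w ! i) + \<epsilon> \<and> \<sigma> C \<le> \<tau>e"
    if "i < n" "\<not> i < m C" "disc C (fst (w ! i))" for i C
  proof (rule \<sigma>)
    have i: "w ! i \<in> set w" using that by (simp add: n_def)
    then show "C \<in> cars T" using car[OF i] that(3) by (simp add: disc_def)
    have "w ! i = drop (m C) w ! (i - m C)" "i - m C < length (drop (m C) w)"
      using that by (simp_all add: n_def)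
    then show "w ! i \<in> set (drop (m C) w)" by (metis nth_mem)
  qed fact
  have early: "snd (w ! i) - \<epsilon> \<le> t" if "i < n" "i < m C" "disc C (fst (w ! i))" for i C
  proof -
    have i: "w ! i \<in> set w" using that by (simp add: n_def)
    then have "C \<in> cars T" using car[OF i] that(3) by (simp add: disc_def)
    moreover have "w ! i = take (m C) w ! i" "i < length (take (m C) w)" using that by (simp_all add: n_def)
    then have "w ! i \<in> set (take (m C) w)" by (metis nth_mem)
    ultimately show ?thesis using win that by (simp add: window_def \<rho>)
  qed
  have discI: "disc (car_of a) a" if "\<not> is_acc a" for a using that by (simp add: disc_def)
  have st_le: "st i \<le> \<tau>e" if "i < n" for i
    using that le_end[of "w ! i"] late[OF that _ discI] by (auto simp: st_def n_def min_def max_def)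
  have st_nonneg: "0 \<le> st i" if "i < n" for i
    using that nonneg[of "w ! i"] t by (auto simp: st_def n_def min_def max_def)
  have st_close: "\<bar>snd (w ! i) - st i\<bar> \<le> \<epsilon>" if "i < n" for i
    using early[OF that _ discI] late[OF that _ discI] \<epsilon> by (auto simp: st_def min_def max_def abs_if)
  have st_until: "st i \<le> t \<longleftrightarrow> i < m C" if "i < n" "disc C (fst (w ! i))" for i C
    using late[OF that(1) _ that(2)] that(2) by (auto simp: st_def disc_def)
  have w_mono: "snd (w ! i) \<le> snd (w ! j)" if "i < j" "j < n" for i j
    using srt that by (auto simp: n_def dest: sorted_nth_mono[of "map snd w" i j])
  have mono_acc: "st i \<le> st j" if "i < j" "j < n" "is_acc (fst (w ! i))" "is_acc (fst (w ! j))" for i j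
    using that w_mono by (simp add: st_def)
  have mono_disc: "st i \<le> st j" if "i < j" "j < n" "disc C (fst (w ! i))" "disc C (fst (w ! j))" for i j C
    using that w_mono[OF that(1,2)] by (auto simp: st_def disc_def min_def max_def)
  have sorted_L: "sorted_wrt (\<lambda>x y. snd y < snd x \<longrightarrow> indep (fst x) (fst y)) L"
  proof -
    have "indep (fst (w ! i)) (fst (w ! j))" if ij: "i < j" "j < n" "st j < st i" for i j
    proof (rule ccontr)
      assume "\<not> ?thesis"
      then have "is_acc (fst (w ! i)) \<and> is_acc (fst (w ! j)) \<or>
          disc (car_of (fst (w ! i))) (fst (w ! i)) \<and> disc (car_of (fst (w ! i))) (fst (w ! j))"
        by (auto simp: indep_def disc_def)
      then show False using mono_acc[OF ij(1,2)] mono_disc[OF ij(1,2)] ij(3) by fastforce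
    qed
    then show ?thesis by (simp add: sorted_wrt_iff_nth_less L_def)
  qed
  have filter_L: "filter (\<lambda>x. P (fst x)) w' = filter (\<lambda>x. P (fst x)) L"
    if "\<And>i j. i < j \<Longrightarrow> j < n \<Longrightarrow> P (fst (w ! i)) \<Longrightarrow> P (fst (w ! j)) \<Longrightarrow> st i \<le> st j" for P
    unfolding w'_def
  proof (rule filter_sort_key)
    have "sorted_wrt (\<lambda>x y. P (fst x) \<longrightarrow> P (fst y) \<longrightarrow> snd x \<le> snd y) L"
      using that by (simp add: sorted_wrt_iff_nth_less L_def)
    then have "sorted_wrt (\<lambda>x y. snd x \<le> snd y) (filter (\<lambda>x. P (fst x)) L)"
      by (induction L) auto
    then show "sorted (map snd (filter (\<lambda>x. P (fst x)) L))"
      by (simp add: sorted_map)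
  qed
  have filter_disc: "filter (\<lambda>x. disc C (fst x)) w' = filter (\<lambda>x. disc C (fst x)) L" for C
    by (rule filter_L) (rule mono_disc)
  have fst_disc: "filter (disc C) (map fst w') = filter (disc C) (map fst w)" for C
    using arg_cong[OF filter_disc, of "map fst" C] unfolding fst_L[symmetric] by (simp add: filter_map o_def)
  have acc_eq: "filter (\<lambda>x. is_acc (fst x)) w' = filter (\<lambda>x. is_acc (fst x)) w"
  proof -
    have "filter (\<lambda>x. is_acc (fst x)) w' = filter (\<lambda>x. is_acc (fst x)) L"
      by (rule filter_L) (rule mono_acc)
    also have "\<dots> = map (\<lambda>i. (fst (w ! i), st i)) (filter (\<lambda>i. is_acc (fst (w ! i))) [0..<n])"
      by (simp add: L_def filter_map o_def)
    also have "\<dots> = map ((!) w) (filter (\<lambda>i. is_acc (fst (w ! i))) [0..<n])"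
      by (rule map_cong) (auto simp: st_def)
    also have "\<dots> = filter (\<lambda>x. is_acc (fst x)) w"
      by (subst (3) w_map) (simp add: filter_map o_def)
    finally show ?thesis .
  qed
  have set_w': "set w' = set L" by (simp add: w'_def)
  have "wf_timed_word T (w', \<tau>e)"
  proof -
    have "fst ` set w' = fst ` set w" unfolding set_w' set_map[symmetric] fst_L ..
    moreover have "\<forall>x\<in>set w'. snd x \<le> \<tau>e \<and> 0 \<le> snd x"
      unfolding set_w' L_def using st_le st_nonneg by auto
    ultimately show ?thesis
      using alph \<open>0 \<le> \<tau>e\<close> by (auto simp: wf_timed_word_def sorted_append w'_def)
  qed
  moreover have "run T (w', \<tau>e) S \<noteq> None"
    using adm exec_defined_iff[of T 0 w' \<tau>e S] exec_defined_iff[of T 0 w \<tau>e S]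
    by (simp add: admissible_def run_def \<rho> fst_disc)
  ultimately have "admissible T S (w', \<tau>e)" by (simp add: admissible_def)
  moreover have "d_time T \<rho> (w', \<tau>e) \<le> ereal \<epsilon>"
  proof -
    have "causally_equiv (untimed \<rho>) (untimed (w', \<tau>e))"
      using causally_equiv_sort[OF sorted_L] by (simp add: untimed_def \<rho> fst_L w'_def)
    moreover have "\<bar>snd (filter (\<lambda>x. disc C (fst x)) w ! i) - snd (filter (\<lambda>x. disc C (fst x)) w' ! i)\<bar> \<le> \<epsilon>"
      if "i < length (filter (\<lambda>x. disc C (fst x)) w)" for C i
    proof -
      define ix where "ix = filter (\<lambda>i. disc C (fst (w ! i))) [0..<n]"
      have 1: "filter (\<lambda>x. disc C (fst x)) w = map ((!) w) ix"
        by (subst w_map) (simp add: filter_map o_def ix_def)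
      have 2: "filter (\<lambda>x. disc C (fst x)) w' = map (\<lambda>i. (fst (w ! i), st i)) ix"
        unfolding filter_disc by (simp add: L_def filter_map o_def ix_def)
      have "i < length ix" using that unfolding 1 by simp
      then have "ix ! i \<in> set ix" by simp
      then have "ix ! i < n" by (simp add: ix_def)
      then show ?thesis using st_close \<open>i < length ix\<close> unfolding 1 2 by simp
    qed
    ultimately show ?thesis
      using \<open>0 \<le> \<tau>e\<close> \<epsilon> by (subst d_time_le_iff[OF fin]) (simp_all add: \<rho> acc_eq)
  qed
  moreover have "filter (disc C) (map fst (until t w')) = filter (disc C) (map fst (take (m C) w))"
    if C: "C \<in> cars T" for C
  proof -
    have m_le: "m C \<le> n" using win[OF C] by (simp add: n_def \<rho>)
    have "filter (disc C) (map fst (until t w')) = map fst (filter (\<lambda>x. snd x \<le> t) (filter (\<lambda>x. disc C (fst x)) w'))"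
      by (subst until_eq_filter) (simp_all add: w'_def filter_map o_def conj_commute)
    also have "\<dots> = map (\<lambda>i. fst (w ! i)) (filter (\<lambda>i. disc C (fst (w ! i)) \<and> st i \<le> t) [0..<n])"
      unfolding filter_disc by (simp add: L_def filter_map o_def)
    also have "\<dots> = map (\<lambda>i. fst (w ! i)) (filter (\<lambda>i. disc C (fst (w ! i)) \<and> i < m C) [0..<n])"
      using st_until[where C = C] by (intro arg_cong[where f = "map _"] filter_cong) auto
    also have "\<dots> = map (\<lambda>i. fst (w ! i)) (filter (\<lambda>i. disc C (fst (w ! i))) [0..<m C])"
    proof -
      have "filter (\<lambda>i. disc C (fst (w ! i)) \<and> i < m C) [0..<n] =
          filter (\<lambda>i. disc C (fst (w ! i))) (filter (\<lambda>i. i < m C) [0..<n])"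
        by (simp add: conj_commute)
      then show ?thesis using filter_less_upt[of "m C" n] m_le by (simp add: min_absorb1)
    qed
    also have "\<dots> = filter (disc C) (map fst (map ((!) w) [0..<m C]))"
      by (simp add: filter_map o_def)
    also have "map ((!) w) [0..<m C] = take (m C) w"
      using m_le by (intro nth_equalityI) (auto simp: n_def)
    finally show ?thesis .
  qed
  ultimately show ?thesis by (intro exI[of _ "(w', \<tau>e)"]) (simp add: \<rho>)
qed

subsection \<open>Robust satisfaction in terms of perturbed models\<close>

text \<open>
  The arguments are lanes, positions and ends of the braking distances of the cars, and the ends
  of the view.
\<close>

definition near :: "traffic \<Rightarrow> model \<Rightarrow> real \<Rightarrow> (car \<Rightarrow> lane set \<times> lane set) \<Rightarrow> (car \<Rightarrow> real) \<Rightarrow> (car \<Rightarrow> real) \<Rightarrow>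
    real \<Rightarrow> real \<Rightarrow> model \<Rightarrow> bool" where
  "near T M \<delta> L P E a b M' \<longleftrightarrow> wf_model T M' \<and>
     (\<forall>C\<in>cars T. lane_state (snap M') C = L C \<and> \<bar>P C - pos (snap M') C\<bar> \<le> \<delta> \<and>
        \<bar>E C - (pos (snap M') C + len (snap M') C)\<bar> \<le> \<delta>) \<and>
     {lo (view M)..hi (view M)} = {lo (view M')..hi (view M')} \<and> val M = val M' \<and>
     \<bar>a - left (view M')\<bar> \<le> \<delta> \<and> \<bar>b - right (view M')\<bar> \<le> \<delta>"

lemma d_model_le_iff:
  assumes "finite (cars T)" "cars T \<noteq> {}"
  shows "d_model T M M' \<le> ereal \<delta> \<longleftrightarrow>
     (\<forall>C\<in>cars T. lane_state (snap M) C = lane_state (snap M') C \<and>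
        \<bar>pos (snap M) C - pos (snap M') C\<bar> \<le> \<delta> \<and>
        \<bar>pos (snap M) C + len (snap M) C - (pos (snap M') C + len (snap M') C)\<bar> \<le> \<delta>) \<and>
     {lo (view M)..hi (view M)} = {lo (view M')..hi (view M')} \<and> val M = val M' \<and>
     \<bar>left (view M) - left (view M')\<bar> \<le> \<delta> \<and> \<bar>right (view M) - right (view M')\<bar> \<le> \<delta>"
proof (cases "(\<exists>C\<in>cars T. res (snap M) C \<noteq> res (snap M') C \<or> clm (snap M) C \<noteq> clm (snap M') C) \<or>
         {lo (view M)..hi (view M)} \<noteq> {lo (view M')..hi (view M')} \<or> val M \<noteq> val M'")
  case True
  then have "d_model T M M' = \<infinity>" by (simp only: d_model_def Let_def if_True)
  then show ?thesis using True by (auto simp: lane_state_def)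
next
  case False
  define A where "A C = {\<bar>pos (snap M) C - pos (snap M') C\<bar>,
         \<bar>pos (snap M) C + len (snap M) C - pos (snap M') C - len (snap M') C\<bar>,
         \<bar>left (view M) - left (view M')\<bar>, \<bar>right (view M) - right (view M')\<bar>}" for C
  have "d_model T M M' = ereal (MAX C\<in>cars T. Max (A C))"
    using False unfolding d_model_def Let_def A_def by (simp only: if_False)
  then have "d_model T M M' \<le> ereal \<delta> \<longleftrightarrow> (MAX C\<in>cars T. Max (A C)) \<le> \<delta>" by simp
  also have "\<dots> \<longleftrightarrow> (\<forall>C\<in>cars T. Max (A C) \<le> \<delta>)" using assms by (subst Max_le_iff) auto
  also have "\<dots> \<longleftrightarrow> (\<forall>C\<in>cars T. \<forall>x\<in>A C. x \<le> \<delta>)"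
    by (intro ball_cong refl, subst Max_le_iff) (auto simp: A_def)
  finally show ?thesis using False assms(2) by (auto simp: A_def lane_state_def algebra_simps)
qed

definition pos_at :: "model \<Rightarrow> timed_word \<Rightarrow> car \<Rightarrow> real \<Rightarrow> real" where
  "pos_at M \<rho> C t = quad_val (traj C (until t (fst \<rho>)) (init_quad (snap M) C)) t"

definition end_at :: "traffic \<Rightarrow> model \<Rightarrow> timed_word \<Rightarrow> car \<Rightarrow> real \<Rightarrow> real" where
  "end_at T M \<rho> C t = pos_at M \<rho> C t +
     ((quad_deriv (traj C (until t (fst \<rho>)) (init_quad (snap M) C)) t)\<^sup>2 / bmax T + plen T C)"

definition shift_at :: "model \<Rightarrow> timed_word \<Rightarrow> real \<Rightarrow> real" where
  "shift_at M \<rho> t = pos_at M \<rho> (owner (view M)) t - pos (snap M) (owner (view M))"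

definition lanes_after :: "model \<Rightarrow> (real action \<times> real) list \<Rightarrow> car \<Rightarrow> lane set \<times> lane set" where
  "lanes_after M w C = fold lane_step (filter (disc C) (map fst w)) (lane_state (snap M) C)"

definition violated ::
  "traffic \<Rightarrow> model \<Rightarrow> timed_word \<Rightarrow> real \<Rightarrow> mlsl \<Rightarrow> (car \<Rightarrow> lane set \<times> lane set) \<Rightarrow> real \<Rightarrow> bool" where
  "violated T M \<rho> \<delta> \<phi> L t \<longleftrightarrow> (\<exists>M'. near T M \<delta> L (\<lambda>C. pos_at M \<rho> C t) (\<lambda>C. end_at T M \<rho> C t)
     (left (view M) + shift_at M \<rho> t) (right (view M) + shift_at M \<rho> t) M' \<and> \<not> sat T M' \<phi>)"

lemma violated_cong:
  "(\<And>C. C \<in> cars T \<Longrightarrow> L C = L' C) \<Longrightarrow> violated T M \<rho> \<delta> \<phi> L t \<longleftrightarrow> violated T M \<rho> \<delta> \<phi> L' t"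
  by (simp add: violated_def near_def)

text \<open>Positions, ends and the shift of the view are common to all similar words, so a
  violation depends on the word only through the lanes reached at \<open>t\<close>. These are
  described exactly by \<open>window_of_similar\<close> and
  \<open>similar_of_window\<close>.\<close>

lemma robust_globally_seq_iff:
  assumes T: "wf_traffic T" and M: "wf_model T M" and adm: "admissible T (snap M) \<rho>"
    and \<epsilon>: "0 < \<epsilon>" and sep: "separated T \<epsilon> \<rho>"
  shows "\<not> robust_globally_seq T \<epsilon> \<delta> \<rho> M \<phi> \<longleftrightarrow>
    (\<exists>t m. 0 \<le> t \<and> t \<le> snd \<rho> \<and> (\<forall>C\<in>cars T. m C \<le> length (fst \<rho>) \<and> window \<epsilon> (fst \<rho>) C (m C) t) \<and>
      violated T M \<rho> \<delta> \<phi> (\<lambda>C. lanes_after M (take (m C) (fst \<rho>)) C) t)"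
    (is "?A \<longleftrightarrow> ?B")
proof -
  have fin: "finite (cars T)" "cars T \<noteq> {}"
    using T M by (auto simp: wf_traffic_def wf_model_def wf_view_def)
  have wf: "sorted (map snd (fst \<rho>'))" "0 \<le> snd \<rho>'" if "admissible T (snap M) \<rho>'" for \<rho>'
    using that by (auto simp: admissible_def wf_timed_word_def sorted_append)
  note dist_iff = d_time_le_iff[OF fin wf(2)[OF adm] wf(2)]
  have key: "(\<exists>M'. d_model T (model_at T \<rho>' M t) M' \<le> ereal \<delta> \<and> wf_model T M' \<and> \<not> sat T M' \<phi>) \<longleftrightarrow>
     violated T M \<rho> \<delta> \<phi> (\<lambda>C. lanes_after M (until t (fst \<rho>')) C) t"
    if adm': "admissible T (snap M) \<rho>'" and dist: "d_time T \<rho> \<rho>' \<le> ereal \<epsilon>" for \<rho>' t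
  proof -
    have acc: "filter (\<lambda>x. is_acc (fst x)) (fst \<rho>) = filter (\<lambda>x. is_acc (fst x)) (fst \<rho>')"
      using dist dist_iff[OF adm'] by blast
    have "traj C (until t (fst \<rho>')) q = traj C (until t (fst \<rho>)) q" for C q
    proof -
      have "traj C (until t (fst \<rho>')) q =
          traj C (filter (\<lambda>x. snd x \<le> t) (filter (\<lambda>x. is_acc (fst x)) (fst \<rho>'))) q"
        by (subst traj_filter_acc[symmetric]) (simp add: until_eq_filter[OF wf(1)[OF adm']] conj_commute)
      also have "\<dots> = traj C (until t (fst \<rho>)) q"
        unfolding acc[symmetric]
        by (subst (2) traj_filter_acc[symmetric]) (simp add: until_eq_filter[OF wf(1)[OF adm]] conj_commute)
      finally show ?thesis .
    qed
    then have "pos_at M \<rho>' C t = pos_at M \<rho> C t" "end_at T M \<rho>' C t = end_at T M \<rho> C t" for C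
      by (simp_all add: pos_at_def end_at_def)
    then have P: "pos (snapshot_at T \<rho>' (snap M) t) C = pos_at M \<rho> C t"
      and E: "len (snapshot_at T \<rho>' (snap M) t) C = end_at T M \<rho> C t - pos_at M \<rho> C t" for C
      using snapshot_at_eqs(1,2)[OF adm', of t C] by (simp_all add: pos_at_def end_at_def)
    have L: "lane_state (snapshot_at T \<rho>' (snap M) t) C = lanes_after M (until t (fst \<rho>')) C" for C
      using snapshot_at_eqs(3)[OF adm'] by (simp add: lanes_after_def)
    show ?thesis
      unfolding d_model_le_iff[OF fin] violated_def near_def
      by (intro ex_cong1) (auto simp: model_at_def Let_def P E L shift_at_def)
  qed
  have "?A \<longleftrightarrow> (\<exists>\<rho>' t. admissible T (snap M) \<rho>' \<and> d_time T \<rho> \<rho>' \<le> ereal \<epsilon> \<and> 0 \<le> t \<and> t \<le> snd \<rho>' \<and>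
     (\<exists>M'. d_model T (model_at T \<rho>' M t) M' \<le> ereal \<delta> \<and> wf_model T M' \<and> \<not> sat T M' \<phi>))"
    unfolding robust_globally_seq_def robust_globally_def robust_sat_def time_span_def Ball_def atLeastAtMost_iff
    by blast
  also have "\<dots> \<longleftrightarrow> (\<exists>\<rho>' t. admissible T (snap M) \<rho>' \<and> d_time T \<rho> \<rho>' \<le> ereal \<epsilon> \<and> 0 \<le> t \<and> t \<le> snd \<rho>' \<and>
     violated T M \<rho> \<delta> \<phi> (\<lambda>C. lanes_after M (until t (fst \<rho>')) C) t)"
    by (intro ex_cong1 conj_cong refl key)
  also have "\<dots> \<longleftrightarrow> ?B"
  proof (intro iffI; elim exE conjE)
    fix \<rho>' t
    assume adm': "admissible T (snap M) \<rho>'" and dist: "d_time T \<rho> \<rho>' \<le> ereal \<epsilon>"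
      and t: "0 \<le> t" "t \<le> snd \<rho>'"
      and viol: "violated T M \<rho> \<delta> \<phi> (\<lambda>C. lanes_after M (until t (fst \<rho>')) C) t"
    note d = iffD1[OF dist_iff[OF adm'] dist]
    have "\<exists>m\<le>length (fst \<rho>). window \<epsilon> (fst \<rho>) C m t \<and>
        filter (disc C) (map fst (until t (fst \<rho>'))) = filter (disc C) (map fst (take m (fst \<rho>)))"
      if "C \<in> cars T" for C
    proof (rule window_of_similar[OF wf(1)[OF adm'] _ refl refl])
      have "filter (disc C) (untimed \<rho>) = filter (disc C) (untimed \<rho>')"
        using d by (intro filter_disc_causally_equiv) blast
      then show "map fst (filter (\<lambda>x. disc C (fst x)) (fst \<rho>)) = map fst (filter (\<lambda>x. disc C (fst x)) (fst \<rho>'))"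
        by (simp add: untimed_def filter_map o_def)
    qed (use d that in blast)
    then obtain m where m: "\<And>C. C \<in> cars T \<Longrightarrow> m C \<le> length (fst \<rho>) \<and> window \<epsilon> (fst \<rho>) C (m C) t \<and>
        filter (disc C) (map fst (until t (fst \<rho>'))) = filter (disc C) (map fst (take (m C) (fst \<rho>)))"
      by metis
    have "violated T M \<rho> \<delta> \<phi> (\<lambda>C. lanes_after M (take (m C) (fst \<rho>)) C) t"
      by (rule iffD1[OF violated_cong viol]) (simp add: lanes_after_def m)
    moreover have "t \<le> snd \<rho>" using t d by simp
    ultimately show ?B using t(1) m by blast
  next
    fix t m
    assume t: "0 \<le> t" "t \<le> snd \<rho>"
      and m: "\<forall>C\<in>cars T. m C \<le> length (fst \<rho>) \<and> window \<epsilon> (fst \<rho>) C (m C) t"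
      and viol: "violated T M \<rho> \<delta> \<phi> (\<lambda>C. lanes_after M (take (m C) (fst \<rho>)) C) t"
    from similar_of_window[OF fin \<epsilon> adm sep t(1), of m] m obtain \<rho>' where
      adm': "admissible T (snap M) \<rho>'" and dist: "d_time T \<rho> \<rho>' \<le> ereal \<epsilon>"
      and eq: "\<forall>C\<in>cars T. filter (disc C) (map fst (until t (fst \<rho>'))) = filter (disc C) (map fst (take (m C) (fst \<rho>)))"
      by blast
    have "violated T M \<rho> \<delta> \<phi> (\<lambda>C. lanes_after M (until t (fst \<rho>')) C) t"
      by (rule iffD1[OF violated_cong viol]) (simp add: lanes_after_def eq)
    moreover have "snd \<rho>' = snd \<rho>" using iffD1[OF dist_iff[OF adm'] dist] by simp
    ultimately show "\<exists>\<rho>' t. admissible T (snap M) \<rho>' \<and> d_time T \<rho> \<rho>' \<le> ereal \<epsilon> \<and> 0 \<le> t \<and> t \<le> snd \<rho>' \<and>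
        violated T M \<rho> \<delta> \<phi> (\<lambda>C. lanes_after M (until t (fst \<rho>')) C) t"
      using adm' dist t by metis
  qed
  finally show ?thesis .
qed

section \<open>Perturbed models as solutions of difference constraints\<close>

text \<open>Needed for the well-formedness of the perturbed model that is built from a solution of
  the constraints.\<close>

lemma lanes_after_subset:
  assumes "wf_model T M" "fst ` set w \<subseteq> alphabet T" "C \<in> cars T"
  shows "fst (lanes_after M w C) \<subseteq> lanes T" "snd (lanes_after M w C) \<subseteq> lanes T"
proof -
  have "fst (fold lane_step as s) \<subseteq> lanes T \<and> snd (fold lane_step as s) \<subseteq> lanes T"
    if "set as \<subseteq> alphabet T" "fst s \<subseteq> lanes T" "snd s \<subseteq> lanes T" for as s
    using that
  proof (induction as arbitrary: s)
    case (Cons a as)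
    have "fst (lane_step a s) \<subseteq> lanes T \<and> snd (lane_step a s) \<subseteq> lanes T"
      using Cons.prems by (cases a) (auto simp: alphabet_def)
    with Cons show ?case by simp
  qed simp
  moreover have "set (filter (disc C) (map fst w)) \<subseteq> alphabet T" using assms(2) by auto
  moreover have "fst (lane_state (snap M) C) \<subseteq> lanes T" "snd (lane_state (snap M) C) \<subseteq> lanes T"
    using assms(1,3) by (auto simp: wf_model_def wf_snapshot_def lane_state_def)
  ultimately show "fst (lanes_after M w C) \<subseteq> lanes T" "snd (lanes_after M w C) \<subseteq> lanes T"
    unfolding lanes_after_def by blast+
qed

text \<open>Letters stamped exactly \<open>t\<close> may lie on either side of the cut: position and
  speed are continuous, so at time \<open>t\<close> such letters make no difference. Thus one prefix
  serves a closed piece of time.\<close>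

lemma traj_prefix:
  assumes "sorted (map snd w)" "\<forall>x\<in>set (take k w). snd x \<le> t" "\<forall>x\<in>set (drop k w). t \<le> snd x"
  shows "quad_val (traj C (until t w) q) t = quad_val (traj C (take k w) q) t"
    and "quad_deriv (traj C (until t w) q) t = quad_deriv (traj C (take k w) q) t"
proof -
  have "until t w = filter (\<lambda>x. snd x \<le> t) (take k w @ drop k w)"
    using until_eq_filter[OF assms(1)] by simp
  also have "\<dots> = take k w @ filter (\<lambda>x. snd x \<le> t) (drop k w)"
    using assms(2) unfolding filter_append by simp
  finally have w: "until t w = take k w @ filter (\<lambda>x. snd x \<le> t) (drop k w)" .
  have "\<forall>x\<in>set (filter (\<lambda>x. snd x \<le> t) (drop k w)). snd x = t" using assms(3) by force
  from traj_at_stamp[OF this] show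
    "quad_val (traj C (until t w) q) t = quad_val (traj C (take k w) q) t"
    "quad_deriv (traj C (until t w) q) t = quad_deriv (traj C (take k w) q) t"
    unfolding w by (simp_all add: traj_def)
qed

text \<open>All empty intervals represent the empty set of lanes.\<close>

definition lanes_rep :: "view \<Rightarrow> nat \<Rightarrow> nat \<Rightarrow> bool" where
  "lanes_rep V l h \<longleftrightarrow> 0 < l \<and> (lo V = int l \<and> hi V = int h \<or> hi V < lo V \<and> h < l)"

text \<open>With no lanes, \<open>Free\<close>, \<open>Re\<close> and \<open>Cl\<close> fail and a
  vertical chop does not split, so the bounds matter only through emptiness. This is required
  because \<open>d_model\<close> compares sets of lanes, and a perturbed view may present the empty
  set by other bounds.\<close>

lemma holds_cong_view:
  assumes "left V = left V'" "right V = right V'"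
    and "lo V = lo V' \<and> hi V = hi V' \<or> hi V < lo V \<and> hi V' < lo V'"
  shows "holds T S \<phi> V \<nu> \<longleftrightarrow> holds T S \<phi> V' \<nu>"
  using assms
proof (induction \<phi> arbitrary: V V' \<nu>)
  case (HChop \<phi> \<psi>)
  have "holds T S \<phi> (V\<lparr>right := s\<rparr>) \<nu> = holds T S \<phi> (V'\<lparr>right := s\<rparr>) \<nu>"
    "holds T S \<psi> (V\<lparr>left := s\<rparr>) \<nu> = holds T S \<psi> (V'\<lparr>left := s\<rparr>) \<nu>" for s
    by (rule HChop.IH(1), use HChop.prems in simp_all) (rule HChop.IH(2), use HChop.prems in simp_all)
  then show ?case using HChop.prems by simp
next
  case (VChop \<phi> \<psi>)
  have "holds T S \<psi> (V\<lparr>hi := m\<rparr>) \<nu> = holds T S \<psi> (V'\<lparr>hi := m\<rparr>) \<nu>"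
    "holds T S \<phi> (V\<lparr>lo := m\<rparr>) \<nu> = holds T S \<phi> (V'\<lparr>lo := m\<rparr>) \<nu>" if "lo V = lo V' \<and> hi V = hi V'" for m
    by (rule VChop.IH(2), use VChop.prems that in simp_all) (rule VChop.IH(1), use VChop.prems that in simp_all)
  moreover have "holds T S \<psi> V \<nu> = holds T S \<psi> V' \<nu>" "holds T S \<phi> V \<nu> = holds T S \<phi> V' \<nu>"
    by (rule VChop.IH(2), use VChop.prems in simp_all) (rule VChop.IH(1), use VChop.prems in simp_all)
  ultimately show ?case using VChop.prems by auto
next
  case (Neg \<phi>)
  then show ?case by (metis holds.simps(6))
next
  case (Conj \<phi> \<psi>)
  then show ?case by (metis holds.simps(7))
next
  case (Ex c \<phi>)
  then have "holds T S \<phi> V (\<nu>(CVar c := C)) = holds T S \<phi> V' (\<nu>(CVar c := C))" for C by blast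
  then show ?case by simp
qed auto

context named_field
begin

definition move_vars :: "nat list \<Rightarrow> nat list" where
  "move_vars Cs = 0 # 2 # concat (map (\<lambda>C. [pos_var C, end_var C]) Cs)"

text \<open>The variable \<open>Suc y\<close> has the unperturbed value of the variable \<open>y\<close>.\<close>

definition near_clause :: "nat list \<Rightarrow> nat \<Rightarrow> dlit list" where
  "near_clause Cs d = (False, 0, kzero, 2) #
     map (\<lambda>C. (True, pos_var C, kzero, end_var C)) Cs @
     concat (map (\<lambda>y. [(False, Suc y, kneg d, y), (False, y, kneg d, Suc y)]) (move_vars Cs))"

text \<open>Eliminating the perturbed values leaves constraints between odd variables, whose values
  are known functions of time.\<close>

definition violation_dnf ::
  "mlsl \<Rightarrow> (nat \<times> nat list \<times> nat list) list \<Rightarrow> nat \<Rightarrow> nat \<Rightarrow> (nat \<times> nat) list \<Rightarrow> nat \<Rightarrow> dlit list list" where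
  "violation_dnf \<phi> cs l h \<nu> d = dnf_elim (move_vars (map fst cs))
     (dnf_and [near_clause (map fst cs) d] (dnf_neg (mlsl_dnf \<phi> cs l h \<nu>)))"

lemma set_move_vars: "set (move_vars Cs) = {0, 2} \<union> (\<Union>C\<in>set Cs. {pos_var C, end_var C})"
  by (auto simp: move_vars_def)

text \<open>Besides the distances, \<open>near_clause\<close> demands an ordered view and positive
  lengths. This is what well-formedness asks of the perturbed reals, so solutions and perturbed
  models correspond.\<close>

lemma violation_dnf_iff:
  assumes M: "wf_model T M"
    and L: "\<And>C. C \<in> cars T \<Longrightarrow> fst (L C) \<subseteq> lanes T \<and> snd (L C) \<subseteq> lanes T"
    and cs: "cars T = fst ` set cs"
      "\<And>C rs ks l. (C, rs, ks) \<in> set cs \<Longrightarrow> l \<in> fst (L C) \<longleftrightarrow> int_encode l \<in> set rs"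
      "\<And>C rs ks l. (C, rs, ks) \<in> set cs \<Longrightarrow> l \<in> snd (L C) \<longleftrightarrow> int_encode l \<in> set ks"
    and \<nu>: "\<And>v. v \<in> free_vars \<phi> \<Longrightarrow> assoc \<nu>s (cvar_code v) = val M v"
    and V: "lanes_rep (view M) l h"
    and X: "X 1 = a" "X 3 = b" "\<And>C. C \<in> cars T \<Longrightarrow> X (Suc (pos_var C)) = P C"
      "\<And>C. C \<in> cars T \<Longrightarrow> X (Suc (end_var C)) = E C"
  shows "dnf_val X (violation_dnf \<phi> cs l h \<nu>s d) \<longleftrightarrow> (\<exists>M'. near T M (R d) L P E a b M' \<and> \<not> sat T M' \<phi>)"
proof -
  have odd: "Suc y \<notin> set (move_vars (map fst cs))" if "y \<in> set (move_vars (map fst cs))" for y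
  proof -
    have even: "even y" if "y \<in> set (move_vars (map fst cs))" for y
      using that by (auto simp: set_move_vars pos_var_def end_var_def)
    show ?thesis using even[of "Suc y"] even[OF that] by auto
  qed
  have one: "1 \<notin> set (move_vars (map fst cs))"
    using odd[of 0] by (simp add: set_move_vars)
  have set_Cs: "set (map fst cs) = cars T" by (simp add: cs(1))
  define close where "close Y \<longleftrightarrow> Y 0 \<le> Y 2 \<and> \<bar>a - Y 0\<bar> \<le> R d \<and> \<bar>b - Y 2\<bar> \<le> R d \<and>
      (\<forall>C\<in>cars T. Y (pos_var C) < Y (end_var C) \<and> \<bar>P C - Y (pos_var C)\<bar> \<le> R d \<and> \<bar>E C - Y (end_var C)\<bar> \<le> R d)"
    for Y
  have near_clause: "(\<forall>l\<in>set (near_clause (map fst cs) d). dlit_val Y l) \<longleftrightarrow> close Y"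
    if "\<forall>i. i \<notin> set (move_vars (map fst cs)) \<longrightarrow> Y i = X i" for Y
  proof -
    have Y: "Y (Suc y) = X (Suc y)" if "y \<in> set (move_vars (map fst cs))" for y
      using odd[OF that] \<open>\<forall>i. _\<close> by blast
    have abs: "\<bar>x - y\<bar> \<le> e \<longleftrightarrow> x + - e \<le> y \<and> y + - e \<le> x" for x y e :: real by auto
    have "(\<forall>l\<in>set (near_clause (map fst cs) d). dlit_val Y l) \<longleftrightarrow> Y 0 \<le> Y 2 \<and>
        (\<forall>C\<in>cars T. Y (pos_var C) < Y (end_var C)) \<and>
        (\<forall>y\<in>set (move_vars (map fst cs)). \<bar>X (Suc y) - Y y\<bar> \<le> R d)"
      using Y by (simp add: near_clause_def dlit_val_def ball_Un cs(1) abs)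
    also have "(\<forall>y\<in>set (move_vars (map fst cs)). \<bar>X (Suc y) - Y y\<bar> \<le> R d) \<longleftrightarrow>
        \<bar>a - Y 0\<bar> \<le> R d \<and> \<bar>b - Y 2\<bar> \<le> R d \<and>
        (\<forall>C\<in>cars T. \<bar>P C - Y (pos_var C)\<bar> \<le> R d \<and> \<bar>E C - Y (end_var C)\<bar> \<le> R d)"
      unfolding set_move_vars set_Cs using X by (auto simp: numeral_3_eq_3 numeral_2_eq_2)
    finally show ?thesis unfolding close_def by blast
  qed
  have "dnf_val X (violation_dnf \<phi> cs l h \<nu>s d) \<longleftrightarrow>
      (\<exists>Y. (\<forall>i. i \<notin> set (move_vars (map fst cs)) \<longrightarrow> Y i = X i) \<and>
        close Y \<and> \<not> dnf_val Y (mlsl_dnf \<phi> cs l h \<nu>s))"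
    unfolding violation_dnf_def dnf_val_elim[OF one] using near_clause by auto
  also have "\<dots> \<longleftrightarrow> (\<exists>M'. near T M (R d) L P E a b M' \<and> \<not> sat T M' \<phi>)"
  proof (intro iffI; elim exE conjE)
    fix Y
    assume "close Y"
      and nd: "\<not> dnf_val Y (mlsl_dnf \<phi> cs l h \<nu>s)"
    note Y = \<open>close Y\<close>[unfolded close_def]
    \<comment> \<open>Speeds and accelerations are visible neither to MLSL nor to
      \<open>d_model\<close>, so any values will do.\<close>
    define S where "S = \<lparr>pos = (\<lambda>C. Y (pos_var C)), len = (\<lambda>C. Y (end_var C) - Y (pos_var C)),
      spd = (\<lambda>_. 0), acc = (\<lambda>_. 0), res = (\<lambda>C. fst (L C)), clm = (\<lambda>C. snd (L C))\<rparr>"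
    define M' where "M' = \<lparr>snap = S, view = (view M)\<lparr>left := Y 0, right := Y 2\<rparr>, val = val M\<rparr>"
    define V0 where "V0 = (view M)\<lparr>lo := int l, hi := int h, left := Y 0, right := Y 2\<rparr>"
    have "near T M (R d) L P E a b M'"
      using M Y L by (auto simp: near_def M'_def S_def wf_model_def wf_snapshot_def wf_view_def lane_state_def)
    moreover have "dnf_val Y (mlsl_dnf \<phi> cs l h \<nu>s) \<longleftrightarrow> holds T S \<phi> V0 (val M)"
    proof (rule dnf_val_mlsl_dnf[OF cs(1)])
      show "assoc \<nu>s (cvar_code v) = val M v" if "v \<in> free_vars \<phi>" for v using \<nu> that .
    qed (use cs(2,3) Y V M in \<open>auto simp: S_def V0_def lanes_rep_def wf_model_def\<close>)
    moreover have "holds T S \<phi> V0 (val M) \<longleftrightarrow> sat T M' \<phi>"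
      unfolding sat_def M'_def model.simps using V
      by (intro holds_cong_view) (auto simp: V0_def lanes_rep_def)
    ultimately show "\<exists>M'. near T M (R d) L P E a b M' \<and> \<not> sat T M' \<phi>" using nd by blast
  next
    fix M' assume nr: "near T M (R d) L P E a b M'" and ns: "\<not> sat T M' \<phi>"
    \<comment> \<open>The values of \<open>M'\<close> are read off on the moved variables;
      \<open>THE\<close> inverts the injective numbering of the cars.\<close>
    define Y where "Y i = (if i = 0 then left (view M') else if i = 2 then right (view M')
      else if odd i then X i
      else if \<exists>C\<in>cars T. i = pos_var C then pos (snap M') (THE C. i = pos_var C)
      else if \<exists>C\<in>cars T. i = end_var C
        then pos (snap M') (THE C. i = end_var C) + len (snap M') (THE C. i = end_var C)
      else X i)" for i
    have vars: "pos_var C \<noteq> 0" "pos_var C \<noteq> 2" "even (pos_var C)" "end_var C \<noteq> 0" "end_var C \<noteq> 2"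
      "even (end_var C)" "pos_var C = pos_var D \<longleftrightarrow> C = D" "end_var C = end_var D \<longleftrightarrow> C = D"
      "end_var C \<noteq> pos_var D" for C D
      unfolding pos_var_def end_var_def by presburger+
    have Ys: "Y 0 = left (view M')" "Y 2 = right (view M')"
      "C \<in> cars T \<Longrightarrow> Y (pos_var C) = pos (snap M') C"
      "C \<in> cars T \<Longrightarrow> Y (end_var C) = pos (snap M') C + len (snap M') C" for C
      by (auto simp: Y_def vars)
    have out: "Y i = X i" if "i \<notin> set (move_vars (map fst cs))" for i
      using that unfolding set_move_vars set_Cs by (auto simp: Y_def)
    define V0 where "V0 = (view M')\<lparr>lo := int l, hi := int h\<rparr>"
    have lanes: "lane_state (snap M') C = L C" if "C \<in> cars T" for C
      using nr that by (simp add: near_def)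
    have wf: "wf_model T M'" using nr by (simp add: near_def)
    have "dnf_val Y (mlsl_dnf \<phi> cs l h \<nu>s) \<longleftrightarrow> holds T (snap M') \<phi> V0 (val M')"
    proof (rule dnf_val_mlsl_dnf[OF cs(1)])
      show "assoc \<nu>s (cvar_code v) = val M' v" if "v \<in> free_vars \<phi>" for v
        using \<nu>[OF that] nr by (simp add: near_def)
      show "x \<in> res (snap M') C \<longleftrightarrow> int_encode x \<in> set rs" if "(C, rs, ks) \<in> set cs" for C rs ks x
      proof -
        have "C \<in> cars T" using that unfolding cs(1) by force
        then have "fst (lane_state (snap M') C) = fst (L C)" by (simp add: lanes)
        then show ?thesis using cs(2)[OF that] by (simp add: lane_state_def)
      qed
      show "x \<in> clm (snap M') C \<longleftrightarrow> int_encode x \<in> set ks" if "(C, rs, ks) \<in> set cs" for C rs ks x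
      proof -
        have "C \<in> cars T" using that unfolding cs(1) by force
        then have "snd (lane_state (snap M') C) = snd (L C)" by (simp add: lanes)
        then show ?thesis using cs(3)[OF that] by (simp add: lane_state_def)
      qed
    qed (use Ys V wf in \<open>auto simp: V0_def lanes_rep_def wf_model_def wf_snapshot_def\<close>)
    moreover have "holds T (snap M') \<phi> V0 (val M') \<longleftrightarrow> sat T M' \<phi>"
    proof -
      have "{lo (view M)..hi (view M)} = {lo (view M')..hi (view M')}" using nr by (simp add: near_def)
      then have "lo (view M) = lo (view M') \<and> hi (view M) = hi (view M') \<or>
          hi (view M) < lo (view M) \<and> hi (view M') < lo (view M')"
        by (auto simp: Icc_eq_Icc)
      then show ?thesis unfolding sat_def using V
        by (intro holds_cong_view) (auto simp: V0_def lanes_rep_def)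
    qed
    moreover have "close Y"
      using nr by (auto simp: close_def Ys near_def wf_model_def wf_view_def wf_snapshot_def)
    ultimately show "\<exists>Y. (\<forall>i. i \<notin> set (move_vars (map fst cs)) \<longrightarrow> Y i = X i) \<and>
        close Y \<and> \<not> dnf_val Y (mlsl_dnf \<phi> cs l h \<nu>s)"
      using out ns by blast
  qed
  finally show ?thesis .
qed

end

section \<open>The decision procedure\<close>

text \<open>Piece \<open>k\<close> is the closed interval between the entries \<open>k\<close> and
  \<open>Suc k\<close> of \<open>ts\<close>; on it the trajectories are those after the first
  \<open>k\<close> letters.\<close>

lemma pieceD:
  assumes "sorted ts" "ts = 0 # map snd w @ [\<tau>]" "k \<le> length w" "ts ! k \<le> t" "t \<le> ts ! Suc k"
  shows "\<forall>x\<in>set (take k w). snd x \<le> t" "\<forall>x\<in>set (drop k w). t \<le> snd x" "0 \<le> t" "t \<le> \<tau>"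
proof -
  have len: "length ts = Suc (Suc (length w))" by (simp add: assms(2))
  have nth: "ts ! Suc i = snd (w ! i)" if "i < length w" for i
    using that by (simp add: assms(2) nth_append)
  have mono: "ts ! i \<le> ts ! j" if "i \<le> j" "j < length ts" for i j
    using assms(1) that by (rule sorted_nth_mono)
  show "\<forall>x\<in>set (take k w). snd x \<le> t"
  proof
    fix x assume "x \<in> set (take k w)"
    then obtain i where "i < k" "i < length w" "x = w ! i" by (auto simp: in_set_conv_nth)
    then show "snd x \<le> t" using mono[of "Suc i" k] nth[of i] assms(3,4) len by simp
  qed
  show "\<forall>x\<in>set (drop k w). t \<le> snd x"
  proof
    fix x assume "x \<in> set (drop k w)"
    then obtain i where "i < length w - k" "x = w ! (k + i)" by (auto simp: in_set_conv_nth)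
    moreover from this have "k + i < length w" by simp
    ultimately show "t \<le> snd x" using mono[of "Suc k" "Suc (k + i)"] nth[of "k + i"] assms(3,5) len by simp
  qed
  show "0 \<le> t" using mono[of 0 k] assms(2,3,4) len by simp
  have "ts ! Suc (length w) = \<tau>" by (simp add: assms(2) nth_append)
  then show "t \<le> \<tau>" using mono[of "Suc k" "Suc (length w)"] assms(3,5) len by simp
qed

lemma piece_exists:
  fixes w :: "(real action \<times> real) list"
  assumes "0 \<le> t" "t \<le> \<tau>"
  shows "\<exists>k\<le>length w. (0 # map snd w @ [\<tau>]) ! k \<le> t \<and> t \<le> (0 # map snd w @ [\<tau>]) ! Suc k"
proof -
  define k where "k = length (until t w)"
  have k: "k \<le> length w" by (simp add: k_def length_takeWhile_le)
  have "(0 # map snd w @ [\<tau>]) ! k \<le> t"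
  proof (cases k)
    case (Suc i)
    then have "i < length (until t w)" by (simp add: k_def)
    then have "w ! i \<in> set (until t w)" using takeWhile_nth nth_mem by metis
    then have "snd (w ! i) \<le> t" by (auto dest!: set_takeWhileD)
    then show ?thesis using Suc k by (simp add: nth_append)
  qed (use assms in simp)
  moreover have "t \<le> (0 # map snd w @ [\<tau>]) ! Suc k"
  proof (cases "k < length w")
    case True
    then have "\<not> snd (w ! k) \<le> t"
      using nth_length_takeWhile[of "\<lambda>(a, \<tau>). \<tau> \<le> t" w] by (simp add: k_def case_prod_beta)
    then show ?thesis using True by (simp add: nth_append)
  qed (use assms k in \<open>simp add: nth_append\<close>)
  ultimately show ?thesis using k by blast
qed

context named_field
begin

subsection \<open>Trajectories and lanes on codes\<close>

definition qreal :: "qpoly \<Rightarrow> quad" where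
  "qreal p = (R (fst p), R (fst (snd p)), R (snd (snd p)))"

lemma qval_qreal: "qval p t = quad_val (qreal p) t"
  by (simp add: qval_def quad_val_def qreal_def)

definition qaccelerate :: "nat \<Rightarrow> nat \<Rightarrow> qpoly \<Rightarrow> qpoly" where
  "qaccelerate a \<tau> q =
    (let b = ksub (kadd (fst (snd q)) (kmul (kmul ktwo (snd (snd q))) \<tau>)) (kmul a \<tau>); c = kdiv a ktwo
     in (ksub (ksub (kadd (kadd (fst q) (kmul (fst (snd q)) \<tau>)) (kmul (snd (snd q)) (kmul \<tau> \<tau>))) (kmul b \<tau>))
           (kmul c (kmul \<tau> \<tau>)), b, c))"

lemma qreal_accelerate: "qreal (qaccelerate a \<tau> q) = quad_accelerate (R a) (R \<tau>) (qreal q)"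
  by (simp add: qreal_def qaccelerate_def quad_accelerate_def Let_def)

definition tag :: "nat \<times> nat \<Rightarrow> nat" where "tag x = nth_or 0 (list_decode (fst x)) 0"
definition car_arg :: "nat \<times> nat \<Rightarrow> nat" where "car_arg x = nth_or 0 (list_decode (fst x)) 1"
definition data_arg :: "nat \<times> nat \<Rightarrow> nat" where "data_arg x = nth_or 0 (list_decode (fst x)) 2"

abbreviation code_word :: "(nat action \<times> nat) list \<Rightarrow> (nat \<times> nat) list" where
  "code_word w \<equiv> map (\<lambda>(a, t). (action_code a, t)) w"

abbreviation real_word :: "(nat action \<times> nat) list \<Rightarrow> (real action \<times> real) list" where
  "real_word w \<equiv> map (\<lambda>(a, t). (map_action R a, R t)) w"

definition qtraj :: "nat \<Rightarrow> (nat \<times> nat) list \<Rightarrow> qpoly \<Rightarrow> qpoly" where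
  "qtraj C w q = foldl (\<lambda>q x. if tag x = 4 \<and> car_arg x = C then qaccelerate (data_arg x) (snd x) q else q) q w"

lemma qreal_traj: "qreal (qtraj C (code_word w) q) = traj C (real_word w) (qreal q)"
proof (induction w arbitrary: q)
  case (Cons x w)
  obtain a t where x: "x = (a, t)" by fastforce
  have "qreal (if tag (action_code a, t) = 4 \<and> car_arg (action_code a, t) = C
      then qaccelerate (data_arg (action_code a, t)) t q else q) = traj_step C (map_action R a, R t) (qreal q)"
    by (cases a) (auto simp: tag_def car_arg_def data_arg_def qreal_accelerate)
  note step = this
  have "qtraj C (code_word (x # w)) q = qtraj C (code_word w)
      (if tag (action_code a, t) = 4 \<and> car_arg (action_code a, t) = C
       then qaccelerate (data_arg (action_code a, t)) t q else q)"
    by (simp add: qtraj_def x)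
  then have "qreal (qtraj C (code_word (x # w)) q) =
      traj C (real_word w) (traj_step C (map_action R a, R t) (qreal q))"
    by (simp only: Cons step)
  then show ?case by (simp add: traj_def x)
qed (simp add: qtraj_def traj_def)

definition kdisc :: "nat \<Rightarrow> nat \<times> nat \<Rightarrow> bool" where
  "kdisc C x \<longleftrightarrow> tag x \<noteq> 4 \<and> car_arg x = C"

lemma kdisc_code [simp]: "kdisc C (action_code a, t) \<longleftrightarrow> disc C (map_action R a)"
  by (cases a) (auto simp: kdisc_def disc_def tag_def car_arg_def)

definition klane_step :: "nat \<times> nat \<Rightarrow> nat list \<times> nat list \<Rightarrow> nat list \<times> nat list" where
  "klane_step x s = (if tag x = 0 then (fst s, [data_arg x])
     else if tag x = 1 then (fst s @ snd s, [])
     else if tag x = 2 then (fst s, []) else ([data_arg x], snd s))"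

definition klanes :: "nat \<Rightarrow> (nat \<times> nat) list \<Rightarrow> nat list \<times> nat list \<Rightarrow> nat list \<times> nat list" where
  "klanes C w s = foldl (\<lambda>s x. if kdisc C x then klane_step x s else s) s w"

definition codes_lanes :: "nat list \<times> nat list \<Rightarrow> lane set \<times> lane set \<Rightarrow> bool" where
  "codes_lanes s S \<longleftrightarrow> (\<forall>l. (l \<in> fst S \<longleftrightarrow> int_encode l \<in> set (fst s)) \<and> (l \<in> snd S \<longleftrightarrow> int_encode l \<in> set (snd s)))"

lemma codes_lanes_klanes:
  assumes "codes_lanes s S"
  shows "codes_lanes (klanes C (code_word w) s) (fold lane_step (filter (disc C) (map fst (real_word w))) S)"
  using assms
proof (induction w arbitrary: s S)
  case (Cons x w)
  obtain a t where x: "x = (a, t)" by fastforce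
  have "codes_lanes (klane_step (action_code a, t) s) (lane_step (map_action R a) S)"
    if "disc C (map_action R a)"
    using that Cons.prems
    by (cases a) (auto simp: codes_lanes_def klane_step_def tag_def data_arg_def disc_def int_encode_eq)
  with Cons show ?case by (simp add: klanes_def x)
qed (simp add: klanes_def)

subsection \<open>Enumeration of the cases\<close>

text \<open>All maps from the cars to \<open>{0..n}\<close> as association lists: by
  \<open>similar_of_window\<close> the prefix lengths of the cars may be chosen
  independently.\<close>

definition choices :: "nat \<Rightarrow> nat list \<Rightarrow> (nat \<times> nat) list list" where
  "choices n Cs = foldr (\<lambda>C chs. concat (map (\<lambda>m. map (\<lambda>ch. (C, m) # ch) chs) [0..<Suc n])) Cs [[]]"

lemma set_choices_Cons:
  "set (choices n (C # Cs)) = (\<Union>m\<in>{..n}. (\<lambda>ch. (C, m) # ch) ` set (choices n Cs))"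
  by (auto simp: choices_def less_Suc_eq_le simp del: upt_Suc)

lemma assoc_choice_le: "ch \<in> set (choices n Cs) \<Longrightarrow> C \<in> set Cs \<Longrightarrow> assoc ch C \<le> n"
proof (induction Cs arbitrary: ch)
  case (Cons D Cs)
  then obtain m ch' where "m \<le> n" "ch' \<in> set (choices n Cs)" "ch = (D, m) # ch'"
    by (auto simp: set_choices_Cons)
  with Cons show ?case by auto
qed simp

lemma choice_exists:
  "\<forall>C\<in>set Cs. m C \<le> n \<Longrightarrow> \<exists>ch\<in>set (choices n Cs). \<forall>C\<in>set Cs. assoc ch C = m C"
proof (induction Cs)
  case (Cons D Cs)
  then obtain ch where "ch \<in> set (choices n Cs)" "\<forall>C\<in>set Cs. assoc ch C = m C" by auto
  with Cons.prems show ?case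
    by (intro bexI[of _ "(D, m D) # ch"]) (auto simp: set_choices_Cons)
qed (simp add: choices_def)

definition qlookup :: "(nat \<times> qpoly) list \<Rightarrow> nat \<Rightarrow> qpoly" where
  "qlookup tab i = foldr (\<lambda>p r. if fst p = i then snd p else r) tab (kzero, kzero, kzero)"

text \<open>The input may list a car repeatedly, so a key can recur in the table. Agreement of its
  entries is enough.\<close>

lemma qlookup_unique:
  "(i, p) \<in> set tab \<Longrightarrow> (\<And>q. (i, q) \<in> set tab \<Longrightarrow> q = p) \<Longrightarrow> qlookup tab i = p"
proof (induction tab)
  case (Cons x tab)
  show ?case
  proof (cases "fst x = i")
    case True
    then have "(i, snd x) \<in> set (x # tab)" by (cases x) auto
    from Cons.prems(2)[OF this] show ?thesis using True by (simp add: qlookup_def)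
  next
    case False
    then have "(i, p) \<in> set tab" using Cons.prems(1) by auto
    moreover have "q = p" if "(i, q) \<in> set tab" for q using Cons.prems(2)[of q] that by simp
    ultimately have "qlookup tab i = p" by (rule Cons.IH)
    with False show ?thesis by (simp add: qlookup_def)
  qed
qed simp

definition qinst :: "(nat \<times> qpoly) list \<Rightarrow> dlit \<Rightarrow> bool \<times> qpoly" where
  "qinst tab l = (strict l, qadd (qadd (qlookup tab (src l)) (off l, kzero, kzero)) (qneg (qlookup tab (tgt l))))"

lemma qlit_val_qinst: "qlit_val t (qinst tab l) \<longleftrightarrow> dlit_val (\<lambda>i. qval (qlookup tab i) t) l"
proof -
  have "qval (off l, kzero, kzero) t = R (off l)" by (simp add: qval_def)
  then show ?thesis by (auto simp: qlit_val_def qinst_def dlit_val_def)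
qed

definition kwindow :: "nat \<Rightarrow> (nat \<times> nat) list \<Rightarrow> nat \<Rightarrow> nat \<Rightarrow> (bool \<times> qpoly) list" where
  "kwindow e w C m =
     map (\<lambda>x. (False, ksub (snd x) e, kneg kone, kzero)) (filter (kdisc C) (take m w)) @
     map (\<lambda>x. (True, kneg (kadd (snd x) e), kone, kzero)) (filter (kdisc C) (drop m w))"

lemma kwindow_iff:
  "(\<forall>l\<in>set (kwindow e (code_word w) C m). qlit_val t l) \<longleftrightarrow> window (R e) (real_word w) C m t"
proof -
  have "qlit_val t (False, ksub s e, kneg kone, kzero) \<longleftrightarrow> R s - R e \<le> t"
    "qlit_val t (True, kneg (kadd s e), kone, kzero) \<longleftrightarrow> t < R s + R e" for s
    by (auto simp: qlit_val_def qval_def)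
  then show ?thesis
    by (auto simp: kwindow_def window_def ball_Un take_map drop_map filter_map o_def case_prod_beta)
qed

text \<open>
  A record describes a car as in \<open>encodes\<close>: number, physical length, position, length, speed,
  acceleration, reserved lanes, claimed lanes.
\<close>

definition car_record :: "nat list list \<Rightarrow> nat \<Rightarrow> nat list" where
  "car_record css C = foldr (\<lambda>e r. if nth_or 0 e 0 = C then e else r) css []"

definition qpos :: "nat list list \<Rightarrow> (nat \<times> nat) list \<Rightarrow> nat \<Rightarrow> qpoly" where
  "qpos css w C = (let e = car_record css C in qtraj C w (nth_or 0 e 2, nth_or 0 e 4, kdiv (nth_or 0 e 5) ktwo))"

text \<open>The speed \<open>p1 + 2 * p2 * t\<close> is linear in time, so the braking distance, its
  square divided by \<open>b\<close>, is quadratic again and the ends stay within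
  \<open>qpoly\<close>.\<close>

definition qend :: "nat list list \<Rightarrow> nat \<Rightarrow> (nat \<times> nat) list \<Rightarrow> nat \<Rightarrow> qpoly" where
  "qend css b w C = (let p = qpos css w C; p1 = fst (snd p); p2 = snd (snd p) in
     qadd p (kadd (kdiv (kmul p1 p1) b) (nth_or 0 (car_record css C) 1),
       kdiv (kmul (kmul ktwo ktwo) (kmul p1 p2)) b, kdiv (kmul (kmul ktwo ktwo) (kmul p2 p2)) b))"

text \<open>The view moves with its owner: each of its ends, under the keys 1 and 3, is the owner's
  trajectory plus the initial distance from the owner.\<close>

definition base_table ::
  "nat list list \<Rightarrow> nat \<Rightarrow> nat \<Rightarrow> nat \<Rightarrow> nat \<Rightarrow> (nat \<times> nat) list \<Rightarrow> nat list \<Rightarrow> (nat \<times> qpoly) list" where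
  "base_table css b r t ow w Cs =
     (let p = qpos css w ow; x = nth_or 0 (car_record css ow) 2 in
      (1, qadd p (ksub r x, kzero, kzero)) # (3, qadd p (ksub t x, kzero, kzero)) #
      concat (map (\<lambda>C. [(Suc (pos_var C), qpos css w C), (Suc (end_var C), qend css b w C)]) Cs))"

text \<open>The first literal of each clause bounds the time from below by the start of the piece
  and thereby supplies the literal \<open>l\<^sub>0\<close> of \<open>qsat_iff\<close>.\<close>

definition case_clauses ::
  "mlsl \<Rightarrow> nat list list \<Rightarrow> nat \<Rightarrow> nat \<Rightarrow> nat \<Rightarrow> nat \<Rightarrow> nat \<Rightarrow> nat \<Rightarrow> (nat \<times> nat) list \<Rightarrow> (nat \<times> nat) list \<Rightarrow>
    nat \<Rightarrow> nat \<Rightarrow> nat \<Rightarrow> nat \<Rightarrow> (nat \<times> nat) list \<Rightarrow> (bool \<times> qpoly) list list" where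
  "case_clauses \<phi> css b l h r t ow \<nu> w \<tau> e d k ch =
    (let Cs = map (\<lambda>e. nth_or 0 e 0) css;
       ts = kzero # map snd w @ [\<tau>];
       lanes = map (\<lambda>C. (C, klanes C (take (assoc ch C) w)
         (list_decode (nth_or 0 (car_record css C) 6), list_decode (nth_or 0 (car_record css C) 7)))) Cs;
       tab = base_table css b r t ow (take k w) Cs
     in map (\<lambda>cl. (False, nth_or 0 ts k, kneg kone, kzero) # (False, kneg (nth_or 0 ts (Suc k)), kone, kzero) #
          concat (map (\<lambda>C. kwindow e w C (assoc ch C)) Cs) @ map (qinst tab) cl)
        (violation_dnf \<phi> lanes l h \<nu> d))"

text \<open>Lanes are passed on as natural numbers. An odd code is that of a negative bound; a
  well-formed view with such a bound has no lanes, and the empty interval from 1 to 0 takes its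
  place.\<close>

definition decide :: "mlsl \<Rightarrow> nat list \<Rightarrow> bool" where
  "decide \<phi> its =
    (let css = map list_decode (list_decode (nth_or 0 its 0));
       lc = nth_or 0 its 3; hc = nth_or 0 its 4;
       proper = (2 * (lc div 2) = lc \<and> 2 * (hc div 2) = hc);
       l = (if proper then lc div 2 else 1); h = (if proper then hc div 2 else 0);
       \<nu> = map prod_decode (list_decode (nth_or 0 its 8));
       w = map prod_decode (list_decode (nth_or 0 its 9))
     in \<not> list_ex (\<lambda>k. list_ex (\<lambda>ch. list_ex qsat
            (case_clauses \<phi> css (nth_or 0 its 2) l h (nth_or 0 its 5) (nth_or 0 its 6) (nth_or 0 its 7) \<nu> w
              (nth_or 0 its 10) (nth_or 0 its 12) (nth_or 0 its 13) k ch))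
          (choices (length w) (map (\<lambda>e. nth_or 0 e 0) css))) [0..<Suc (length w)])"

subsection \<open>Correctness\<close>

lemma car_record_unique:
  assumes "C \<in> (\<lambda>e. nth_or 0 e 0) ` set css"
  shows "car_record css C \<in> set css" "nth_or 0 (car_record css C) 0 = C"
proof -
  have "car_record css C \<in> set css \<and> nth_or 0 (car_record css C) 0 = C"
    using assms by (induction css) (auto simp: car_record_def)
  then show "car_record css C \<in> set css" "nth_or 0 (car_record css C) 0 = C" by auto
qed

lemma assoc_valuation:
  assumes "v \<in> fst ` set vs" "\<forall>(v, C)\<in>set vs. f v = C"
  shows "assoc (map (\<lambda>(v, C). (cvar_code v, C)) vs) (cvar_code v) = f v"
  using assms by (induction vs) auto

lemma lanes_rep_codes:
  assumes "wf_view T V" and "lc = int_encode (lo V)" "hc = int_encode (hi V)"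
    and "proper \<longleftrightarrow> 2 * (lc div 2) = lc \<and> 2 * (hc div 2) = hc"
  shows "lanes_rep V (if proper then lc div 2 else 1) (if proper then hc div 2 else 0)"
proof -
  have code: "if 0 \<le> i then int_encode i = 2 * nat i else int_encode i = Suc (2 * nat (- i - 1))" for i
    by (simp add: int_encode_def sum_encode_def)
  have pos: "0 < lo V" if "lo V \<le> hi V"
    using assms(1) that by (auto simp: wf_view_def lanes_def)
  show ?thesis
  proof (cases "0 \<le> lo V \<and> 0 \<le> hi V")
    case True
    then have "lc = 2 * nat (lo V)" "hc = 2 * nat (hi V)"
      using code[of "lo V"] code[of "hi V"] assms by auto
    moreover have "0 < lo V" using True pos by (cases "lo V \<le> hi V") auto
    ultimately show ?thesis using True assms(4) by (auto simp: lanes_rep_def)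
  next
    case False
    then have "hi V < lo V" using pos by linarith
    moreover have "\<not> proper"
      using False code[of "lo V"] code[of "hi V"] assms(2-4) by (auto split: if_splits)
    ultimately show ?thesis by (simp add: lanes_rep_def)
  qed
qed

lemma qval_qend:
  "qval (qend css b w C) t = qval (qpos css w C) t +
     ((quad_deriv (qreal (qpos css w C)) t)\<^sup>2 / R b + R (nth_or 0 (car_record css C) 1))"
proof -
  define p where "p = qpos css w C"
  have "(R (fst (snd p)) + 2 * R (snd (snd p)) * t)\<^sup>2 / R b =
      R (fst (snd p)) * R (fst (snd p)) / R b + 2 * 2 * (R (fst (snd p)) * R (snd (snd p))) / R b * t +
      2 * 2 * (R (snd (snd p)) * R (snd (snd p))) / R b * t\<^sup>2"
    by (simp add: power2_eq_square add_divide_distrib[symmetric] algebra_simps)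
  then show ?thesis
    unfolding qend_def Let_def p_def[symmetric]
    by (simp add: qval_def[of "(_, _, _)"] quad_deriv_def qreal_def)
qed

lemma decide_iff_robust:
  assumes T: "wf_traffic T" and M: "wf_model T M" and adm: "admissible T (snap M) \<rho>"
    and \<epsilon>: "0 < \<epsilon>" and sep: "separated T \<epsilon> \<rho>" and enc: "encodes R n T M \<rho> \<phi> \<epsilon> \<delta>"
  shows "decide \<phi> (list_decode n) \<longleftrightarrow> robust_globally_seq T \<epsilon> \<delta> \<rho> M \<phi>"
proof -
  from enc obtain cs :: "(car \<times> nat \<times> nat \<times> nat \<times> nat \<times> nat \<times> lane list \<times> lane list) list"
    and vs :: "(cvar \<times> car) list" and w :: "(nat action \<times> nat) list" and b r t \<tau> e d where
    n: "n = list_encode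
          [list_encode (map (\<lambda>(C, p, x, l, s, a, rs, ks).
             list_encode [C, p, x, l, s, a, lanes_code rs, lanes_code ks]) cs),
           nlanes T, b,
           int_encode (lo (view M)), int_encode (hi (view M)), r, t, owner (view M),
           list_encode (map (\<lambda>(v, C). prod_encode (cvar_code v, C)) vs),
           list_encode (map (\<lambda>(a, t). prod_encode (action_code a, t)) w), \<tau>,
           mlsl_code \<phi>, e, d]"
    and cars: "cars T = fst ` set cs"
    and cs: "\<forall>(C, p, x, l, s, a, rs, ks)\<in>set cs.
           plen T C = R p \<and> pos (snap M) C = R x \<and> len (snap M) C = R l \<and>
           spd (snap M) C = R s \<and> acc (snap M) C = R a \<and>
           res (snap M) C = set rs \<and> clm (snap M) C = set ks"
    and bnds: "bmax T = R b" "left (view M) = R r" "right (view M) = R t"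
    and vs: "free_vars \<phi> \<subseteq> fst ` set vs" "\<forall>(v, C)\<in>set vs. val M v = C"
    and \<rho>: "\<rho> = (real_word w, R \<tau>)" and \<epsilon>\<delta>: "\<epsilon> = R e" "\<delta> = R d"
    unfolding encodes_def by blast
  define css where "css = map (\<lambda>(C, p, x, l, s, a, rs, ks). [C, p, x, l, s, a, lanes_code rs, lanes_code ks]) cs"
  define \<nu>s where "\<nu>s = map (\<lambda>(v, C). (cvar_code v, C)) vs"
  define Cs where "Cs = map (\<lambda>e. nth_or 0 e 0) css"
  define lc hc where "lc = int_encode (lo (view M))" and "hc = int_encode (hi (view M))"
  define proper where "proper \<longleftrightarrow> 2 * (lc div 2) = lc \<and> 2 * (hc div 2) = hc"
  define l h where "l = (if proper then lc div 2 else 1)" and "h = (if proper then hc div 2 else 0)"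
  define E where "E = owner (view M)"
  have its: "list_decode n = [list_encode (map list_encode css), nlanes T, b, lc, hc, r, t, E,
      list_encode (map prod_encode \<nu>s), list_encode (map prod_encode (code_word w)), \<tau>, mlsl_code \<phi>, e, d]"
  proof -
    have "map list_encode css = map (\<lambda>(C, p, x, l, s, a, rs, ks).
        list_encode [C, p, x, l, s, a, lanes_code rs, lanes_code ks]) cs"
      "map prod_encode \<nu>s = map (\<lambda>(v, C). prod_encode (cvar_code v, C)) vs"
      "map prod_encode (code_word w) = map (\<lambda>(a, t). prod_encode (action_code a, t)) w"
      by (auto simp: css_def \<nu>s_def simp del: list_encode.simps)
    then show ?thesis unfolding n list_encode_inverse lc_def hc_def E_def by (simp only:)
  qed
  have len_w: "length (code_word w) = length (real_word w)" by simp
  have dec: "decide \<phi> (list_decode n) \<longleftrightarrow> \<not> (\<exists>k\<le>length w. \<exists>ch\<in>set (choices (length w) Cs).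
      \<exists>cl\<in>set (case_clauses \<phi> css b l h r t E \<nu>s (code_word w) \<tau> e d k ch). qsat cl)"
  proof -
    define its where "its = list_decode n"
    note its = its[folded its_def]
    have nths: "map list_decode (list_decode (nth_or 0 its 0)) = css" "nth_or 0 its 2 = b"
      "nth_or 0 its 3 = lc" "nth_or 0 its 4 = hc" "nth_or 0 its 5 = r" "nth_or 0 its 6 = t" "nth_or 0 its 7 = E"
      "map prod_decode (list_decode (nth_or 0 its 8)) = \<nu>s"
      "map prod_decode (list_decode (nth_or 0 its 9)) = code_word w"
      "nth_or 0 its 10 = \<tau>" "nth_or 0 its 12 = e" "nth_or 0 its 13 = d"
      by (simp_all add: its o_def case_prod_beta)
    have "decide \<phi> its \<longleftrightarrow> \<not> list_ex (\<lambda>k. list_ex (\<lambda>ch. list_ex qsat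
        (case_clauses \<phi> css b l h r t E \<nu>s (code_word w) \<tau> e d k ch))
        (choices (length (code_word w)) Cs)) [0..<Suc (length (code_word w))]"
      unfolding decide_def Let_def nths Cs_def l_def h_def proper_def by (rule refl)
    then show ?thesis unfolding its_def by (auto simp: list_ex_iff less_Suc_eq_le simp del: upt_Suc)
  qed
  have set_Cs: "set Cs = cars T"
    unfolding Cs_def css_def cars by (force simp: image_iff)
  have rec: "\<exists>p x l s a rs ks. car_record css C = [C, p, x, l, s, a, lanes_code rs, lanes_code ks] \<and>
      plen T C = R p \<and> pos (snap M) C = R x \<and> spd (snap M) C = R s \<and> acc (snap M) C = R a \<and>
      res (snap M) C = set rs \<and> clm (snap M) C = set ks" if "C \<in> cars T" for C
  proof -
    have "C \<in> (\<lambda>e. nth_or 0 e 0) ` set css" using that set_Cs by (simp add: Cs_def)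
    from car_record_unique[OF this] show ?thesis
      using cs unfolding css_def by fastforce
  qed
  have init: "qreal (let e = car_record css C in (nth_or 0 e 2, nth_or 0 e 4, kdiv (nth_or 0 e 5) ktwo)) =
      init_quad (snap M) C" if "C \<in> cars T" for C
    using rec[OF that] by (auto simp: qreal_def init_quad_def Let_def)
  have codes: "codes_lanes (list_decode (nth_or 0 (car_record css C) 6), list_decode (nth_or 0 (car_record css C) 7))
      (lane_state (snap M) C)" if "C \<in> cars T" for C
    using rec[OF that] by (auto simp: codes_lanes_def lane_state_def lanes_code_def int_encode_eq)
  have wf: "sorted (map snd (real_word w))" "sorted (0 # map snd (real_word w) @ [R \<tau>])"
    and alph: "fst ` set (real_word w) \<subseteq> alphabet T"
    using adm by (auto simp: admissible_def wf_timed_word_def \<rho> sorted_append)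
  have lrep: "lanes_rep (view M) l h"
    unfolding l_def h_def
    by (rule lanes_rep_codes[where T = T, OF _ lc_def hc_def proper_def]) (use M in \<open>simp add: wf_model_def\<close>)
  define viol where "viol ch = violated T M \<rho> \<delta> \<phi> (\<lambda>C. lanes_after M (take (assoc ch C) (real_word w)) C)" for ch
  define rts where "rts = 0 # map snd (real_word w) @ [R \<tau>]"
  have E_car: "E \<in> cars T" using M by (simp add: wf_model_def wf_view_def E_def)
  have piece: "(\<exists>cl\<in>set (case_clauses \<phi> css b l h r t E \<nu>s (code_word w) \<tau> e d k ch). qsat cl) \<longleftrightarrow>
      (\<exists>x. rts ! k \<le> x \<and> x \<le> rts ! Suc k \<and>
        (\<forall>C\<in>cars T. window \<epsilon> (real_word w) C (assoc ch C) x) \<and>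
        viol ch x)"
    if k: "k \<le> length w" for k ch
  proof -
    define ts where "ts = kzero # map snd (code_word w) @ [\<tau>]"
    define lns where "lns = map (\<lambda>C. (C, klanes C (take (assoc ch C) (code_word w))
         (list_decode (nth_or 0 (car_record css C) 6), list_decode (nth_or 0 (car_record css C) 7)))) Cs"
    define tab where "tab = base_table css b r t E (take k (code_word w)) Cs"
    define D where "D = violation_dnf \<phi> lns l h \<nu>s d"
    define win where "win = concat (map (\<lambda>C. kwindow e (code_word w) C (assoc ch C)) Cs)"
    define full where "full cl = (False, nth_or 0 ts k, kneg kone, kzero) #
      (False, kneg (nth_or 0 ts (Suc k)), kone, kzero) # win @ map (qinst tab) cl" for cl
    have cc: "case_clauses \<phi> css b l h r t E \<nu>s (code_word w) \<tau> e d k ch = map full D"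
      by (simp add: case_clauses_def Let_def full_def[abs_def] Cs_def ts_def lns_def tab_def D_def win_def)
    have R_ts: "R (nth_or 0 ts i) = rts ! i" if "i \<le> Suc (length w)" for i
    proof -
      have "length ts = Suc (Suc (length w))" "map R ts = rts"
        by (simp_all add: ts_def rts_def case_prod_beta)
      then show ?thesis using that nth_map[of i ts R] by (simp add: nth_or_nth)
    qed
    have qsat_full: "qsat (full cl) \<longleftrightarrow> (\<exists>x. rts ! k \<le> x \<and> x \<le> rts ! Suc k \<and>
        (\<forall>C\<in>cars T. window \<epsilon> (real_word w) C (assoc ch C) x) \<and>
        (\<forall>l\<in>set cl. dlit_val (\<lambda>i. qval (qlookup tab i) x) l))" for cl
    proof -
      have "qsat (full cl) \<longleftrightarrow> (\<exists>x. \<forall>l\<in>set (full cl). qlit_val x l)"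
        by (rule qsat_iff[of "(False, nth_or 0 ts k, kneg kone, kzero)" _ "R (nth_or 0 ts k)"])
          (simp_all add: full_def qval_def)
      moreover have "(\<forall>l\<in>set win. qlit_val x l) \<longleftrightarrow> (\<forall>C\<in>cars T. window \<epsilon> (real_word w) C (assoc ch C) x)" for x
        using kwindow_iff[where e = e and w = w and t = x] by (simp add: win_def \<epsilon>\<delta> flip: set_Cs)
      moreover have "qlit_val x (False, nth_or 0 ts k, kneg kone, kzero) \<longleftrightarrow> rts ! k \<le> x"
        "qlit_val x (False, kneg (nth_or 0 ts (Suc k)), kone, kzero) \<longleftrightarrow> x \<le> rts ! Suc k" for x
        using R_ts[of k] R_ts[of "Suc k"] k by (auto simp: qlit_val_def qval_def)
      ultimately show ?thesis by (simp add: full_def ball_Un qlit_val_qinst)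
    qed
    \<comment> \<open>The table holds the trajectories after the first \<open>k\<close> letters,
      which are correct on the whole piece, end points included, by
      \<open>traj_prefix\<close>.\<close>
    have dnf_viol: "dnf_val (\<lambda>i. qval (qlookup tab i) x) D \<longleftrightarrow>
        viol ch x"
      if x: "rts ! k \<le> x" "x \<le> rts ! Suc k" for x
    proof -
      note pc = pieceD[OF wf(2)[folded rts_def] rts_def _ x]
      have k': "k \<le> length (real_word w)" using k by simp
      have pos: "qval (qpos css (take k (code_word w)) C) x = pos_at M \<rho> C x"
        and der: "quad_deriv (qreal (qpos css (take k (code_word w)) C)) x =
          quad_deriv (traj C (until x (real_word w)) (init_quad (snap M) C)) x" if "C \<in> cars T" for C
      proof -
        have "qreal (qpos css (take k (code_word w)) C) = traj C (take k (real_word w)) (init_quad (snap M) C)"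
          unfolding qpos_def take_map by (simp add: Let_def qreal_traj init[OF that, unfolded Let_def])
        then show "qval (qpos css (take k (code_word w)) C) x = pos_at M \<rho> C x"
          "quad_deriv (qreal (qpos css (take k (code_word w)) C)) x =
          quad_deriv (traj C (until x (real_word w)) (init_quad (snap M) C)) x"
          using traj_prefix[OF wf(1) pc(1,2)[OF k']]
          by (simp_all add: qval_qreal pos_at_def \<rho>)
      qed
      have "plen T C = R (nth_or 0 (car_record css C) 1)" if "C \<in> cars T" for C
        using rec[OF that] by auto
      then have end_eq: "qval (qend css b (take k (code_word w)) C) x = end_at T M \<rho> C x" if "C \<in> cars T" for C
        using that by (simp add: qval_qend pos der end_at_def bnds \<rho>)
      have vars: "Suc (pos_var C) \<noteq> 1" "Suc (pos_var C) \<noteq> 3" "Suc (end_var C) \<noteq> 1" "Suc (end_var C) \<noteq> 3"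
        "pos_var C \<noteq> 0" "end_var C \<noteq> 0" "pos_var C \<noteq> 2" "end_var C \<noteq> 2"
        "pos_var C = pos_var C' \<longleftrightarrow> C = C'" "end_var C = end_var C' \<longleftrightarrow> C = C'" "pos_var C \<noteq> end_var C'" "end_var C \<noteq> pos_var C'" for C C'
        unfolding pos_var_def end_var_def by presburger+
      show ?thesis unfolding D_def viol_def violated_def \<epsilon>\<delta>
      proof (rule violation_dnf_iff[OF M])
        have "fst ` set (take (assoc ch C) (real_word w)) \<subseteq> alphabet T" for C
          using alph by (meson image_mono order_trans set_take_subset)
        then show "fst (lanes_after M (take (assoc ch C) (real_word w)) C) \<subseteq> lanes T \<and>
            snd (lanes_after M (take (assoc ch C) (real_word w)) C) \<subseteq> lanes T" if "C \<in> cars T" for C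
          using lanes_after_subset[OF M _ that] by blast
        show "cars T = fst ` set lns" by (simp add: lns_def image_image set_Cs)
        have cl: "codes_lanes (rs, ks) (lanes_after M (take (assoc ch C) (real_word w)) C)"
          if "(C, rs, ks) \<in> set lns" for C rs ks
        proof -
          have C: "C \<in> cars T" and eq: "(rs, ks) = klanes C (code_word (take (assoc ch C) w))
             (list_decode (nth_or 0 (car_record css C) 6), list_decode (nth_or 0 (car_record css C) 7))"
            using that by (auto simp: lns_def set_Cs take_map)
          show ?thesis
            unfolding eq lanes_after_def take_map by (rule codes_lanes_klanes[OF codes[OF C]])
        qed
        show "x \<in> fst (lanes_after M (take (assoc ch C) (real_word w)) C) \<longleftrightarrow> int_encode x \<in> set rs"
          if "(C, rs, ks) \<in> set lns" for C rs ks x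
          using cl[OF that] by (simp add: codes_lanes_def)
        show "x \<in> snd (lanes_after M (take (assoc ch C) (real_word w)) C) \<longleftrightarrow> int_encode x \<in> set ks"
          if "(C, rs, ks) \<in> set lns" for C rs ks x
          using cl[OF that] by (simp add: codes_lanes_def)
        show "assoc \<nu>s (cvar_code v) = val M v" if "v \<in> free_vars \<phi>" for v
          unfolding \<nu>s_def using vs that by (intro assoc_valuation) auto
        show "lanes_rep (view M) l h" by (rule lrep)
        have xE: "R (nth_or 0 (car_record css E) 2) = pos (snap M) E" using rec[OF E_car] by auto
        have shift: "qval (qadd (qpos css (take k (code_word w)) E) (ksub y (nth_or 0 (car_record css E) 2), kzero, kzero)) x =
            R y + shift_at M \<rho> x" for y
          using pos[OF E_car] xE by (simp add: qval_def[of "(_, _, _)"] shift_at_def E_def)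
        have "qlookup tab 1 = qadd (qpos css (take k (code_word w)) E) (ksub r (nth_or 0 (car_record css E) 2), kzero, kzero)"
          by (rule qlookup_unique) (use vars in \<open>auto simp: tab_def base_table_def Let_def dest: sym\<close>)
        then show "qval (qlookup tab 1) x = left (view M) + shift_at M \<rho> x"
          by (simp only: shift bnds)
        have "qlookup tab 3 = qadd (qpos css (take k (code_word w)) E) (ksub t (nth_or 0 (car_record css E) 2), kzero, kzero)"
          by (rule qlookup_unique) (use vars in \<open>auto simp: tab_def base_table_def Let_def dest: sym\<close>)
        then show "qval (qlookup tab 3) x = right (view M) + shift_at M \<rho> x"
          by (simp only: shift bnds)
        show "qval (qlookup tab (Suc (pos_var C))) x = pos_at M \<rho> C x" if "C \<in> cars T" for C
        proof -
          have "qlookup tab (Suc (pos_var C)) = qpos css (take k (code_word w)) C"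
            by (rule qlookup_unique)
              (use vars that set_Cs in \<open>auto simp: tab_def base_table_def Let_def\<close>)
          then show ?thesis using pos[OF that] by simp
        qed
        show "qval (qlookup tab (Suc (end_var C))) x = end_at T M \<rho> C x" if "C \<in> cars T" for C
        proof -
          have "qlookup tab (Suc (end_var C)) = qend css b (take k (code_word w)) C"
            by (rule qlookup_unique)
              (use vars that set_Cs in \<open>auto simp: tab_def base_table_def Let_def\<close>)
          then show ?thesis using end_eq[OF that] by simp
        qed
      qed
    qed
    have "(\<exists>cl\<in>set (map full D). qsat cl) \<longleftrightarrow> (\<exists>x. rts ! k \<le> x \<and> x \<le> rts ! Suc k \<and>
        (\<forall>C\<in>cars T. window \<epsilon> (real_word w) C (assoc ch C) x) \<and> dnf_val (\<lambda>i. qval (qlookup tab i) x) D)"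
      unfolding dnf_val_def using qsat_full by auto
    then show ?thesis unfolding cc using dnf_viol by blast
  qed
  have "\<not> decide \<phi> (list_decode n) \<longleftrightarrow> (\<exists>k\<le>length w. \<exists>ch\<in>set (choices (length w) Cs). \<exists>x.
        rts ! k \<le> x \<and> x \<le> rts ! Suc k \<and>
        (\<forall>C\<in>cars T. window \<epsilon> (real_word w) C (assoc ch C) x) \<and>
        viol ch x)"
    unfolding dec not_not by (intro ex_cong1 conj_cong bex_cong refl piece)
  also have "\<dots> \<longleftrightarrow> \<not> robust_globally_seq T \<epsilon> \<delta> \<rho> M \<phi>"
    unfolding robust_globally_seq_iff[OF T M adm \<epsilon> sep]
  proof (intro iffI; elim exE conjE bexE)
    fix k ch x
    assume k: "k \<le> length w" and ch: "ch \<in> set (choices (length w) Cs)"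
      and x: "rts ! k \<le> x" "x \<le> rts ! Suc k"
      and win: "\<forall>C\<in>cars T. window \<epsilon> (real_word w) C (assoc ch C) x"
      and viol: "viol ch x"
    have k': "k \<le> length (real_word w)" using k by simp
    show "\<exists>t m. 0 \<le> t \<and> t \<le> snd \<rho> \<and> (\<forall>C\<in>cars T. m C \<le> length (fst \<rho>) \<and> window \<epsilon> (fst \<rho>) C (m C) t) \<and>
        violated T M \<rho> \<delta> \<phi> (\<lambda>C. lanes_after M (take (m C) (fst \<rho>)) C) t"
      using pieceD(3,4)[OF wf(2)[folded rts_def] rts_def k' x] win viol[unfolded viol_def] assoc_choice_le[OF ch] set_Cs
      by (intro exI[of _ x] exI[of _ "assoc ch"]) (auto simp: \<rho>)
  next
    fix x m
    assume x: "0 \<le> x" "x \<le> snd \<rho>"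
      and m: "\<forall>C\<in>cars T. m C \<le> length (fst \<rho>) \<and> window \<epsilon> (fst \<rho>) C (m C) x"
      and viol: "violated T M \<rho> \<delta> \<phi> (\<lambda>C. lanes_after M (take (m C) (fst \<rho>)) C) x"
    obtain k where k: "k \<le> length w" "rts ! k \<le> x" "x \<le> rts ! Suc k"
      using piece_exists[of x "R \<tau>" "real_word w"] x by (auto simp: \<rho> rts_def)
    obtain ch where ch: "ch \<in> set (choices (length w) Cs)" "\<forall>C\<in>cars T. assoc ch C = m C"
      using choice_exists[of Cs m "length w"] m set_Cs by (auto simp: \<rho>)
    have "viol ch x"
      unfolding viol_def by (rule iffD1[OF violated_cong viol]) (simp add: ch(2) \<rho>)
    moreover have "\<forall>C\<in>cars T. window \<epsilon> (real_word w) C (assoc ch C) x"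
      using m ch(2) by (simp add: \<rho>)
    ultimately show "\<exists>k\<le>length w. \<exists>ch\<in>set (choices (length w) Cs). \<exists>x.
        rts ! k \<le> x \<and> x \<le> rts ! Suc k \<and> (\<forall>C\<in>cars T. window \<epsilon> (real_word w) C (assoc ch C) x) \<and>
        viol ch x"
      using k ch(1) by blast
  qed
  finally show ?thesis by blast
qed

end

subsection \<open>Computability of the decision procedure\<close>

context named_field
begin

lemma computable_letter [computable_intros]:
  assumes "computable x"
  shows "computable (\<lambda>z. tag (x z))" "computable (\<lambda>z. car_arg (x z))" "computable (\<lambda>z. data_arg (x z))"
  unfolding tag_def car_arg_def data_arg_def by (intro computable_intros assms)+

lemma computable_kdisc [computable_intros]:
  assumes "computable C" "computable x" shows "computable (\<lambda>z. kdisc (C z) (x z))"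
  unfolding kdisc_def by (intro computable_intros assms)

lemma computable_qtraj [computable_intros]:
  assumes "computable C" "computable w" "computable q" shows "computable (\<lambda>z. qtraj (C z) (w z) (q z))"
  by (rule computable_compose3[OF _ assms], unfold qtraj_def qaccelerate_def) (intro computable_intros)

lemma computable_klanes [computable_intros]:
  assumes "computable C" "computable w" "computable s" shows "computable (\<lambda>z. klanes (C z) (w z) (s z))"
  by (rule computable_compose3[OF _ assms], unfold klanes_def klane_step_def) (intro computable_intros)

lemma computable_choices [computable_intros]:
  assumes "computable n" "computable Cs" shows "computable (\<lambda>z. choices (n z) (Cs z))"
  by (rule computable_compose2[OF _ assms], unfold choices_def) (intro computable_intros)

lemma computable_qinst [computable_intros]:
  assumes "computable f" "computable l" shows "computable (\<lambda>z. qinst (f z) (l z))"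
  by (rule computable_compose2[OF _ assms], unfold qinst_def qlookup_def) (intro computable_intros)

lemma computable_kwindow [computable_intros]:
  assumes "computable e" "computable w" "computable C" "computable m"
  shows "computable (\<lambda>z. kwindow (e z) (w z) (C z) (m z))"
proof -
  have "computable (\<lambda>p. kwindow (fst (fst p)) (snd (fst p)) (fst (snd p)) (snd (snd p)))"
    unfolding kwindow_def by (intro computable_intros computable_drop)
  from computable_compose[OF this computable_Pair[OF computable_Pair[OF assms(1,2)] computable_Pair[OF assms(3,4)]]]
  show ?thesis by simp
qed

lemma computable_car_record [computable_intros]:
  assumes "computable css" "computable C" shows "computable (\<lambda>z. car_record (css z) (C z))"
  by (rule computable_compose2[OF _ assms], unfold car_record_def) (intro computable_intros)

lemma computable_qpos [computable_intros]:
  assumes "computable css" "computable w" "computable C" shows "computable (\<lambda>z. qpos (css z) (w z) (C z))"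
  by (rule computable_compose3[OF _ assms], unfold qpos_def) (intro computable_intros)

lemma computable_qend [computable_intros]:
  assumes "computable css" "computable b" "computable w" "computable C"
  shows "computable (\<lambda>z. qend (css z) (b z) (w z) (C z))"
proof -
  have "computable (\<lambda>p. qend (fst (fst p)) (snd (fst p)) (fst (snd p)) (snd (snd p)))"
    unfolding qend_def by (intro computable_intros)
  from computable_compose[OF this computable_Pair[OF computable_Pair[OF assms(1,2)] computable_Pair[OF assms(3,4)]]]
  show ?thesis by simp
qed

lemma computable_violation_dnf [computable_intros]:
  assumes "computable \<phi>" "computable cs" "computable l" "computable h" "computable \<nu>" "computable d"
  shows "computable (\<lambda>z. violation_dnf (\<phi> z) (cs z) (l z) (h z) (\<nu> z) (d z))"
proof -
  have move_vars: "computable (\<lambda>z. move_vars (f z))" if "computable f" for f :: "'x::enc \<Rightarrow> nat list"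
    unfolding move_vars_def by (intro computable_intros that)
  have near_clause: "computable (\<lambda>z. near_clause (f z) (g z))" if "computable f" "computable g"
    for f :: "'x::enc \<Rightarrow> nat list" and g
    by (rule computable_compose2[OF _ that], unfold near_clause_def) (intro computable_intros move_vars)
  show ?thesis
    unfolding violation_dnf_def by (intro computable_intros assms move_vars near_clause)
qed

lemma computable_decide: "computable (\<lambda>p. decide (fst p) (snd p))"
  unfolding decide_def case_clauses_def base_table_def by (intro computable_intros)

end

theorem mainTheorem2:
  fixes R :: "nat \<Rightarrow> real"
  assumes "constructive_field R"
  shows "\<exists>p. \<forall>n T M \<rho> \<phi> \<epsilon> \<delta>.
    wf_traffic T \<and> wf_model T M \<and> admissible T (snap M) \<rho> \<and>
    0 < \<epsilon> \<and> 0 < \<delta> \<and> separated T \<epsilon> \<rho> \<and>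
    encodes R n T M \<rho> \<phi> \<epsilon> \<delta> \<longrightarrow>
    computes p [n] (if robust_globally_seq T \<epsilon> \<delta> \<rho> M \<phi> then 1 else 0)"
proof -
  obtain kadd ksub kmul kdiv kone where "named_field R kadd ksub kmul kdiv kone"
    using named_field_of_constructive_field[OF assms] by blast
  then interpret named_field R kadd ksub kmul kdiv kone .
  obtain g where "realizes g (\<lambda>p. decide (fst p) (snd p))" using computableD[OF computable_decide] by blast
  note g = realizesD[OF this]
  have "computable (\<lambda>n. nth_or 0 (list_decode n) 11)" by (intro computable_intros)
  then have "computable_on 1 (\<lambda>xs. nth_or 0 (list_decode (xs ! 0)) 11)"
    unfolding computable_nat_iff .
  \<comment> \<open>Entry 11 of the input already is the code of the formula, and \<open>n\<close>
    itself is the code of \<open>list_decode n\<close>, so the argument of \<open>decide\<close>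
    needs no further translation.\<close>
  then have "computable_on 1 (\<lambda>xs. g (prod_encode (nth_or 0 (list_decode (xs ! 0)) 11, xs ! 0)))"
    by (intro g comp_intros) simp_all
  then obtain p where p: "\<And>xs. length xs = 1 \<Longrightarrow>
      computes p xs (g (prod_encode (nth_or 0 (list_decode (xs ! 0)) 11, xs ! 0)))"
    unfolding computable_on_def by blast
  have "computes p [n] (if robust_globally_seq T \<epsilon> \<delta> \<rho> M \<phi> then 1 else 0)"
    if "wf_traffic T" "wf_model T M" "admissible T (snap M) \<rho>" "0 < \<epsilon>" "separated T \<epsilon> \<rho>"
      "encodes R n T M \<rho> \<phi> \<epsilon> \<delta>" for n T M \<rho> \<phi> \<epsilon> \<delta>
  proof -
    have "nth_or 0 (list_decode n) 11 = mlsl_code \<phi>"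
      using that(6) unfolding encodes_def by (auto simp del: list_encode.simps)
    then have "g (prod_encode (nth_or 0 (list_decode n) 11, n)) = enc (decide \<phi> (list_decode n))"
      using g(2)[of "(\<phi>, list_decode n)"] by (simp add: enc_prod_def enc_mlsl_def enc_list_def)
    then show ?thesis
      using p[of "[n]"] decide_iff_robust[OF that] by (auto simp: enc_bool_def)
  qed
  then show ?thesis by blast
qed

end
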